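(* Let $n\ge 2$ and let $\mathbf a=(a_0,\dots,a_n)$ be a tuple of positive integers. (1) The toric vector bundle $\mathcal E_{\mathbf a}$ on $\mathbb P^n$ corresponds to the pair $(L_n,D_{\mathbf a})$, where $L_n\subset\mathbb C[y_0,\dots,y_n]$ is the ideal generated by $y_0+\cdots+y_n$ and $D_{\mathbf a}$ is the $(n+1)\times(n+1)$ diagonal matrix with diagonal entries $a_0,\dots,a_n$. (2) The dual bundle $\mathcal E_{\mathbf a}^\vee$ corresponds to the pair $(L_n^\vee,D_{\mathbf a}^\vee)$, where $L_n^\vee\subset\mathbb C[z_{ij}\mid 0\le i<j\le n]$ is the ideal generated by the linear forms $z_{ik}-z_{ij}-z_{jk}$ for all $0\le i<j<k\le n$, and $D_{\mathbf a}^\vee$ is the matrix with rows indexed by $i\in\{0,\dots,n\}$ and columns indexed by pairs $jk$ with $0\le j<k\le n$, whose $(i,jk)$ entry is $0$ if $i\notin\{j,k\}$ and $-a_i$ if $i\in\{j,k\}$.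
   Context: Work over $\mathbb C$. The torus $T=(\mathbb C^* )^n$ acts on $\mathbb P^n$ in the usual way; $x_0,\dots,x_n$ are homogeneous coordinates, $H_i=\{x_i=0\}$, and the fan $\Sigma_n$ of $\mathbb P^n$ has ray generators $\mathbf e_0,\dots,\mathbf e_n$ with $\mathbf e_0=-\sum_{i=1}^n\mathbf e_i$, where $\mathbf e_i$ corresponds to $H_i$. A toric vector bundle is a vector bundle with a $T$-action, linear on fibers, lifting the action on the base. The bundle $\mathcal E_{\mathbf a}$ is the rank $n$ toric vector bundle which is the cokernel of the $T$-equivariant map $\mathcal O\to\bigoplus_{j=0}^n\mathcal O(a_jH_j)\cong\bigoplus_{j=0}^n\mathcal O(a_j)$ given by $1\mapsto(x_0^{a_0},\dots,x_n^{a_n})$. Klyachko filtrations: a toric vector bundle $\mathcal E$ on $\mathbb P^n$ with fiber $E$ over the identity of $T\subset\mathbb P^n$ is determined by decreasing $\mathbb Z$-filtrations $(F^i_r)_{r\in\mathbb Z}$ of $E$, one for each ray $\mathbf e_i$, $0\le i\le n$, with the convention that for the line bundle $\mathcal O(\sum_i r_iH_i)$ one has $F^i_r=E$ for $r\le r_i$ and $F^i_r=0$ for $r>r_i$. For each maximal cone $\sigma$ there is a basis $\mathbb B_\sigma$ of $E$ (an adapted basis) such that every $F^i_r$ with $\mathbf e_i\in\sigma$ is spanned by a subset of $\mathbb B_\sigma$. A toric vector bundle $\mathcal E$ corresponds to the pair $(L,D)$, where $L\subset\mathbb C[y_1,\dots,y_m]$ is an ideal generated by linear forms and $D$ is an integral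 $(n+1)\times m$ matrix (the diagram), if there is a spanning set $b_1,\dots,b_m$ of $E$ containing an adapted basis $\mathbb B_\sigma$ for each maximal cone $\sigma$, such that $L$ is the kernel of $\mathbb C[y_1,\dots,y_m]\to\mathrm{Sym}(E)$, $y_j\mapsto b_j$, and $D_{ij}=\max\{r\mid b_j\in F^i_r\}$ for all $i,j$. (Then $F^i_r$ is the span of $\{b_j\mid D_{ij}\ge r\}$.) *)

theory Defs
  imports
    Complex_Main
    "HOL-Algebra.Algebraic_Closure_Type"
    "HOL-Library.Poly_Mapping"
begin

section \<open>Complex vector spaces\<close>

text \<open>
  The fibres of a vector bundle are modules, in the sense of \<open>HOL-Algebra\<close>, over the field of
  complex numbers. The ring fields \<open>mult\<close> and \<open>one\<close> of a module record play no role.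
\<close>

type_synonym 'v cspace = "(complex, 'v) module"

abbreviation complex_field :: "complex ring" where
  "complex_field \<equiv> ring_of_type_algebra"

definition lin_span :: "'v cspace \<Rightarrow> 'v set \<Rightarrow> 'v set" where
  "lin_span M S = \<Inter> {H. submodule H complex_field M \<and> S \<subseteq> H}"

definition is_basis :: "'v cspace \<Rightarrow> 'v set \<Rightarrow> bool" where
  "is_basis M B \<longleftrightarrow> B \<subseteq> carrier M \<and> lin_span M B = carrier M
     \<and> (\<forall>v\<in>B. v \<notin> lin_span M (B - {v}))"

definition linear_maps :: "'v cspace \<Rightarrow> 'w cspace \<Rightarrow> ('v \<Rightarrow> 'w) set" where
  "linear_maps M N = {f \<in> carrier M \<rightarrow> carrier N.
     (\<forall>v\<in>carrier M. \<forall>w\<in>carrier M. f (v \<oplus>\<^bsub>M\<^esub> w) = f v \<oplus>\<^bsub>N\<^esub> f w)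
   \<and> (\<forall>c. \<forall>v\<in>carrier M. f (c \<odot>\<^bsub>M\<^esub> v) = c \<odot>\<^bsub>N\<^esub> f v)}"

definition complex_line :: "complex cspace" where
  "complex_line = \<lparr>carrier = UNIV, monoid.mult = (*), one = 1, zero = 0, add = (+), module.smult = (*)\<rparr>"

definition dual_space :: "'v cspace \<Rightarrow> ('v \<Rightarrow> complex) cspace" where
  "dual_space M =
     \<lparr>carrier = linear_maps M complex_line \<inter> extensional (carrier M),
      monoid.mult = undefined, one = undefined,
      zero = (\<lambda>v\<in>carrier M. 0),
      add = (\<lambda>f g. \<lambda>v\<in>carrier M. f v + g v),
      module.smult = (\<lambda>c f. \<lambda>v\<in>carrier M. c * f v)\<rparr>"

definition direct_sum_space :: "'j set \<Rightarrow> ('j \<Rightarrow> 'v cspace) \<Rightarrow> ('j \<Rightarrow> 'v) cspace" where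
  "direct_sum_space J M =
     \<lparr>carrier = (\<Pi>\<^sub>E j\<in>J. carrier (M j)),
      monoid.mult = undefined, one = undefined,
      zero = (\<lambda>j\<in>J. \<zero>\<^bsub>M j\<^esub>),
      add = (\<lambda>v w. \<lambda>j\<in>J. v j \<oplus>\<^bsub>M j\<^esub> w j),
      module.smult = (\<lambda>c v. \<lambda>j\<in>J. c \<odot>\<^bsub>M j\<^esub> v j)\<rparr>"

text \<open>
  The quotient by a subspace \<open>H\<close>, whose elements are the cosets of \<open>H\<close>. In the scalar
  multiplication \<open>H\<close> is added again because \<open>0 \<odot> C\<close> would otherwise be \<open>{0}\<close> instead of \<open>H\<close>.
\<close>

definition quotient_space :: "'v cspace \<Rightarrow> 'v set \<Rightarrow> 'v set cspace" where
  "quotient_space M H =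
     \<lparr>carrier = a_rcosets\<^bsub>M\<^esub> H,
      monoid.mult = undefined, one = undefined,
      zero = H,
      add = set_add M,
      module.smult = (\<lambda>c C. \<Union>v\<in>C. H +>\<^bsub>M\<^esub> (c \<odot>\<^bsub>M\<^esub> v))\<rparr>"

section \<open>Polynomials in several variables\<close>

type_synonym 'i cpoly = "('i \<Rightarrow>\<^sub>0 nat) \<Rightarrow>\<^sub>0 complex"

definition Const :: "complex \<Rightarrow> 'i cpoly" where
  "Const c = Poly_Mapping.single 0 c"

definition Var :: "'i \<Rightarrow> 'i cpoly" where
  "Var i = Poly_Mapping.single (Poly_Mapping.single i 1) 1"

text \<open>The ring of polynomials whose variables are indexed by the set \<open>I\<close>.\<close>

definition cpoly_ring :: "'i set \<Rightarrow> 'i cpoly ring" where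
  "cpoly_ring I =
     \<lparr>carrier = {P. \<forall>m\<in>Poly_Mapping.keys P. Poly_Mapping.keys m \<subseteq> I},
      monoid.mult = (*), one = 1, zero = 0, add = (+)\<rparr>"

text \<open>Substitution of \<open>x i\<close> for the variables, with coefficients mapped along \<open>h\<close>.\<close>

definition cpoly_subst :: "(complex \<Rightarrow> 'r) \<Rightarrow> ('i \<Rightarrow> 'r) \<Rightarrow> 'i cpoly \<Rightarrow> 'r::comm_ring_1" where
  "cpoly_subst h x P = (\<Sum>m\<in>Poly_Mapping.keys P. h (Poly_Mapping.lookup P m) *
     (\<Prod>i\<in>Poly_Mapping.keys m. x i ^ Poly_Mapping.lookup m i))"

abbreviation cpoly_eval :: "'i cpoly \<Rightarrow> ('i \<Rightarrow> complex) \<Rightarrow> complex" where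
  "cpoly_eval P x \<equiv> cpoly_subst (\<lambda>c. c) x P"

text \<open>
  Polynomials with variables in \<open>I\<close> that are homogeneous of degree \<open>d\<close> with respect to the
  variables in \<open>Z\<close>.
\<close>

definition homogeneous :: "'i set \<Rightarrow> 'i set \<Rightarrow> nat \<Rightarrow> 'i cpoly set" where
  "homogeneous I Z d = {P \<in> carrier (cpoly_ring I).
     \<forall>m\<in>Poly_Mapping.keys P. (\<Sum>i\<in>Poly_Mapping.keys m \<inter> Z. Poly_Mapping.lookup m i) = d}"

text \<open>
  The symmetric algebra of \<open>M\<close> is the commutative algebra generated by the elements of \<open>M\<close>
  subject to the linear relations that hold in \<open>M\<close>.
\<close>

definition sym_relations :: "'v cspace \<Rightarrow> 'v cpoly set" where
  "sym_relations M =
     {Var (v \<oplus>\<^bsub>M\<^esub> w) - Var v - Var w | v w. v \<in> carrier M \<and> w \<in> carrier M}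
   \<union> {Var (c \<odot>\<^bsub>M\<^esub> v) - Const c * Var v | c v. v \<in> carrier M}"

definition sym_ideal :: "'v cspace \<Rightarrow> 'v cpoly set" where
  "sym_ideal M = Idl\<^bsub>cpoly_ring (carrier M)\<^esub> (sym_relations M)"

definition sym_algebra :: "'v cspace \<Rightarrow> 'v cpoly set ring" where
  "sym_algebra M = cpoly_ring (carrier M) Quot sym_ideal M"

text \<open>The algebra homomorphism from a polynomial ring to \<open>Sym(M)\<close> with \<open>y\<^sub>j \<mapsto> b j\<close>.\<close>

definition to_sym :: "'v cspace \<Rightarrow> ('j \<Rightarrow> 'v) \<Rightarrow> 'j cpoly \<Rightarrow> 'v cpoly set" where
  "to_sym M b P =
     sym_ideal M +>\<^bsub>cpoly_ring (carrier M)\<^esub> cpoly_subst Const (\<lambda>j. Var (b j)) P"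

section \<open>Projective space and its torus\<close>

text \<open>
  A vector is a function on the natural numbers vanishing above \<open>n\<close>; a point of projective
  \<open>n\<close>-space is the set of all its homogeneous coordinate vectors, that is, a line through the
  origin without the origin.
\<close>

type_synonym cvec = "nat \<Rightarrow> complex"
type_synonym ppoint = "cvec set"

definition hpoint :: "cvec \<Rightarrow> ppoint" where
  "hpoint x = {(\<lambda>i. c * x i) | c. c \<noteq> 0}"

definition Pn :: "nat \<Rightarrow> ppoint set" where
  "Pn n = {hpoint x | x. (\<forall>i>n. x i = 0) \<and> (\<exists>i\<le>n. x i \<noteq> 0)}"

definition zariski_open :: "nat \<Rightarrow> ppoint set \<Rightarrow> bool" where
  "zariski_open n U \<longleftrightarrow> (\<exists>S \<subseteq> (\<Union>d. homogeneous {..n} {..n} d).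
     U = {p \<in> Pn n. \<exists>P\<in>S. \<forall>x\<in>p. cpoly_eval P x \<noteq> 0})"

definition regular_functions :: "nat \<Rightarrow> ppoint set \<Rightarrow> (ppoint \<Rightarrow> complex) set" where
  "regular_functions n U = {f. \<forall>p\<in>U. \<exists>d.
     \<exists>P\<in>homogeneous {..n} {..n} d. \<exists>Q\<in>homogeneous {..n} {..n} d.
       (\<forall>x\<in>p. cpoly_eval Q x \<noteq> 0) \<and>
       (\<forall>q\<in>U. \<forall>x\<in>q. cpoly_eval Q x \<noteq> 0 \<longrightarrow> f q = cpoly_eval P x / cpoly_eval Q x)}"

text \<open>
  The torus \<open>(\<complex>\<^sup>*)\<^sup>n\<close> has coordinates \<open>t\<^sub>1, \<dots>, t\<^sub>n\<close>. The convention \<open>t\<^sub>0 = 1\<close> makes its action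
  on projective space the coordinatewise product.
\<close>

definition torus :: "nat \<Rightarrow> cvec set" where
  "torus n = {t. (\<forall>i\<in>{1..n}. t i \<noteq> 0) \<and> (\<forall>i. i \<notin> {1..n} \<longrightarrow> t i = 1)}"

definition tmult :: "cvec \<Rightarrow> cvec \<Rightarrow> cvec" where
  "tmult t x = (\<lambda>i. t i * x i)"

definition tinv :: "cvec \<Rightarrow> cvec" where
  "tinv t = (\<lambda>i. inverse (t i))"

definition tpoint :: "cvec \<Rightarrow> ppoint \<Rightarrow> ppoint" where
  "tpoint t p = tmult t ` p"

text \<open>The identity of the torus, as a point of projective space.\<close>

definition identity_point :: "nat \<Rightarrow> ppoint" where
  "identity_point n = hpoint (\<lambda>i. if i \<le> n then 1 else 0)"

text \<open>
  Regular functions on an open subset of \<open>torus n \<times> Pn n\<close>: the variables \<open>Inl i\<close> are the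
  coordinates of the torus, the variables \<open>Inr i\<close> are the homogeneous coordinates.
\<close>

definition regular_functions_torus ::
    "nat \<Rightarrow> (cvec \<times> ppoint) set \<Rightarrow> (cvec \<Rightarrow> ppoint \<Rightarrow> complex) set" where
  "regular_functions_torus n W =
     (let I = Inl ` {1..n} \<union> Inr ` {..n}; Z = Inr ` {..n} in
      {f. \<forall>(t, p)\<in>W. \<exists>d. \<exists>P\<in>homogeneous I Z d. \<exists>Q\<in>homogeneous I Z d.
         (\<forall>x\<in>p. cpoly_eval Q (case_sum t x) \<noteq> 0) \<and>
         (\<forall>(s, q)\<in>W. \<forall>x\<in>q. cpoly_eval Q (case_sum s x) \<noteq> 0 \<longrightarrow>
            f s q = cpoly_eval P (case_sum s x) / cpoly_eval Q (case_sum s x))})"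

text \<open>
  Lattice vectors and characters have coordinates \<open>1, \<dots>, n\<close>. \<open>ray_generator n i\<close> is the
  generator of the ray of the fan of projective space that corresponds to \<open>x\<^sub>i = 0\<close>.
\<close>

definition ray_generator :: "nat \<Rightarrow> nat \<Rightarrow> nat \<Rightarrow> int" where
  "ray_generator n i =
     (if i = 0 then (\<lambda>k. - (\<Sum>j=1..n. if k = j then 1 else 0)) else (\<lambda>k. if k = i then 1 else 0))"

definition pairing :: "nat \<Rightarrow> (nat \<Rightarrow> int) \<Rightarrow> (nat \<Rightarrow> int) \<Rightarrow> int" where
  "pairing n u v = (\<Sum>k=1..n. u k * v k)"

definition torus_character :: "nat \<Rightarrow> (nat \<Rightarrow> int) \<Rightarrow> cvec \<Rightarrow> complex" where
  "torus_character n u t = (\<Prod>k=1..n. t k powi u k)"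

text \<open>The affine toric chart of the ray \<open>i\<close>: the torus together with the open orbit in \<open>x\<^sub>i = 0\<close>.\<close>

definition ray_chart :: "nat \<Rightarrow> nat \<Rightarrow> ppoint set" where
  "ray_chart n i = {p \<in> Pn n. \<forall>x\<in>p. \<forall>k\<le>n. k \<noteq> i \<longrightarrow> x k \<noteq> 0}"

section \<open>Toric vector bundles on projective space\<close>

text \<open>
  A bundle with a torus action is given by its fibres, the regular sections over the open sets
  (functions whose values outside the open set do not matter), and, for \<open>t\<close> in the torus, the
  maps \<open>bact E t p\<close> from the fibre over \<open>p\<close> to the fibre over \<open>t p\<close>.
\<close>

record 'v tbundle =
  fibre :: "ppoint \<Rightarrow> 'v cspace"
  sections :: "ppoint set \<Rightarrow> (ppoint \<Rightarrow> 'v) set"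
  bact :: "cvec \<Rightarrow> ppoint \<Rightarrow> 'v \<Rightarrow> 'v"

text \<open>A frame over \<open>U\<close>: sections trivialising the bundle over \<open>U\<close>.\<close>

definition frame :: "nat \<Rightarrow> nat \<Rightarrow> 'v tbundle \<Rightarrow> ppoint set \<Rightarrow> (nat \<Rightarrow> ppoint \<Rightarrow> 'v) \<Rightarrow> bool" where
  "frame n r E U b \<longleftrightarrow> zariski_open n U \<and>
     (\<forall>p\<in>U. \<forall>k<r. b k p \<in> carrier (fibre E p)) \<and>
     (\<forall>p\<in>U. \<forall>v\<in>carrier (fibre E p). \<exists>!c. c \<in> {..<r} \<rightarrow>\<^sub>E UNIV \<and>
        v = (\<Oplus>\<^bsub>fibre E p\<^esub>k\<in>{..<r}. c k \<odot>\<^bsub>fibre E p\<^esub> b k p)) \<and>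
     (\<forall>V s. zariski_open n V \<and> V \<subseteq> U \<longrightarrow>
        (s \<in> sections E V \<longleftrightarrow> (\<exists>f. (\<forall>k<r. f k \<in> regular_functions n V) \<and>
           (\<forall>p\<in>V. s p = (\<Oplus>\<^bsub>fibre E p\<^esub>k\<in>{..<r}. f k p \<odot>\<^bsub>fibre E p\<^esub> b k p)))))"

definition vector_bundle :: "nat \<Rightarrow> nat \<Rightarrow> 'v tbundle \<Rightarrow> bool" where
  "vector_bundle n r E \<longleftrightarrow>
     (\<forall>p\<in>Pn n. module complex_field (fibre E p)) \<and>
     (\<forall>U s. zariski_open n U \<longrightarrow> (s \<in> sections E U \<longleftrightarrow>
        (\<forall>p\<in>U. \<exists>V. zariski_open n V \<and> p \<in> V \<and> V \<subseteq> U \<and> s \<in> sections E V))) \<and>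
     (\<forall>p\<in>Pn n. \<exists>U b. p \<in> U \<and> frame n r E U b)"

text \<open>
  The last condition says that the action is a morphism of varieties: in suitable local frames
  its matrix is regular on an open subset of \<open>torus n \<times> Pn n\<close>.
\<close>

definition toric_vector_bundle :: "nat \<Rightarrow> nat \<Rightarrow> 'v tbundle \<Rightarrow> bool" where
  "toric_vector_bundle n r E \<longleftrightarrow> vector_bundle n r E \<and>
     (\<forall>t\<in>torus n. \<forall>p\<in>Pn n. bact E t p \<in> linear_maps (fibre E p) (fibre E (tpoint t p))) \<and>
     (\<forall>p\<in>Pn n. \<forall>v\<in>carrier (fibre E p). bact E (\<lambda>i. 1) p v = v) \<and>
     (\<forall>s\<in>torus n. \<forall>t\<in>torus n. \<forall>p\<in>Pn n. \<forall>v\<in>carrier (fibre E p).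
        bact E (tmult s t) p v = bact E s (tpoint t p) (bact E t p v)) \<and>
     (\<forall>t\<^sub>0\<in>torus n. \<forall>p\<^sub>0\<in>Pn n. \<exists>U b V c A.
        p\<^sub>0 \<in> U \<and> frame n r E U b \<and> tpoint t\<^sub>0 p\<^sub>0 \<in> V \<and> frame n r E V c \<and>
        (\<forall>k<r. \<forall>l<r. A k l \<in>
           regular_functions_torus n {(t, p). t \<in> torus n \<and> p \<in> U \<and> tpoint t p \<in> V}) \<and>
        (\<forall>t\<in>torus n. \<forall>p\<in>U. tpoint t p \<in> V \<longrightarrow> (\<forall>k<r. bact E t p (b k p) =
           (\<Oplus>\<^bsub>fibre E (tpoint t p)\<^esub>l\<in>{..<r}.
              A k l t p \<odot>\<^bsub>fibre E (tpoint t p)\<^esub> c l (tpoint t p)))))"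

text \<open>
  The Klyachko filtrations: the step \<open>\<langle>u, e\<^sub>i\<rangle>\<close> of the filtration of the ray \<open>e\<^sub>i\<close> consists of the
  values at the identity of the regular sections over the chart of \<open>e\<^sub>i\<close> that are semi-invariant
  of weight \<open>u\<close>. It depends on \<open>u\<close> only through \<open>\<langle>u, e\<^sub>i\<rangle>\<close>.
\<close>

definition identity_fibre :: "nat \<Rightarrow> 'v tbundle \<Rightarrow> 'v cspace" where
  "identity_fibre n E = fibre E (identity_point n)"

definition semi_invariant ::
    "nat \<Rightarrow> 'v tbundle \<Rightarrow> ppoint set \<Rightarrow> (nat \<Rightarrow> int) \<Rightarrow> (ppoint \<Rightarrow> 'v) \<Rightarrow> bool" where
  "semi_invariant n E U u s \<longleftrightarrow> (\<forall>t\<in>torus n. \<forall>p\<in>U.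
     bact E t p (s p) =
       torus_character n u t \<odot>\<^bsub>fibre E (tpoint t p)\<^esub> s (tpoint t p))"

definition klyachko_filtration :: "nat \<Rightarrow> 'v tbundle \<Rightarrow> nat \<Rightarrow> int \<Rightarrow> 'v set" where
  "klyachko_filtration n E i r = {s (identity_point n) | s u.
     s \<in> sections E (ray_chart n i) \<and> pairing n u (ray_generator n i) = r \<and>
     semi_invariant n E (ray_chart n i) u s}"

section \<open>The pair attached to a toric vector bundle\<close>

text \<open>
  The maximal cones of the fan are indexed by \<open>k \<le> n\<close>: the \<open>k\<close>-th one is generated by the
  rays \<open>i \<le> n\<close> different from \<open>k\<close>.
\<close>

definition adapted_basis :: "nat \<Rightarrow> 'v tbundle \<Rightarrow> nat \<Rightarrow> 'v set \<Rightarrow> bool" where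
  "adapted_basis n E k B \<longleftrightarrow> is_basis (identity_fibre n E) B \<and>
     (\<forall>i\<le>n. i \<noteq> k \<longrightarrow>
        (\<forall>r. \<exists>S\<subseteq>B. klyachko_filtration n E i r = lin_span (identity_fibre n E) S))"

text \<open>The finite set \<open>J\<close> indexes the variables \<open>y\<^sub>j\<close> and the columns of \<open>D\<close>.\<close>

definition corresponds_to_pair ::
    "nat \<Rightarrow> 'v tbundle \<Rightarrow> 'j set \<Rightarrow> 'j cpoly set \<Rightarrow> (nat \<Rightarrow> 'j \<Rightarrow> int) \<Rightarrow> bool" where
  "corresponds_to_pair n E J L D \<longleftrightarrow>
     (\<exists>r. toric_vector_bundle n r E) \<and> finite J \<and>
     (\<exists>b \<in> J \<rightarrow> carrier (identity_fibre n E).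
        lin_span (identity_fibre n E) (b ` J) = carrier (identity_fibre n E) \<and>
        (\<forall>k\<le>n. \<exists>B\<subseteq>b ` J. adapted_basis n E k B) \<and>
        L = a_kernel (cpoly_ring J) (sym_algebra (identity_fibre n E))
              (to_sym (identity_fibre n E) b) \<and>
        (\<forall>i\<le>n. \<forall>j\<in>J. b j \<in> klyachko_filtration n E i (D i j) \<and>
           (\<forall>r. b j \<in> klyachko_filtration n E i r \<longrightarrow> r \<le> D i j)))"

section \<open>Line bundles, direct sums, cokernels and duals\<close>

text \<open>
  The toric line bundle \<open>O(\<Sum>\<^sub>i r\<^sub>i H\<^sub>i)\<close>, via its isomorphism with \<open>O(d)\<close>, \<open>d = \<Sum>\<^sub>i r\<^sub>i\<close>, which
  multiplies a rational function by \<open>\<Prod>\<^sub>i x\<^sub>i\<^bsup>r\<^sub>i\<^esup>\<close>. The fibre of \<open>O(d)\<close> over a point \<open>p\<close> consists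
  of the functions on the punctured line \<open>p\<close> that are homogeneous of degree \<open>d\<close>. The torus acts
  on rational functions by \<open>(t f)(x) = f(t\<^sup>-\<^sup>1 x)\<close>, so it acts on \<open>O(d)\<close> with the extra factor
  \<open>\<Prod>\<^sub>i t\<^sub>i\<^bsup>r\<^sub>i\<^esup>\<close>, and the canonical section \<open>\<Prod>\<^sub>i x\<^sub>i\<^bsup>r\<^sub>i\<^esup>\<close> is invariant.
\<close>

definition toric_line_bundle :: "nat \<Rightarrow> (nat \<Rightarrow> int) \<Rightarrow> (cvec \<Rightarrow> complex) tbundle" where
  "toric_line_bundle n r = (let d = (\<Sum>i\<le>n. r i); F = (\<lambda>p. \<lparr>
       carrier = {\<phi> \<in> p \<rightarrow>\<^sub>E UNIV. \<forall>x\<in>p. \<forall>c. c \<noteq> 0 \<longrightarrow> \<phi> (\<lambda>i. c * x i) = c powi d * \<phi> x},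
       monoid.mult = undefined, one = undefined,
       zero = (\<lambda>x\<in>p. 0),
       add = (\<lambda>\<phi> \<psi>. \<lambda>x\<in>p. \<phi> x + \<psi> x),
       module.smult = (\<lambda>c \<phi>. \<lambda>x\<in>p. c * \<phi> x)\<rparr>) in
     \<lparr>fibre = F,
      sections = (\<lambda>U. {s. \<forall>p\<in>U. s p \<in> carrier (F p) \<and>
        (\<exists>k l. int k - int l = d \<and>
           (\<exists>P\<in>homogeneous {..n} {..n} k. \<exists>Q\<in>homogeneous {..n} {..n} l.
              (\<forall>x\<in>p. cpoly_eval Q x \<noteq> 0) \<and>
              (\<forall>q\<in>U. \<forall>x\<in>q. cpoly_eval Q x \<noteq> 0 \<longrightarrow>
                 s q x = cpoly_eval P x / cpoly_eval Q x)))}),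
      bact = (\<lambda>t p \<phi>. \<lambda>x\<in>tpoint t p. (\<Prod>i\<le>n. t i powi r i) * \<phi> (tmult (tinv t) x))\<rparr>)"

definition direct_sum_bundle :: "'j set \<Rightarrow> ('j \<Rightarrow> 'v tbundle) \<Rightarrow> ('j \<Rightarrow> 'v) tbundle" where
  "direct_sum_bundle J E =
     \<lparr>fibre = (\<lambda>p. direct_sum_space J (\<lambda>j. fibre (E j) p)),
      sections = (\<lambda>U. {s. (\<forall>p\<in>U. s p \<in> extensional J) \<and>
        (\<forall>j\<in>J. (\<lambda>p. s p j) \<in> sections (E j) U)}),
      bact = (\<lambda>t p v. \<lambda>j\<in>J. bact (E j) t p (v j))\<rparr>"

text \<open>
  The cokernel of a map \<open>h\<close> of bundles, given on the fibres. As for any quotient sheaf, its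
  sections are those that lift locally.
\<close>

definition cokernel_bundle ::
    "nat \<Rightarrow> 'v tbundle \<Rightarrow> 'w tbundle \<Rightarrow> (ppoint \<Rightarrow> 'v \<Rightarrow> 'w) \<Rightarrow> 'w set tbundle" where
  "cokernel_bundle n A B h = (let H = (\<lambda>p. h p ` carrier (fibre A p)) in
     \<lparr>fibre = (\<lambda>p. quotient_space (fibre B p) (H p)),
      sections = (\<lambda>U. {s. \<forall>p\<in>U. \<exists>V \<sigma>. zariski_open n V \<and> p \<in> V \<and> V \<subseteq> U \<and>
        \<sigma> \<in> sections B V \<and> (\<forall>q\<in>V. s q = H q +>\<^bsub>fibre B q\<^esub> \<sigma> q)}),
      bact = (\<lambda>t p C. bact B t p ` C)\<rparr>)"

definition dual_bundle :: "nat \<Rightarrow> 'v tbundle \<Rightarrow> ('v \<Rightarrow> complex) tbundle" where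
  "dual_bundle n E =
     \<lparr>fibre = (\<lambda>p. dual_space (fibre E p)),
      sections = (\<lambda>U. {s. (\<forall>p\<in>U. s p \<in> carrier (dual_space (fibre E p))) \<and>
        (\<forall>V \<sigma>. zariski_open n V \<and> V \<subseteq> U \<and> \<sigma> \<in> sections E V \<longrightarrow>
           (\<lambda>p. s p (\<sigma> p)) \<in> regular_functions n V)}),
      bact = (\<lambda>t p f. \<lambda>v\<in>carrier (fibre E (tpoint t p)). f (bact E (tinv t) (tpoint t p) v))\<rparr>"

text \<open>
  The bundle \<open>\<E>\<^sub>a\<close>: the cokernel of the map from \<open>O\<close>, with fibres the functions of degree \<open>0\<close> on
  the lines, to \<open>\<Oplus>\<^sub>j O(a\<^sub>j H\<^sub>j)\<close> given by \<open>1 \<mapsto> (x\<^sub>0\<^bsup>a\<^sub>0\<^esup>, \<dots>, x\<^sub>n\<^bsup>a\<^sub>n\<^esup>)\<close>.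
\<close>

definition bundle_E :: "nat \<Rightarrow> (nat \<Rightarrow> nat) \<Rightarrow> (nat \<Rightarrow> cvec \<Rightarrow> complex) set tbundle" where
  "bundle_E n a = cokernel_bundle n
     (toric_line_bundle n (\<lambda>i. 0))
     (direct_sum_bundle {..n} (\<lambda>j. toric_line_bundle n (\<lambda>i. if i = j then int (a j) else 0)))
     (\<lambda>p \<phi>. \<lambda>j\<in>{..n}. \<lambda>x\<in>p. \<phi> x * x j ^ a j)"

end

theory Submission
  imports Defs
begin

text \<open>
  Everything follows from frames of semi-invariant sections. Suppose that over each chart
  \<open>x\<^sub>k \<noteq> 0\<close> a bundle has a frame of sections \<open>b\<^sub>l\<close> that are semi-invariant of weights \<open>u\<^sub>l\<close>.
  Then it is a toric vector bundle (\<open>toric_vector_bundleI\<close>). For a ray \<open>e\<^sub>i\<close> with \<open>i \<noteq> k\<close>, a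
  semi-invariant section over the chart of the ray has coordinates that are multiples of
  Laurent monomials. A Laurent monomial is regular there exactly if its order along \<open>x\<^sub>i = 0\<close> is
  nonnegative, which is seen by restricting it to a curve that crosses \<open>x\<^sub>i = 0\<close>
  (\<open>regular_no_pole\<close>, \<open>laurent_monomial_regular\<close>). So the step \<open>r\<close> of the Klyachko filtration of \<open>e\<^sub>i\<close> is
  spanned by the \<open>b\<^sub>l\<close> with \<open>\<langle>u\<^sub>l, e\<^sub>i\<rangle> \<ge> r\<close> (\<open>klyachko_filtration_coords\<close>). In particular the \<open>b\<^sub>l\<close>
  form an adapted basis for the cone \<open>k\<close>, and \<open>b\<^sub>l\<close> has the entry \<open>\<langle>u\<^sub>l, e\<^sub>i\<rangle>\<close> in row \<open>i\<close> of the
  diagram. The dual frame is a frame of the dual bundle with the weights \<open>-u\<^sub>l\<close>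
  (\<open>equivariant_dual_frame\<close>).

  For the cokernel of \<open>1 \<mapsto> (x\<^sub>0\<^bsup>a\<^sub>0\<^esup>, \<dots>, x\<^sub>n\<^bsup>a\<^sub>n\<^esup>)\<close> the classes of \<open>x\<^sub>k\<^bsup>a\<^sub>j\<^esup>\<close> in the summands
  \<open>j \<noteq> k\<close> form such a frame over \<open>x\<^sub>k \<noteq> 0\<close> (\<open>equivariant_frame_E\<close>). The weight of the \<open>j\<close>-th member
  pairs with \<open>e\<^sub>i\<close>, \<open>i \<noteq> k\<close>, to \<open>a\<^sub>i\<close> if \<open>i = j\<close> and to \<open>0\<close> otherwise. At the identity the frames are
  made up of the images \<open>b\<^sub>j\<close> of the standard basis vectors, whose only linear relation is
  \<open>b\<^sub>0 + \<dots> + b\<^sub>n = 0\<close>. The dual frames are made up, up to signs, of the functionals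
  \<open>z\<^sub>i\<^sub>j\<close> that take the difference of the components \<open>i\<close> and \<open>j\<close>.

  The kernel of the map to the symmetric algebra is generated by the linear relations between
  the chosen vectors (\<open>kernel_to_sym\<close>). Between the \<open>z\<^sub>i\<^sub>j\<close> these follow from
  \<open>z\<^sub>i\<^sub>k = z\<^sub>i\<^sub>j + z\<^sub>j\<^sub>k\<close>, because these reduce every linear form to the \<open>z\<^sub>0\<^sub>j\<close>, which are
  independent.
\<close>

section \<open>Linear algebra over the complex numbers\<close>

text \<open>Modules over the complex field, with the module axioms restated for complex scalars.\<close>

locale complex_space =
  fixes M :: "'v cspace" (structure)
  assumes is_module: "module complex_field M"

sublocale complex_space \<subseteq> module complex_field M
  by (rule is_module)

lemma complex_field_simps [simp]:
  "carrier complex_field = UNIV" "\<zero>\<^bsub>complex_field\<^esub> = 0" "\<one>\<^bsub>complex_field\<^esub> = 1"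
  "x \<oplus>\<^bsub>complex_field\<^esub> y = x + y" "x \<otimes>\<^bsub>complex_field\<^esub> y = x * y"
  by (simp_all add: ring_of_type_algebra_def)

text \<open>Negatives need not be given, as \<open>(-1) \<odot> x\<close> is one.\<close>

lemma complex_spaceI:
  fixes M :: "'v cspace" (structure)
  assumes "\<zero> \<in> carrier M"
    and "\<And>x y. x \<in> carrier M \<Longrightarrow> y \<in> carrier M \<Longrightarrow> x \<oplus> y \<in> carrier M"
    and "\<And>c x. x \<in> carrier M \<Longrightarrow> c \<odot> x \<in> carrier M"
    and "\<And>x y z. x \<in> carrier M \<Longrightarrow> y \<in> carrier M \<Longrightarrow> z \<in> carrier M \<Longrightarrow> x \<oplus> y \<oplus> z = x \<oplus> (y \<oplus> z)"
    and "\<And>x y. x \<in> carrier M \<Longrightarrow> y \<in> carrier M \<Longrightarrow> x \<oplus> y = y \<oplus> x"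
    and "\<And>x. x \<in> carrier M \<Longrightarrow> \<zero> \<oplus> x = x"
    and "\<And>x. x \<in> carrier M \<Longrightarrow> 0 \<odot> x = \<zero>"
    and "\<And>x. x \<in> carrier M \<Longrightarrow> 1 \<odot> x = x"
    and "\<And>c d x. x \<in> carrier M \<Longrightarrow> (c + d) \<odot> x = c \<odot> x \<oplus> d \<odot> x"
    and "\<And>c d x. x \<in> carrier M \<Longrightarrow> (c * d) \<odot> x = c \<odot> (d \<odot> x)"
    and "\<And>c x y. x \<in> carrier M \<Longrightarrow> y \<in> carrier M \<Longrightarrow> c \<odot> (x \<oplus> y) = c \<odot> x \<oplus> c \<odot> y"
  shows "complex_space M"
proof (rule complex_space.intro)
  have "abelian_group M"
  proof (rule abelian_groupI)
    fix x assume x: "x \<in> carrier M"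
    have "(-1) \<odot> x \<oplus> 1 \<odot> x = (-1 + 1) \<odot> x"
      using assms(9)[OF x] by metis
    then have "(-1) \<odot> x \<oplus> x = \<zero>"
      using assms(7,8)[OF x] by simp
    then show "\<exists>y\<in>carrier M. y \<oplus> x = \<zero>"
      using assms(3)[OF x] by blast
  qed (rule assms; assumption)+
  then show "module complex_field M"
    by (intro moduleI) (simp_all add: assms(3,8-11) cring_from_type_algebra)
qed

context complex_space
begin

lemma smult_in [simp, intro]: "v \<in> carrier M \<Longrightarrow> c \<odot> v \<in> carrier M"
  using smult_closed by simp

lemma add_smult: "v \<in> carrier M \<Longrightarrow> (c + d) \<odot> v = c \<odot> v \<oplus> d \<odot> v"
  using smult_l_distr by simp

lemma smult_add: "v \<in> carrier M \<Longrightarrow> w \<in> carrier M \<Longrightarrow> c \<odot> (v \<oplus> w) = c \<odot> v \<oplus> c \<odot> w"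
  using smult_r_distr by simp

lemma smult_smult: "v \<in> carrier M \<Longrightarrow> c \<odot> (d \<odot> v) = (c * d) \<odot> v"
  using smult_assoc1 by simp

lemma one_smult [simp]: "v \<in> carrier M \<Longrightarrow> 1 \<odot> v = v"
  using smult_one by simp

lemma zero_smult [simp]: "v \<in> carrier M \<Longrightarrow> 0 \<odot> v = \<zero>"
  using smult_l_null by simp

lemma smult_zero [simp]: "c \<odot> \<zero> = \<zero>"
  using smult_r_null by simp

lemma minus_eq_smult: "v \<in> carrier M \<Longrightarrow> \<ominus> v = (-1) \<odot> v"
proof -
  assume v: "v \<in> carrier M"
  have "(-1) \<odot> v \<oplus> v = \<zero>"
    using add_smult[OF v, of "-1" 1] v by simp
  then show ?thesis
    using v by (simp add: M.minus_equality)
qed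

lemma finsum_in [simp, intro]:
  "(\<And>k. k \<in> A \<Longrightarrow> b k \<in> carrier M) \<Longrightarrow> (\<Oplus>k\<in>A. c k \<odot> b k) \<in> carrier M"
  by (rule finsum_closed) auto

lemma finsum_add_coeff:
  assumes b: "\<And>k. k \<in> A \<Longrightarrow> b k \<in> carrier M"
  shows "(\<Oplus>k\<in>A. (c k + d k) \<odot> b k) = (\<Oplus>k\<in>A. c k \<odot> b k) \<oplus> (\<Oplus>k\<in>A. d k \<odot> b k)"
proof -
  have "(\<Oplus>k\<in>A. (c k + d k) \<odot> b k) = (\<Oplus>k\<in>A. c k \<odot> b k \<oplus> d k \<odot> b k)"
    using b by (intro finsum_cong') (auto simp: add_smult)
  also have "\<dots> = (\<Oplus>k\<in>A. c k \<odot> b k) \<oplus> (\<Oplus>k\<in>A. d k \<odot> b k)"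
    using b by (intro finsum_addf) auto
  finally show ?thesis .
qed

lemma finsum_smult_coeff:
  assumes A: "finite A" and b: "\<And>k. k \<in> A \<Longrightarrow> b k \<in> carrier M"
  shows "(\<Oplus>k\<in>A. (a * c k) \<odot> b k) = a \<odot> (\<Oplus>k\<in>A. c k \<odot> b k)"
proof -
  have "(\<Oplus>k\<in>A. (a * c k) \<odot> b k) = (\<Oplus>k\<in>A. a \<odot> (c k \<odot> b k))"
    using b by (intro finsum_cong') (auto simp: smult_smult)
  also have "\<dots> = a \<odot> (\<Oplus>k\<in>A. c k \<odot> b k)"
    using A b by (intro finsum_smult_ldistr[symmetric]) auto
  finally show ?thesis .
qed

lemma finsum_unit_coeff:
  assumes A: "finite A" and b: "\<And>k. k \<in> A \<Longrightarrow> b k \<in> carrier M" and l: "l \<in> A"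
  shows "(\<Oplus>k\<in>A. (if k = l then a else 0) \<odot> b k) = a \<odot> b l"
proof -
  have "(\<Oplus>k\<in>A. (if k = l then a else 0) \<odot> b k) = (\<Oplus>k\<in>A. if l = k then a \<odot> b k else \<zero>)"
    using b by (intro finsum_cong') auto
  also have "\<dots> = a \<odot> b l"
    by (rule finsum_singleton) (use assms in auto)
  finally show ?thesis .
qed

lemma submoduleI':
  assumes "H \<subseteq> carrier M" "\<zero> \<in> H"
    and "\<And>v w. v \<in> H \<Longrightarrow> w \<in> H \<Longrightarrow> v \<oplus> w \<in> H"
    and "\<And>c v. v \<in> H \<Longrightarrow> c \<odot> v \<in> H"
  shows "submodule H complex_field M"
  by (rule submoduleI) (use assms in \<open>auto simp: minus_eq_smult subset_iff\<close>)

lemma finsum_in_submodule: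
  assumes "submodule H complex_field M" "finite A" "\<And>k. k \<in> A \<Longrightarrow> b k \<in> H"
  shows "(\<Oplus>k\<in>A. c k \<odot> b k) \<in> H"
  using assms(2,3)
proof (induction A)
  case empty
  then show ?case
    using subgroup.one_closed[OF submodule.axioms(1)[OF assms(1)]] by simp
next
  case (insert x F)
  have "H \<subseteq> carrier M"
    by (rule submoduleE(1)[OF assms(1)])
  then have "(\<Oplus>k\<in>insert x F. c k \<odot> b k) = c x \<odot> b x \<oplus> (\<Oplus>k\<in>F. c k \<odot> b k)"
    using insert by (subst finsum_insert) auto
  then show ?case
    using insert submoduleE(4,5)[OF assms(1)] by simp
qed

lemma lin_span_image:
  assumes "finite S" "\<And>k. k \<in> S \<Longrightarrow> b k \<in> carrier M"
  shows "lin_span M (b ` S) = {\<Oplus>k\<in>S. c k \<odot> b k | c. True}" (is "_ = ?R")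
proof
  have sub: "submodule ?R complex_field M"
  proof (rule submoduleI')
    show "?R \<subseteq> carrier M"
      using assms by auto
    have "(\<Oplus>k\<in>S. 0 \<odot> b k) = (\<Oplus>k\<in>S. \<zero>)"
      using assms by (intro finsum_cong') auto
    then have "\<zero> = (\<Oplus>k\<in>S. 0 \<odot> b k)"
      by simp
    then show "\<zero> \<in> ?R"
      by (intro CollectI exI[of _ "\<lambda>_. 0"]) auto
    show "v \<oplus> w \<in> ?R" if vw: "v \<in> ?R" "w \<in> ?R" for v w
    proof -
      obtain c d where cd: "v = (\<Oplus>k\<in>S. c k \<odot> b k)" "w = (\<Oplus>k\<in>S. d k \<odot> b k)"
        using vw by blast
      have "v \<oplus> w = (\<Oplus>k\<in>S. (c k + d k) \<odot> b k)"
        unfolding cd using assms(2) by (rule finsum_add_coeff[symmetric])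
      then show ?thesis
        by (intro CollectI exI[of _ "\<lambda>k. c k + d k"]) simp
    qed
    show "a \<odot> v \<in> ?R" if v: "v \<in> ?R" for a v
    proof -
      obtain c where c: "v = (\<Oplus>k\<in>S. c k \<odot> b k)"
        using v by blast
      have "a \<odot> v = (\<Oplus>k\<in>S. (a * c k) \<odot> b k)"
        unfolding c using assms by (rule finsum_smult_coeff[symmetric])
      then show ?thesis
        by (intro CollectI exI[of _ "\<lambda>k. a * c k"]) simp
    qed
  qed
  have "b l \<in> ?R" if l: "l \<in> S" for l
  proof -
    have "b l = (\<Oplus>k\<in>S. (if k = l then 1 else 0) \<odot> b k)"
      using finsum_unit_coeff[OF assms l, where a = 1] assms(2)[OF l] by simp
    then show ?thesis
      by (intro CollectI exI[of _ "\<lambda>k. if k = l then 1 else 0"]) simp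
  qed
  then show "lin_span M (b ` S) \<subseteq> ?R"
    using sub unfolding lin_span_def by blast
  show "?R \<subseteq> lin_span M (b ` S)"
    unfolding lin_span_def by (auto intro: finsum_in_submodule assms(1))
qed

lemma lin_span_subset:
  assumes "S \<subseteq> carrier M"
  shows "lin_span M S \<subseteq> carrier M"
proof -
  have "submodule (carrier M) complex_field M"
    by (rule submoduleI') auto
  then show ?thesis
    unfolding lin_span_def using assms by blast
qed

end

lemma lin_span_mono: "S \<subseteq> T \<Longrightarrow> lin_span M S \<subseteq> lin_span M T"
  unfolding lin_span_def by blast

text \<open>
  The families of length \<open>r\<close> in which every vector has unique coordinates, as in the definition
  of a frame. The coordinates have the value \<open>undefined\<close> from \<open>r\<close> on.
\<close>

definition family_basis :: "'v cspace \<Rightarrow> nat \<Rightarrow> (nat \<Rightarrow> 'v) \<Rightarrow> bool" where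
  "family_basis M r b \<longleftrightarrow> (\<forall>k<r. b k \<in> carrier M) \<and>
     (\<forall>v\<in>carrier M. \<exists>!c. c \<in> {..<r} \<rightarrow>\<^sub>E UNIV \<and> v = (\<Oplus>\<^bsub>M\<^esub>k\<in>{..<r}. c k \<odot>\<^bsub>M\<^esub> b k))"

definition coords :: "'v cspace \<Rightarrow> nat \<Rightarrow> (nat \<Rightarrow> 'v) \<Rightarrow> 'v \<Rightarrow> nat \<Rightarrow> complex" where
  "coords M r b v =
     (THE c. c \<in> {..<r} \<rightarrow>\<^sub>E UNIV \<and> v = (\<Oplus>\<^bsub>M\<^esub>k\<in>{..<r}. c k \<odot>\<^bsub>M\<^esub> b k))"

lemma linear_mapsD:
  assumes "f \<in> linear_maps M N" "v \<in> carrier M"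
  shows "f v \<in> carrier N"
    and "w \<in> carrier M \<Longrightarrow> f (v \<oplus>\<^bsub>M\<^esub> w) = f v \<oplus>\<^bsub>N\<^esub> f w"
    and "f (c \<odot>\<^bsub>M\<^esub> v) = c \<odot>\<^bsub>N\<^esub> f v"
  using assms by (auto simp: linear_maps_def)

lemma linear_mapsI:
  assumes "\<And>v. v \<in> carrier M \<Longrightarrow> f v \<in> carrier N"
    and "\<And>v w. v \<in> carrier M \<Longrightarrow> w \<in> carrier M \<Longrightarrow> f (v \<oplus>\<^bsub>M\<^esub> w) = f v \<oplus>\<^bsub>N\<^esub> f w"
    and "\<And>c v. v \<in> carrier M \<Longrightarrow> f (c \<odot>\<^bsub>M\<^esub> v) = c \<odot>\<^bsub>N\<^esub> f v"
  shows "f \<in> linear_maps M N"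
  using assms by (auto simp: linear_maps_def)

lemma linear_map_finsum:
  assumes M: "complex_space M" and N: "complex_space N" and f: "f \<in> linear_maps M N"
    and fin: "finite A" and b: "\<And>k. k \<in> A \<Longrightarrow> b k \<in> carrier M"
  shows "f (\<Oplus>\<^bsub>M\<^esub>k\<in>A. c k \<odot>\<^bsub>M\<^esub> b k) = (\<Oplus>\<^bsub>N\<^esub>k\<in>A. c k \<odot>\<^bsub>N\<^esub> f (b k))"
proof -
  interpret M: complex_space M by (rule M)
  interpret N: complex_space N by (rule N)
  note fD = linear_mapsD[OF f]
  show ?thesis
    using fin b
  proof (induction A)
    case empty
    have "f (0 \<odot>\<^bsub>M\<^esub> \<zero>\<^bsub>M\<^esub>) = 0 \<odot>\<^bsub>N\<^esub> f \<zero>\<^bsub>M\<^esub>"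
      by (intro fD(3)) simp
    then show ?case
      using fD(1)[OF M.M.zero_closed] by simp
  next
    case (insert x F)
    have "f (\<Oplus>\<^bsub>M\<^esub>k\<in>insert x F. c k \<odot>\<^bsub>M\<^esub> b k) = f (c x \<odot>\<^bsub>M\<^esub> b x \<oplus>\<^bsub>M\<^esub> (\<Oplus>\<^bsub>M\<^esub>k\<in>F. c k \<odot>\<^bsub>M\<^esub> b k))"
      using insert by (subst M.finsum_insert) auto
    also have "\<dots> = c x \<odot>\<^bsub>N\<^esub> f (b x) \<oplus>\<^bsub>N\<^esub> f (\<Oplus>\<^bsub>M\<^esub>k\<in>F. c k \<odot>\<^bsub>M\<^esub> b k)"
      using insert by (simp add: fD)
    also have "\<dots> = (\<Oplus>\<^bsub>N\<^esub>k\<in>insert x F. c k \<odot>\<^bsub>N\<^esub> f (b k))"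
      using insert fD(1) by (subst N.finsum_insert) auto
    finally show ?case .
  qed
qed

lemma complex_line_simps [simp]:
  "carrier complex_line = UNIV" "\<zero>\<^bsub>complex_line\<^esub> = 0"
  "x \<oplus>\<^bsub>complex_line\<^esub> y = x + y" "x \<odot>\<^bsub>complex_line\<^esub> y = x * y"
  by (simp_all add: complex_line_def)

lemma complex_space_line: "complex_space complex_line"
  by (rule complex_spaceI) (auto simp: algebra_simps)

lemma finsum_complex_line: "finite A \<Longrightarrow> finsum complex_line f A = sum f A"
proof -
  interpret complex_space complex_line by (rule complex_space_line)
  assume "finite A"
  then show ?thesis
    by (induction A) (simp_all add: finsum_insert)
qed

lemma functional_finsum:
  assumes "complex_space M" "f \<in> linear_maps M complex_line" "finite A"
    and "\<And>k. k \<in> A \<Longrightarrow> b k \<in> carrier M"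
  shows "f (\<Oplus>\<^bsub>M\<^esub>k\<in>A. c k \<odot>\<^bsub>M\<^esub> b k) = (\<Sum>k\<in>A. c k * f (b k))"
  using linear_map_finsum[OF assms(1) complex_space_line assms(2-4)] assms(3)
  by (simp add: finsum_complex_line)

text \<open>A family is a basis if coordinates are given by linear functionals dual to it.\<close>

lemma family_basisI:
  assumes M: "complex_space M"
    and b: "\<And>k. k < r \<Longrightarrow> b k \<in> carrier M"
    and l: "\<And>k. k < r \<Longrightarrow> l k \<in> linear_maps M complex_line"
    and lb: "\<And>k m. k < r \<Longrightarrow> m < r \<Longrightarrow> l k (b m) = (if k = m then 1 else 0)"
    and span: "\<And>v. v \<in> carrier M \<Longrightarrow> v = (\<Oplus>\<^bsub>M\<^esub>k\<in>{..<r}. l k v \<odot>\<^bsub>M\<^esub> b k)"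
  shows "family_basis M r b"
  unfolding family_basis_def
proof (intro conjI allI impI ballI b)
  interpret complex_space M by (rule M)
  fix v assume v: "v \<in> carrier M"
  show "\<exists>!c. c \<in> {..<r} \<rightarrow>\<^sub>E UNIV \<and> v = (\<Oplus>\<^bsub>M\<^esub>k\<in>{..<r}. c k \<odot>\<^bsub>M\<^esub> b k)"
  proof (rule ex1I[of _ "\<lambda>k\<in>{..<r}. l k v"])
    show "(\<lambda>k\<in>{..<r}. l k v) \<in> {..<r} \<rightarrow>\<^sub>E UNIV \<and>
        v = (\<Oplus>\<^bsub>M\<^esub>k\<in>{..<r}. (\<lambda>k\<in>{..<r}. l k v) k \<odot>\<^bsub>M\<^esub> b k)"
      using span[OF v] b by (auto simp: cong: finsum_cong)
    fix c assume c: "c \<in> {..<r} \<rightarrow>\<^sub>E UNIV \<and> v = (\<Oplus>\<^bsub>M\<^esub>k\<in>{..<r}. c k \<odot>\<^bsub>M\<^esub> b k)"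
    have "l k v = c k" if k: "k < r" for k
    proof -
      have "l k v = (\<Sum>m<r. c m * l k (b m))"
        using c functional_finsum[OF M l[OF k], of "{..<r}" b c] b by auto
      also have "\<dots> = (\<Sum>m<r. if k = m then c m else 0)"
        using lb k by (intro sum.cong) auto
      finally show ?thesis
        using k by simp
    qed
    then show "c = (\<lambda>k\<in>{..<r}. l k v)"
      using c by (intro PiE_ext[of c "{..<r}" "\<lambda>_. UNIV"]) auto
  qed
qed

text \<open>A space with a basis that is indexed by the numbers below \<open>r\<close>.\<close>

locale based_space = complex_space M for M :: "'v cspace" (structure) +
  fixes r :: nat and b :: "nat \<Rightarrow> 'v"
  assumes family: "family_basis M r b"
begin

lemma basis_in [simp, intro]: "k < r \<Longrightarrow> b k \<in> carrier M"
  using family by (simp add: family_basis_def)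

lemma coords_ex1:
  "v \<in> carrier M \<Longrightarrow> \<exists>!c. c \<in> {..<r} \<rightarrow>\<^sub>E UNIV \<and> v = (\<Oplus>k\<in>{..<r}. c k \<odot> b k)"
  using family by (simp add: family_basis_def)

lemma coords_sum: "v \<in> carrier M \<Longrightarrow> (\<Oplus>k\<in>{..<r}. coords M r b v k \<odot> b k) = v"
  using theI'[OF coords_ex1] unfolding coords_def by simp

lemma coords_finsum:
  assumes "k < r"
  shows "coords M r b (\<Oplus>k\<in>{..<r}. c k \<odot> b k) k = c k"
proof -
  let ?c = "restrict c {..<r}"
  have "(\<Oplus>k\<in>{..<r}. c k \<odot> b k) = (\<Oplus>k\<in>{..<r}. ?c k \<odot> b k)"
    by (intro finsum_cong') auto
  then have "coords M r b (\<Oplus>k\<in>{..<r}. c k \<odot> b k) = ?c"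
    unfolding coords_def by (intro the1_equality coords_ex1) auto
  then show ?thesis
    using assms by simp
qed

lemma coords_unique:
  "k < r \<Longrightarrow> (\<Oplus>k\<in>{..<r}. c k \<odot> b k) = (\<Oplus>k\<in>{..<r}. d k \<odot> b k) \<Longrightarrow> c k = d k"
  using coords_finsum by metis

lemma basis_expand: "l < r \<Longrightarrow> (\<Oplus>k\<in>{..<r}. (if k = l then 1 else 0) \<odot> b k) = b l"
  using finsum_unit_coeff[of "{..<r}" b l, where a = 1] by simp

lemma coords_basis: "k < r \<Longrightarrow> l < r \<Longrightarrow> coords M r b (b l) k = (if k = l then 1 else 0)"
  using coords_finsum[of k "\<lambda>k. if k = l then 1 else 0"] basis_expand by simp

lemma coords_add:
  assumes "k < r" "v \<in> carrier M" "w \<in> carrier M"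
  shows "coords M r b (v \<oplus> w) k = coords M r b v k + coords M r b w k"
proof -
  have "(\<Oplus>k\<in>{..<r}. (coords M r b v k + coords M r b w k) \<odot> b k) = v \<oplus> w"
    using assms by (subst finsum_add_coeff) (auto simp: coords_sum)
  then show ?thesis
    using coords_finsum[OF assms(1), of "\<lambda>k. coords M r b v k + coords M r b w k"] by simp
qed

lemma coords_smult:
  assumes "k < r" "v \<in> carrier M"
  shows "coords M r b (c \<odot> v) k = c * coords M r b v k"
proof -
  have "(\<Oplus>k\<in>{..<r}. (c * coords M r b v k) \<odot> b k) = c \<odot> v"
    using assms by (subst finsum_smult_coeff) (auto simp: coords_sum)
  then show ?thesis
    using coords_finsum[OF assms(1), of "\<lambda>k. c * coords M r b v k"] by simp
qed

lemma coords_linear: "k < r \<Longrightarrow> (\<lambda>v. coords M r b v k) \<in> linear_maps M complex_line"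
  by (intro linear_mapsI) (auto simp: coords_add coords_smult)

lemma lin_span_basis:
  assumes S: "S \<subseteq> {..<r}"
  shows "lin_span M (b ` S) = {v \<in> carrier M. \<forall>k<r. k \<notin> S \<longrightarrow> coords M r b v k = 0}"
proof -
  have fin: "finite S"
    using S finite_subset by blast
  have ext: "(\<Oplus>k\<in>S. c k \<odot> b k) = (\<Oplus>k\<in>{..<r}. (if k \<in> S then c k else 0) \<odot> b k)" for c
    using S by (intro add.finprod_mono_neutral_cong_left) auto
  have "lin_span M (b ` S) = {\<Oplus>k\<in>S. c k \<odot> b k | c. True}"
    using S by (intro lin_span_image fin) auto
  also have "\<dots> = {v \<in> carrier M. \<forall>k<r. k \<notin> S \<longrightarrow> coords M r b v k = 0}"
  proof (intro equalityI subsetI)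
    fix v assume "v \<in> {\<Oplus>k\<in>S. c k \<odot> b k | c. True}"
    then obtain c where "v = (\<Oplus>k\<in>{..<r}. (if k \<in> S then c k else 0) \<odot> b k)"
      using ext by auto
    then show "v \<in> {v \<in> carrier M. \<forall>k<r. k \<notin> S \<longrightarrow> coords M r b v k = 0}"
      using coords_finsum[of _ "\<lambda>k. if k \<in> S then c k else 0"] by auto
  next
    fix v assume v: "v \<in> {v \<in> carrier M. \<forall>k<r. k \<notin> S \<longrightarrow> coords M r b v k = 0}"
    have "v = (\<Oplus>k\<in>{..<r}. coords M r b v k \<odot> b k)"
      using v coords_sum by simp
    also have "\<dots> = (\<Oplus>k\<in>{..<r}. (if k \<in> S then coords M r b v k else 0) \<odot> b k)"
      using v by (intro finsum_cong') auto
    finally show "v \<in> {\<Oplus>k\<in>S. c k \<odot> b k | c. True}"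
      using ext by auto
  qed
  finally show ?thesis .
qed

lemma is_basis_image: "is_basis M (b ` {..<r})"
  unfolding is_basis_def
proof (intro conjI ballI)
  show "b ` {..<r} \<subseteq> carrier M"
    by auto
  show "lin_span M (b ` {..<r}) = carrier M"
    by (subst lin_span_basis) auto
  fix v assume "v \<in> b ` {..<r}"
  then obtain l where l: "l < r" "v = b l"
    by auto
  have inj: "b k = b l \<Longrightarrow> k = l" if "k < r" for k
    using coords_basis[OF l(1) that] coords_basis[OF l(1) l(1)] by (metis zero_neq_one)
  then have "b ` {..<r} - {v} = b ` ({..<r} - {l})"
    unfolding l(2) by auto
  then show "v \<notin> lin_span M (b ` {..<r} - {v})"
    using lin_span_basis[of "{..<r} - {l}"] coords_basis[OF l(1) l(1)] l by auto
qed

end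

section \<open>Dual spaces, direct sums and quotients\<close>

lemma dual_space_simps [simp]:
  "carrier (dual_space M) = linear_maps M complex_line \<inter> extensional (carrier M)"
  "\<zero>\<^bsub>dual_space M\<^esub> = (\<lambda>v\<in>carrier M. 0)"
  "f \<oplus>\<^bsub>dual_space M\<^esub> g = (\<lambda>v\<in>carrier M. f v + g v)"
  "c \<odot>\<^bsub>dual_space M\<^esub> f = (\<lambda>v\<in>carrier M. c * f v)"
  by (simp_all add: dual_space_def)

lemma complex_space_dual:
  assumes "complex_space M"
  shows "complex_space (dual_space M)"
proof -
  interpret complex_space M by fact
  show ?thesis
    by (rule complex_spaceI)
      (auto simp: linear_maps_def algebra_simps extensional_def fun_eq_iff restrict_def)
qed

lemma dual_eval_linear:
  "v \<in> carrier M \<Longrightarrow> (\<lambda>f. f v) \<in> linear_maps (dual_space M) complex_line"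
  by (intro linear_mapsI) auto

context based_space
begin

text \<open>The coordinate functionals, extended by \<open>undefined\<close> as the dual space requires.\<close>

definition dual_basis :: "nat \<Rightarrow> 'v \<Rightarrow> complex" where
  "dual_basis k = (\<lambda>v\<in>carrier M. coords M r b v k)"

lemma dual_basis_in: "k < r \<Longrightarrow> dual_basis k \<in> carrier (dual_space M)"
  using coords_linear[of k] by (auto simp: dual_basis_def linear_maps_def)

lemma dual_finsum:
  fixes m :: nat
  assumes "v \<in> carrier M" "\<And>k. k < m \<Longrightarrow> f k \<in> carrier (dual_space M)"
  shows "(\<Oplus>\<^bsub>dual_space M\<^esub>k\<in>{..<m}. c k \<odot>\<^bsub>dual_space M\<^esub> f k) v = (\<Sum>k<m. c k * f k v)"
  using functional_finsum[OF complex_space_dual dual_eval_linear, of M v "{..<m}" f c] assms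
    complex_space_axioms by auto

lemma dual_expand:
  assumes f: "f \<in> carrier (dual_space M)"
  shows "(\<Oplus>\<^bsub>dual_space M\<^esub>k\<in>{..<r}. f (b k) \<odot>\<^bsub>dual_space M\<^esub> dual_basis k) = f" (is "?g = f")
proof -
  interpret D: complex_space "dual_space M"
    by (rule complex_space_dual) (rule complex_space_axioms)
  have g: "?g \<in> carrier (dual_space M)"
    using dual_basis_in by (intro D.finsum_in) auto
  have "?g v = f v" if v: "v \<in> carrier M" for v
  proof -
    have "?g v = (\<Sum>k<r. f (b k) * coords M r b v k)"
      using dual_finsum[OF v, of r dual_basis "\<lambda>k. f (b k)"] dual_basis_in v
      by (simp add: dual_basis_def)
    also have "\<dots> = f (\<Oplus>k\<in>{..<r}. coords M r b v k \<odot> b k)"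
      using f functional_finsum[OF complex_space_axioms, of f "{..<r}" b "coords M r b v"]
      by (auto simp: mult.commute)
    finally show ?thesis
      using coords_sum[OF v] by simp
  qed
  then show ?thesis
    using g f by (intro extensionalityI[of _ "carrier M"]) auto
qed

lemma family_basis_dual: "family_basis (dual_space M) r dual_basis"
proof (rule family_basisI)
  show "complex_space (dual_space M)"
    by (rule complex_space_dual) (rule complex_space_axioms)
  show "(\<lambda>f. f (b k)) \<in> linear_maps (dual_space M) complex_line" if "k < r" for k
    using that by (intro dual_eval_linear) auto
qed (use dual_basis_in dual_expand coords_basis in \<open>auto simp: dual_basis_def\<close>)

end

lemma direct_sum_space_simps [simp]:
  "carrier (direct_sum_space J M) = (\<Pi>\<^sub>E j\<in>J. carrier (M j))"
  "\<zero>\<^bsub>direct_sum_space J M\<^esub> = (\<lambda>j\<in>J. \<zero>\<^bsub>M j\<^esub>)"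
  "v \<oplus>\<^bsub>direct_sum_space J M\<^esub> w = (\<lambda>j\<in>J. v j \<oplus>\<^bsub>M j\<^esub> w j)"
  "c \<odot>\<^bsub>direct_sum_space J M\<^esub> v = (\<lambda>j\<in>J. c \<odot>\<^bsub>M j\<^esub> v j)"
  by (simp_all add: direct_sum_space_def)

lemma complex_space_direct_sum:
  assumes "\<And>j. j \<in> J \<Longrightarrow> complex_space (M j)"
  shows "complex_space (direct_sum_space J M)"
proof -
  note m = complex_space.is_module[OF assms]
  have g: "abelian_monoid (M j)" if "j \<in> J" for j
    using m[OF that] by (simp add: module_def abelian_group_def)
  note simps = abelian_monoid.a_closed[OF g] abelian_monoid.zero_closed[OF g]
    abelian_monoid.a_assoc[OF g] abelian_monoid.l_zero[OF g] complex_space.smult_in[OF assms]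
    complex_space.zero_smult[OF assms] complex_space.one_smult[OF assms]
    complex_space.add_smult[OF assms] complex_space.smult_add[OF assms]
    complex_space.smult_smult[OF assms]
  show ?thesis
    by (rule complex_spaceI)
      (auto simp: simps PiE_iff restrict_def extensional_def fun_eq_iff
        intro: abelian_monoid.a_comm[OF g])
qed

lemma quotient_space_simps [simp]:
  "carrier (quotient_space M H) = a_rcosets\<^bsub>M\<^esub> H"
  "\<zero>\<^bsub>quotient_space M H\<^esub> = H"
  "C \<oplus>\<^bsub>quotient_space M H\<^esub> D = set_add M C D"
  "c \<odot>\<^bsub>quotient_space M H\<^esub> C = (\<Union>v\<in>C. H +>\<^bsub>M\<^esub> (c \<odot>\<^bsub>M\<^esub> v))"
  by (simp_all add: quotient_space_def)

text \<open>A space with a linear subspace \<open>H\<close>.\<close>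

locale sub_space = complex_space M for M :: "'v cspace" (structure) +
  fixes H :: "'v set"
  assumes sub: "submodule H complex_field M"
begin

lemma H_subset: "H \<subseteq> carrier M"
  by (rule submoduleE(1)[OF sub])

lemma H_smult: "v \<in> H \<Longrightarrow> c \<odot> v \<in> H"
  using submoduleE(4)[OF sub] by simp

sublocale abelian_subgroup H M
  by (rule abelian_subgroupI3)
    (auto simp: additive_subgroup_def submodule.axioms(1)[OF sub] M.abelian_group_axioms)

abbreviation (input) Q :: "'v set cspace" where
  "Q \<equiv> quotient_space M H"

lemma coset_eq_iff:
  assumes "v \<in> carrier M" "w \<in> carrier M"
  shows "H +> v = H +> w \<longleftrightarrow> v \<oplus> (-1) \<odot> w \<in> H"
  using assms a_rcos_module[of w v] a_repr_independence'[of v w] a_rcos_self[of v]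
  by (auto simp: minus_eq_smult)

lemma coset_in [intro]: "v \<in> carrier M \<Longrightarrow> H +> v \<in> carrier Q"
  using a_rcosetsI[OF H_subset] by simp

lemma coset_cases:
  assumes "C \<in> carrier Q"
  obtains v where "v \<in> carrier M" "C = H +> v"
  using assms by (auto simp: A_RCOSETS_def')

lemma coset_member:
  assumes "C \<in> carrier Q" "v \<in> C"
  shows "v \<in> carrier M" "H +> v = C"
proof -
  obtain w where "w \<in> carrier M" "C = H +> w"
    using assms(1) by (rule coset_cases)
  then show "v \<in> carrier M" "H +> v = C"
    using assms(2) a_elemrcos_carrier a_repr_independence' by auto
qed

lemma coset_add: "v \<in> carrier M \<Longrightarrow> w \<in> carrier M \<Longrightarrow>
    (H +> v) \<oplus>\<^bsub>Q\<^esub> (H +> w) = H +> (v \<oplus> w)"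
  using a_rcos_sum by simp

lemma coset_smult:
  assumes v: "v \<in> carrier M"
  shows "c \<odot>\<^bsub>Q\<^esub> (H +> v) = H +> (c \<odot> v)"
proof -
  have "H +> (c \<odot> w) = H +> (c \<odot> v)" if w: "w \<in> H +> v" for w
  proof -
    have wM: "w \<in> carrier M"
      using a_elemrcos_carrier[OF v w] .
    have "w \<oplus> (-1) \<odot> v \<in> H"
      using a_rcos_module[OF v wM] w v by (simp add: minus_eq_smult)
    then have "c \<odot> w \<oplus> (-1) \<odot> (c \<odot> v) \<in> H"
      using H_smult[of _ c] v wM by (fastforce simp: smult_add smult_smult)
    then show ?thesis
      using v wM by (subst coset_eq_iff) auto
  qed
  then have "(\<Union>w\<in>H +> v. H +> (c \<odot> w)) = (\<Union>w\<in>H +> v. H +> (c \<odot> v))"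
    by (intro SUP_cong refl)
  then show ?thesis
    using a_rcos_self[OF v] by auto
qed

lemma complex_space_quotient: "complex_space Q"
proof -
  have zero: "H +> \<zero> = H"
    using a_coset_add_zero H_subset by simp
  have H: "H \<in> carrier Q"
    using coset_in[OF M.zero_closed] by (simp add: zero)
  have H_add: "H \<oplus>\<^bsub>Q\<^esub> (H +> v) = H +> v" if "v \<in> carrier M" for v
    using coset_add[OF M.zero_closed that] that by (simp add: zero)
  show ?thesis
    by (rule complex_spaceI; (elim coset_cases)?)
      (simp_all only: coset_add coset_smult coset_in M.a_closed smult_in M.a_assoc one_smult
        zero_smult add_smult smult_smult smult_add quotient_space_simps(2) zero H H_add M.a_comm M.a_lcomm)
qed

lemma coset_linear: "(\<lambda>v. H +> v) \<in> linear_maps M Q"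
  by (rule linear_mapsI) (simp_all only: coset_in coset_add coset_smult)

lemma coset_finsum:
  assumes "finite A" "\<And>k. k \<in> A \<Longrightarrow> b k \<in> carrier M"
  shows "(\<Oplus>\<^bsub>Q\<^esub>k\<in>A. c k \<odot>\<^bsub>Q\<^esub> (H +> b k))
    = H +> (\<Oplus>k\<in>A. c k \<odot> b k)"
  using linear_map_finsum[OF complex_space_axioms complex_space_quotient coset_linear assms]
  by simp

text \<open>
  The functional that \<open>f\<close> induces on the quotient, for \<open>f\<close> vanishing on \<open>H\<close>: it is evaluated on
  an arbitrary member of the coset.
\<close>

definition quotient_functional :: "('v \<Rightarrow> complex) \<Rightarrow> 'v set \<Rightarrow> complex" where
  "quotient_functional f = (\<lambda>C\<in>carrier Q. f (SOME v. v \<in> C))"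

context
  fixes f :: "'v \<Rightarrow> complex"
  assumes f: "f \<in> linear_maps M complex_line" and fH: "\<And>v. v \<in> H \<Longrightarrow> f v = 0"
begin

lemma quotient_functional_coset:
  assumes v: "v \<in> carrier M"
  shows "quotient_functional f (H +> v) = f v"
proof -
  define w where "w = (SOME w. w \<in> H +> v)"
  have w: "w \<in> H +> v"
    unfolding w_def using a_rcos_self[OF v] by (rule someI)
  have wM: "w \<in> carrier M"
    using a_elemrcos_carrier[OF v w] .
  have "w \<oplus> (-1) \<odot> v \<in> H"
    using a_rcos_module[OF v wM] w v by (simp add: minus_eq_smult)
  then have "f (w \<oplus> (-1) \<odot> v) = 0"
    by (rule fH)
  then have "f w = f v"
    using linear_mapsD[OF f] v wM by simp
  then show ?thesis
    using coset_in[OF v] unfolding quotient_functional_def w_def by simp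
qed

lemma quotient_functional_linear:
  "quotient_functional f \<in> linear_maps Q complex_line"
proof (rule linear_mapsI)
  show "quotient_functional f (C \<oplus>\<^bsub>Q\<^esub> D)
      = quotient_functional f C \<oplus>\<^bsub>complex_line\<^esub> quotient_functional f D"
    if "C \<in> carrier Q" "D \<in> carrier Q" for C D
    using that linear_mapsD(2)[OF f]
    by (elim coset_cases) (simp only: coset_add quotient_functional_coset M.a_closed)
  show "quotient_functional f (c \<odot>\<^bsub>Q\<^esub> C)
      = c \<odot>\<^bsub>complex_line\<^esub> quotient_functional f C"
    if "C \<in> carrier Q" for c C
    using that linear_mapsD(3)[OF f]
    by (elim coset_cases) (simp only: coset_smult quotient_functional_coset smult_in)
qed simp

lemma quotient_functional_dual:
  "quotient_functional f \<in> carrier (dual_space Q)"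
  using quotient_functional_linear unfolding dual_space_simps
  by (simp add: quotient_functional_def)

end

end

text \<open>A linear map that takes a subspace onto a subspace induces the image map on cosets.\<close>

lemma image_coset_linear:
  assumes "sub_space M H" "sub_space N K" and g: "g \<in> linear_maps M N" and HK: "g ` H = K"
  shows "v \<in> carrier M \<Longrightarrow> g ` (H +>\<^bsub>M\<^esub> v) = K +>\<^bsub>N\<^esub> g v"
    and "(\<lambda>C. g ` C) \<in> linear_maps (quotient_space M H) (quotient_space N K)"
proof -
  interpret M: sub_space M H by fact
  interpret N: sub_space N K by fact
  note gD = linear_mapsD[OF g]
  show im: "g ` (H +>\<^bsub>M\<^esub> v) = K +>\<^bsub>N\<^esub> g v" if "v \<in> carrier M" for v
  proof -
    have "g ` (H +>\<^bsub>M\<^esub> v) = (\<Union>h\<in>H. {g (h \<oplus>\<^bsub>M\<^esub> v)})"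
      by (auto simp: a_r_coset_def')
    also have "\<dots> = (\<Union>h\<in>H. {g h \<oplus>\<^bsub>N\<^esub> g v})"
      using M.H_subset that by (intro SUP_cong refl) (auto simp: gD(2))
    also have "\<dots> = K +>\<^bsub>N\<^esub> g v"
      by (auto simp: a_r_coset_def' HK[symmetric])
    finally show ?thesis .
  qed
  show "(\<lambda>C. g ` C) \<in> linear_maps (quotient_space M H) (quotient_space N K)"
  proof (rule linear_mapsI)
    show "g ` C \<in> carrier (quotient_space N K)" if "C \<in> carrier (quotient_space M H)" for C
      using that gD(1) by (elim M.coset_cases) (simp only: im N.coset_in)
    show "g ` (C \<oplus>\<^bsub>quotient_space M H\<^esub> D) = g ` C \<oplus>\<^bsub>quotient_space N K\<^esub> g ` D"
      if "C \<in> carrier (quotient_space M H)" "D \<in> carrier (quotient_space M H)" for C D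
      using that gD(1,2) by (elim M.coset_cases) (simp only: im M.coset_add N.coset_add M.M.a_closed)
    show "g ` (c \<odot>\<^bsub>quotient_space M H\<^esub> C) = c \<odot>\<^bsub>quotient_space N K\<^esub> (g ` C)"
      if "C \<in> carrier (quotient_space M H)" for c C
      using that gD(1,3) by (elim M.coset_cases) (simp only: im M.coset_smult N.coset_smult M.smult_in)
  qed
qed

section \<open>Polynomial rings\<close>

text \<open>The value of the monomial with exponents \<open>m\<close> at \<open>x\<close>.\<close>

definition monomial_value :: "('i \<Rightarrow> 'r) \<Rightarrow> ('i \<Rightarrow>\<^sub>0 nat) \<Rightarrow> 'r::comm_ring_1" where
  "monomial_value x m = (\<Prod>i\<in>Poly_Mapping.keys m. x i ^ Poly_Mapping.lookup m i)"

lemma monomial_value_superset: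
  assumes "finite A" "Poly_Mapping.keys m \<subseteq> A"
  shows "monomial_value x m = (\<Prod>i\<in>A. x i ^ Poly_Mapping.lookup m i)"
  unfolding monomial_value_def using assms
  by (intro prod.mono_neutral_left) (auto simp: in_keys_iff)

lemma monomial_value_add: "monomial_value x (m + m') = monomial_value x m * monomial_value x m'"
proof -
  let ?A = "Poly_Mapping.keys m \<union> Poly_Mapping.keys m'"
  have "monomial_value x (m + m') = (\<Prod>i\<in>?A. x i ^ Poly_Mapping.lookup (m + m') i)"
    by (rule monomial_value_superset) (use Poly_Mapping.keys_add[of m m'] in auto)
  also have "\<dots> = (\<Prod>i\<in>?A. x i ^ Poly_Mapping.lookup m i) * (\<Prod>i\<in>?A. x i ^ Poly_Mapping.lookup m' i)"
    by (simp add: lookup_add power_add prod.distrib)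
  also have "\<dots> = monomial_value x m * monomial_value x m'"
    by (simp add: monomial_value_superset[of ?A])
  finally show ?thesis .
qed

lemma monomial_value_single [simp]: "monomial_value x (Poly_Mapping.single i k) = x i ^ k"
  by (cases "k = 0") (simp_all add: monomial_value_def)

lemma monomial_value_zero [simp]: "monomial_value x 0 = 1"
  by (simp add: monomial_value_def)

lemma sum_single_lookup:
  "(\<Sum>m\<in>Poly_Mapping.keys P. Poly_Mapping.single m (Poly_Mapping.lookup P m)) = (P :: 'a \<Rightarrow>\<^sub>0 'b::comm_monoid_add)"
  by (rule poly_mapping_eqI)
    (auto simp: lookup_sum lookup_single when_def in_keys_iff)

text \<open>If \<open>h\<close> is a ring homomorphism, then so is the substitution that maps coefficients along \<open>h\<close>.\<close>

locale coefficient_hom =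
  fixes h :: "complex \<Rightarrow> 'r::comm_ring_1"
  assumes h_zero: "h 0 = 0" and h_one: "h 1 = 1"
    and h_add: "h (c + d) = h c + h d" and h_mult: "h (c * d) = h c * h d"
begin

lemma subst_superset:
  assumes "finite A" "Poly_Mapping.keys P \<subseteq> A"
  shows "cpoly_subst h x P = (\<Sum>m\<in>A. h (Poly_Mapping.lookup P m) * monomial_value x m)"
  unfolding cpoly_subst_def monomial_value_def[symmetric] using assms
  by (intro sum.mono_neutral_left) (auto simp: in_keys_iff h_zero)

lemma subst_zero [simp]: "cpoly_subst h x 0 = 0"
  by (simp add: cpoly_subst_def)

lemma subst_add: "cpoly_subst h x (P + Q) = cpoly_subst h x P + cpoly_subst h x Q"
proof -
  let ?A = "Poly_Mapping.keys P \<union> Poly_Mapping.keys Q"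
  have "cpoly_subst h x (P + Q) = (\<Sum>m\<in>?A. h (Poly_Mapping.lookup (P + Q) m) * monomial_value x m)"
    by (rule subst_superset) (use Poly_Mapping.keys_add[of P Q] in auto)
  also have "\<dots> = cpoly_subst h x P + cpoly_subst h x Q"
    by (simp add: subst_superset[of ?A] lookup_add h_add distrib_right sum.distrib)
  finally show ?thesis .
qed

lemma subst_single: "cpoly_subst h x (Poly_Mapping.single m c) = h c * monomial_value x m"
  using subst_superset[of "{m}" "Poly_Mapping.single m c" x] by (simp add: lookup_single h_zero)

lemma subst_sum: "cpoly_subst h x (sum P A) = (\<Sum>a\<in>A. cpoly_subst h x (P a))"
  by (induction A rule: infinite_finite_induct) (simp_all add: subst_add)

lemma subst_mult: "cpoly_subst h x (P * Q) = cpoly_subst h x P * cpoly_subst h x Q"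
proof -
  let ?s = "\<lambda>P m. Poly_Mapping.single m (Poly_Mapping.lookup P m)"
  have "cpoly_subst h x (P * Q) = cpoly_subst h x
      ((\<Sum>m\<in>Poly_Mapping.keys P. ?s P m) * (\<Sum>m\<in>Poly_Mapping.keys Q. ?s Q m))"
    by (simp only: sum_single_lookup)
  also have "\<dots> = (\<Sum>m\<in>Poly_Mapping.keys P. \<Sum>m'\<in>Poly_Mapping.keys Q.
      cpoly_subst h x (?s P m) * cpoly_subst h x (?s Q m'))"
    by (simp add: sum_product subst_sum mult_single subst_single h_mult monomial_value_add
        mult.assoc mult.left_commute)
  also have "\<dots> = cpoly_subst h x (\<Sum>m\<in>Poly_Mapping.keys P. ?s P m)
      * cpoly_subst h x (\<Sum>m\<in>Poly_Mapping.keys Q. ?s Q m)"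
    by (simp add: sum_product subst_sum)
  finally show ?thesis
    by (simp only: sum_single_lookup)
qed

lemma subst_Const [simp]: "cpoly_subst h x (Const c) = h c"
  by (simp add: Const_def subst_single)

lemma subst_Var [simp]: "cpoly_subst h x (Var i) = x i"
  by (simp add: Var_def subst_single h_one)

lemma subst_one [simp]: "cpoly_subst h x 1 = 1"
  using subst_Const[of x 1] by (simp add: Const_def h_one)

lemma subst_minus: "cpoly_subst h x (- P) = - cpoly_subst h x P"
  using subst_add[of x P "- P"] by (simp add: eq_neg_iff_add_eq_0 add.commute)

lemma subst_diff: "cpoly_subst h x (P - Q) = cpoly_subst h x P - cpoly_subst h x Q"
  using subst_add[of x P "- Q"] by (simp add: subst_minus)

lemma subst_power: "cpoly_subst h x (P ^ k) = cpoly_subst h x P ^ k"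
  by (induction k) (simp_all add: subst_mult)

lemma subst_prod: "cpoly_subst h x (prod P A) = (\<Prod>a\<in>A. cpoly_subst h x (P a))"
  by (induction A rule: infinite_finite_induct) (simp_all add: subst_mult)

end

interpretation eval: coefficient_hom "\<lambda>c :: complex. c"
  by unfold_locales auto

lemma coefficient_hom_Const: "coefficient_hom (Const :: complex \<Rightarrow> 'i cpoly)"
proof
  show "Const 0 = (0 :: 'i cpoly)" "Const 1 = (1 :: 'i cpoly)"
    by (simp_all add: Const_def)
  show "Const (c + d) = (Const c + Const d :: 'i cpoly)" for c d
    by (simp add: Const_def single_add)
  show "Const (c * d) = (Const c * Const d :: 'i cpoly)" for c d
    by (simp add: Const_def mult_single)
qed

interpretation Const: coefficient_hom "Const :: complex \<Rightarrow> 'i cpoly"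
  by (rule coefficient_hom_Const)

lemma Const_uminus: "Const (- c) = - Const c"
  by (simp add: Const_def single_uminus)

lemma Const_diff: "Const (c - d) = Const c - Const d"
  by (simp add: Const_def single_diff)

lemma Const_sum: "Const (\<Sum>a\<in>A. c a) = (\<Sum>a\<in>A. Const (c a))"
  by (induction A rule: infinite_finite_induct) (simp_all add: Const.h_zero Const.h_add)

lemmas eval_simps = eval.subst_add eval.subst_mult eval.subst_power eval.subst_prod eval.subst_sum
  eval.subst_diff

lemma tendsto_cpoly_eval:
  assumes "\<And>i. ((\<lambda>t. x t i) \<longlongrightarrow> y i) F"
  shows "((\<lambda>t. cpoly_eval P (x t)) \<longlongrightarrow> cpoly_eval P y) F"
  unfolding cpoly_subst_def using assms by (intro tendsto_intros)

lemma cpoly_ring_simps [simp]: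
  "monoid.mult (cpoly_ring I) = (*)" "\<one>\<^bsub>cpoly_ring I\<^esub> = 1" "\<zero>\<^bsub>cpoly_ring I\<^esub> = 0"
  "add (cpoly_ring I) = (+)"
  by (simp_all add: cpoly_ring_def)

lemma cpoly_ring_carrier:
  "P \<in> carrier (cpoly_ring I) \<longleftrightarrow> (\<forall>m\<in>Poly_Mapping.keys P. Poly_Mapping.keys m \<subseteq> I)"
  by (simp add: cpoly_ring_def)

lemma keys_add_nat: "Poly_Mapping.keys (m + m') = Poly_Mapping.keys m \<union> Poly_Mapping.keys (m' :: 'i \<Rightarrow>\<^sub>0 nat)"
  by (auto simp: in_keys_iff lookup_add)

lemma cpoly_ring_closed [intro]:
  "Const c \<in> carrier (cpoly_ring I)"
  "i \<in> I \<Longrightarrow> Var i \<in> carrier (cpoly_ring I)"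
  "0 \<in> carrier (cpoly_ring I)"
  "1 \<in> carrier (cpoly_ring I)"
  "P \<in> carrier (cpoly_ring I) \<Longrightarrow> Q \<in> carrier (cpoly_ring I) \<Longrightarrow> P + Q \<in> carrier (cpoly_ring I)"
  "P \<in> carrier (cpoly_ring I) \<Longrightarrow> Q \<in> carrier (cpoly_ring I) \<Longrightarrow> P * Q \<in> carrier (cpoly_ring I)"
  "P \<in> carrier (cpoly_ring I) \<Longrightarrow> - P \<in> carrier (cpoly_ring I)"
proof -
  show "P + Q \<in> carrier (cpoly_ring I)"
    if "P \<in> carrier (cpoly_ring I)" "Q \<in> carrier (cpoly_ring I)"
    using that Poly_Mapping.keys_add[of P Q] by (auto simp: cpoly_ring_carrier)
  show "P * Q \<in> carrier (cpoly_ring I)"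
    if "P \<in> carrier (cpoly_ring I)" "Q \<in> carrier (cpoly_ring I)"
    using that keys_mult[of P Q] by (fastforce simp: cpoly_ring_carrier keys_add_nat)
  show "- P \<in> carrier (cpoly_ring I)" if "P \<in> carrier (cpoly_ring I)"
    using that by (auto simp: cpoly_ring_carrier in_keys_iff)
qed (auto simp: cpoly_ring_carrier Const_def Var_def)

lemma cpoly_ring_sum:
  "(\<And>a. a \<in> A \<Longrightarrow> P a \<in> carrier (cpoly_ring I)) \<Longrightarrow> sum P A \<in> carrier (cpoly_ring I)"
  by (induction A rule: infinite_finite_induct) auto

lemma cpoly_ring_diff:
  "P \<in> carrier (cpoly_ring I) \<Longrightarrow> Q \<in> carrier (cpoly_ring I) \<Longrightarrow> P - Q \<in> carrier (cpoly_ring I)"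
  using cpoly_ring_closed(5,7)[of _ I] by (metis diff_conv_add_uminus)

lemma cring_cpoly: "cring (cpoly_ring I)"
proof (rule cringI)
  have "\<exists>Q\<in>carrier (cpoly_ring I). Q + P = 0" if "P \<in> carrier (cpoly_ring I)" for P
    using cpoly_ring_closed(7)[OF that] by (intro bexI[of _ "- P"]) auto
  then show "abelian_group (cpoly_ring I)"
    by (intro abelian_groupI) (auto simp: algebra_simps)
  show "Group.comm_monoid (cpoly_ring I)"
    by (intro comm_monoidI) (auto simp: algebra_simps)
qed (auto simp: algebra_simps)

lemma cpoly_a_minus: "P \<in> carrier (cpoly_ring I) \<Longrightarrow> \<ominus>\<^bsub>cpoly_ring I\<^esub> P = - P"
proof -
  interpret cring "cpoly_ring I" by (rule cring_cpoly)
  assume "P \<in> carrier (cpoly_ring I)"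
  then show ?thesis
    by (intro minus_equality) auto
qed

lemma cpoly_induct [consumes 1, case_names Const Var add mult]:
  assumes P: "P \<in> carrier (cpoly_ring I)"
    and "\<And>c. R (Const c)" "\<And>i. i \<in> I \<Longrightarrow> R (Var i)"
    and add: "\<And>P Q. P \<in> carrier (cpoly_ring I) \<Longrightarrow> Q \<in> carrier (cpoly_ring I) \<Longrightarrow>
      R P \<Longrightarrow> R Q \<Longrightarrow> R (P + Q)"
    and mult: "\<And>P Q. P \<in> carrier (cpoly_ring I) \<Longrightarrow> Q \<in> carrier (cpoly_ring I) \<Longrightarrow>
      R P \<Longrightarrow> R Q \<Longrightarrow> R (P * Q)"
  shows "R P"
proof -
  define C where "C = {P \<in> carrier (cpoly_ring I). R P}"
  have C: "Const c \<in> C" "i \<in> I \<Longrightarrow> Var i \<in> C" "P \<in> C \<Longrightarrow> Q \<in> C \<Longrightarrow> P + Q \<in> C"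
    "P \<in> C \<Longrightarrow> Q \<in> C \<Longrightarrow> P * Q \<in> C" for c i P Q
    using assms by (auto simp: C_def)
  have C01: "0 \<in> C" "1 \<in> C"
    using C(1)[of 0] C(1)[of 1] by (simp_all add: Const_def)
  have Csum: "(\<And>a. a \<in> A \<Longrightarrow> Q a \<in> C) \<Longrightarrow> sum Q A \<in> C" for Q :: "('i \<Rightarrow>\<^sub>0 nat) \<Rightarrow> _" and A
    by (induction A rule: infinite_finite_induct) (auto simp: C C01)
  have Cprod: "(\<And>a. a \<in> A \<Longrightarrow> Q a \<in> C) \<Longrightarrow> prod Q A \<in> C" for Q :: "'i \<Rightarrow> _" and A
    by (induction A rule: infinite_finite_induct) (auto simp: C C01)
  have Cpow: "Q \<in> C \<Longrightarrow> Q ^ k \<in> C" for Q k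
    by (induction k) (auto simp: C C01)
  have single: "Poly_Mapping.single m c = Const c * monomial_value Var m" for m :: "'i \<Rightarrow>\<^sub>0 nat" and c
  proof -
    have v: "Poly_Mapping.single m 1 = (monomial_value Var m :: 'i cpoly)" for m :: "'i \<Rightarrow>\<^sub>0 nat"
    proof -
      have p: "Poly_Mapping.single (Poly_Mapping.single i k) 1 = (Var i :: 'i cpoly) ^ k" for i k
      proof (induction k)
        case (Suc k)
        have "Poly_Mapping.single i (Suc k) = Poly_Mapping.single i 1 + Poly_Mapping.single i k"
          by (simp flip: single_add)
        moreover have "Var i ^ Suc k = Var i * Poly_Mapping.single (Poly_Mapping.single i k) 1"
          using Suc by simp
        ultimately show ?case
          by (simp add: Var_def mult_single)
      qed simp
      have s: "Poly_Mapping.single (sum f A) 1 = (\<Prod>a\<in>A. Poly_Mapping.single (f a) 1 :: 'i cpoly)"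
        for f :: "'i \<Rightarrow> 'i \<Rightarrow>\<^sub>0 nat" and A
      proof (induction A rule: infinite_finite_induct)
        case (insert a A)
        then show ?case
          using insert.IH[symmetric] by (simp add: mult_single)
      qed simp_all
      have "Poly_Mapping.single m (1::complex) = Poly_Mapping.single
          (\<Sum>i\<in>Poly_Mapping.keys m. Poly_Mapping.single i (Poly_Mapping.lookup m i)) 1"
        by (simp only: sum_single_lookup)
      then show ?thesis
        unfolding s p monomial_value_def .
    qed
    have "Poly_Mapping.single m c = Const c * Poly_Mapping.single m 1"
      by (simp add: Const_def mult_single)
    then show ?thesis
      unfolding v .
  qed
  have "(\<Sum>m\<in>Poly_Mapping.keys P. Poly_Mapping.single m (Poly_Mapping.lookup P m)) \<in> C"
    using P by (intro Csum) (auto simp: single monomial_value_def cpoly_ring_carrier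
        intro!: C(1,2,4) Cprod Cpow)
  then show ?thesis
    unfolding sum_single_lookup by (simp add: C_def)
qed

lemma cpoly_subst_closed:
  assumes P: "P \<in> carrier (cpoly_ring I)" and x: "\<And>i. i \<in> I \<Longrightarrow> x i \<in> carrier (cpoly_ring J)"
  shows "cpoly_subst Const x P \<in> carrier (cpoly_ring J)"
  using P by (induction rule: cpoly_induct)
    (auto simp: Const.subst_add Const.subst_mult x)

section \<open>Homogeneous polynomials\<close>

text \<open>The degree of a monomial with respect to the variables in \<open>Z\<close>.\<close>

definition weight :: "'i set \<Rightarrow> ('i \<Rightarrow>\<^sub>0 nat) \<Rightarrow> nat" where
  "weight Z m = (\<Sum>i\<in>Poly_Mapping.keys m \<inter> Z. Poly_Mapping.lookup m i)"

lemma weight_add: "weight Z (m + m') = weight Z m + weight Z m'"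
proof -
  let ?A = "(Poly_Mapping.keys m \<union> Poly_Mapping.keys m') \<inter> Z"
  have w: "weight Z k = (\<Sum>i\<in>?A. Poly_Mapping.lookup k i)"
    if "Poly_Mapping.keys k \<subseteq> Poly_Mapping.keys m \<union> Poly_Mapping.keys m'" for k
    unfolding weight_def using that by (intro sum.mono_neutral_left) (auto simp: in_keys_iff)
  show ?thesis
    by (subst (1 2 3) w) (auto simp: keys_add_nat lookup_add sum.distrib)
qed

lemma homogeneous_iff: "P \<in> homogeneous I Z d \<longleftrightarrow>
    P \<in> carrier (cpoly_ring I) \<and> (\<forall>m\<in>Poly_Mapping.keys P. weight Z m = d)"
  by (simp add: homogeneous_def weight_def)

lemma homogeneous_add:
  "P \<in> homogeneous I Z d \<Longrightarrow> Q \<in> homogeneous I Z d \<Longrightarrow> P + Q \<in> homogeneous I Z d"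
  using Poly_Mapping.keys_add[of P Q] by (auto simp: homogeneous_iff)

lemma homogeneous_mult:
  "P \<in> homogeneous I Z d \<Longrightarrow> Q \<in> homogeneous I Z e \<Longrightarrow> P * Q \<in> homogeneous I Z (d + e)"
  using keys_mult[of P Q] by (fastforce simp: homogeneous_iff weight_add)

lemma homogeneous_Const: "Const c \<in> homogeneous I Z 0"
  unfolding homogeneous_iff by (auto simp: Const_def weight_def cpoly_ring_carrier split: if_splits)

lemma homogeneous_one: "1 \<in> homogeneous I Z 0"
  using homogeneous_Const[of 1] by (simp add: Const_def)

lemma homogeneous_Var: "i \<in> I \<Longrightarrow> Var i \<in> homogeneous I Z (if i \<in> Z then 1 else 0)"
  unfolding homogeneous_iff by (auto simp: Var_def weight_def cpoly_ring_carrier)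

lemma homogeneous_power: "P \<in> homogeneous I Z d \<Longrightarrow> P ^ k \<in> homogeneous I Z (k * d)"
proof (induction k)
  case (Suc k)
  then show ?case
    using homogeneous_mult[of P I Z d "P ^ k" "k * d"] by simp
qed (simp add: homogeneous_one)

lemma homogeneous_prod:
  "(\<And>a. a \<in> A \<Longrightarrow> P a \<in> homogeneous I Z (d a)) \<Longrightarrow>
    (\<Prod>a\<in>A. P a) \<in> homogeneous I Z (\<Sum>a\<in>A. d a)"
proof (induction A rule: infinite_finite_induct)
  case (insert a A)
  then show ?case
    using homogeneous_mult[of "P a" I Z "d a" "prod P A" "sum d A"] by simp
qed (simp_all add: homogeneous_one)

lemma homogeneous_Var_power:
  "i \<in> I \<Longrightarrow> i \<in> Z \<Longrightarrow> Var i ^ k \<in> homogeneous I Z k"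
  using homogeneous_power[OF homogeneous_Var[of i I Z], of k] by simp

lemma homogeneous_eval_scale:
  assumes "P \<in> homogeneous Z Z d"
  shows "cpoly_eval P (\<lambda>i. c * x i) = c ^ d * cpoly_eval P x"
proof -
  have "monomial_value (\<lambda>i. c * x i) m = c ^ d * monomial_value x m"
    if m: "m \<in> Poly_Mapping.keys P" for m
  proof -
    have "Poly_Mapping.keys m \<inter> Z = Poly_Mapping.keys m" "weight Z m = d"
      using assms m by (auto simp: homogeneous_iff cpoly_ring_carrier)
    then have "c ^ d = (\<Prod>i\<in>Poly_Mapping.keys m. c ^ Poly_Mapping.lookup m i)"
      by (simp add: weight_def flip: power_sum)
    then show ?thesis
      by (simp add: monomial_value_def power_mult_distrib prod.distrib)
  qed
  then show ?thesis
    unfolding cpoly_subst_def monomial_value_def[symmetric] sum_distrib_left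
    by (intro sum.cong) auto
qed

section \<open>The kernel of the map to the symmetric algebra\<close>

lemma sym_relations_subset:
  assumes "complex_space M"
  shows "sym_relations M \<subseteq> carrier (cpoly_ring (carrier M))"
proof -
  interpret complex_space M by fact
  show ?thesis
    by (auto simp: sym_relations_def intro!: cpoly_ring_diff)
qed

lemma cpoly_ideal_simps:
  assumes "ideal L (cpoly_ring I)"
  shows "L \<subseteq> carrier (cpoly_ring I)" "0 \<in> L"
    and "P \<in> L \<Longrightarrow> Q \<in> L \<Longrightarrow> P + Q \<in> L"
    and "P \<in> L \<Longrightarrow> - P \<in> L"
    and "P \<in> L \<Longrightarrow> Q \<in> L \<Longrightarrow> P - Q \<in> L"
    and "P \<in> L \<Longrightarrow> Q \<in> carrier (cpoly_ring I) \<Longrightarrow> Q * P \<in> L"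
proof -
  interpret ideal L "cpoly_ring I" by fact
  show sub: "L \<subseteq> carrier (cpoly_ring I)" "0 \<in> L"
    using a_subset additive_subgroup.zero_closed[OF is_additive_subgroup] by auto
  show add: "P \<in> L \<Longrightarrow> Q \<in> L \<Longrightarrow> P + Q \<in> L" for P Q
    using additive_subgroup.a_closed[OF is_additive_subgroup] by simp
  show neg: "P \<in> L \<Longrightarrow> - P \<in> L" for P
    using additive_subgroup.a_inv_closed[OF is_additive_subgroup, of P] cpoly_a_minus[of P I] sub
    by auto
  show "P \<in> L \<Longrightarrow> Q \<in> L \<Longrightarrow> P - Q \<in> L"
    using add[of P "- Q"] neg[of Q] by simp
  show "P \<in> L \<Longrightarrow> Q \<in> carrier (cpoly_ring I) \<Longrightarrow> Q * P \<in> L"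
    using I_l_closed[of P Q] by simp
qed

lemma cpoly_ideal_sum:
  assumes "ideal L (cpoly_ring I)" "\<And>x. x \<in> A \<Longrightarrow> P x \<in> L"
  shows "sum P A \<in> L"
  using assms(2)
  by (induction A rule: infinite_finite_induct) (simp_all add: cpoly_ideal_simps(2,3)[OF assms(1)])

lemma ideal_Idl: "S \<subseteq> carrier (cpoly_ring I) \<Longrightarrow> ideal (Idl\<^bsub>cpoly_ring I\<^esub> S) (cpoly_ring I)"
  by (rule ring.genideal_ideal) (use cring_cpoly in \<open>auto simp: cring_def\<close>)

text \<open>The preimage of an ideal under a substitution of polynomials.\<close>

lemma ideal_subst_vimage:
  assumes L: "ideal L (cpoly_ring J)" and x: "\<And>i. i \<in> I \<Longrightarrow> x i \<in> carrier (cpoly_ring J)"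
  shows "ideal {P \<in> carrier (cpoly_ring I). cpoly_subst Const x P \<in> L} (cpoly_ring I)" (is "ideal ?K _")
proof (rule idealI)
  interpret cring "cpoly_ring I" by (rule cring_cpoly)
  note L' = cpoly_ideal_simps[OF L]
  show "ring (cpoly_ring I)"
    by (rule ring_axioms)
  show "subgroup ?K (add_monoid (cpoly_ring I))"
  proof (rule add.subgroupI)
    show "?K \<noteq> {}"
      using L'(2) by (auto intro!: exI[of _ 0])
    show "\<ominus>\<^bsub>cpoly_ring I\<^esub> P \<in> ?K" if "P \<in> ?K" for P
      using that L'(4) by (auto simp: cpoly_a_minus Const.subst_minus)
    show "P \<oplus>\<^bsub>cpoly_ring I\<^esub> Q \<in> ?K" if "P \<in> ?K" "Q \<in> ?K" for P Q
      using that L'(3) by (auto simp: Const.subst_add)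
  qed auto
  have *: "Q * P \<in> ?K" if "P \<in> ?K" "Q \<in> carrier (cpoly_ring I)" for P Q
    using that L'(6) cpoly_subst_closed[OF that(2) x] by (auto simp: Const.subst_mult)
  show "Q \<otimes>\<^bsub>cpoly_ring I\<^esub> P \<in> ?K" if "P \<in> ?K" "Q \<in> carrier (cpoly_ring I)" for P Q
    using *[OF that] by simp
  show "P \<otimes>\<^bsub>cpoly_ring I\<^esub> Q \<in> ?K" if "P \<in> ?K" "Q \<in> carrier (cpoly_ring I)" for P Q
    using *[OF that] by (simp add: mult.commute)
qed

lemma Idl_subst:
  assumes L: "ideal L (cpoly_ring J)" and S: "S \<subseteq> carrier (cpoly_ring I)"
    and x: "\<And>i. i \<in> I \<Longrightarrow> x i \<in> carrier (cpoly_ring J)"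
    and gen: "\<And>P. P \<in> S \<Longrightarrow> cpoly_subst Const x P \<in> L"
    and P: "P \<in> Idl\<^bsub>cpoly_ring I\<^esub> S"
  shows "P \<in> carrier (cpoly_ring I)" "cpoly_subst Const x P \<in> L"
proof -
  have "ideal {P \<in> carrier (cpoly_ring I). cpoly_subst Const x P \<in> L} (cpoly_ring I)"
    by (rule ideal_subst_vimage[OF L x])
  then have "Idl\<^bsub>cpoly_ring I\<^esub> S \<subseteq> {P \<in> carrier (cpoly_ring I). cpoly_subst Const x P \<in> L}"
    using S gen cring_cpoly by (intro ring.genideal_minimal) (auto simp: cring_def)
  then show "P \<in> carrier (cpoly_ring I)" "cpoly_subst Const x P \<in> L"
    using P by auto
qed

context complex_space
begin

lemma sym_ideal: "ideal (sym_ideal M) (cpoly_ring (carrier M))"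
  unfolding sym_ideal_def
  by (rule ideal_Idl) (rule sym_relations_subset[OF complex_space_axioms])

lemmas sym_ideal_simps = cpoly_ideal_simps[OF sym_ideal]

lemma sym_relations_ideal: "sym_relations M \<subseteq> sym_ideal M"
  unfolding sym_ideal_def using cring_cpoly sym_relations_subset[OF complex_space_axioms]
  by (intro ring.genideal_self) (auto simp: cring_def)

lemma sym_ideal_add:
  "v \<in> carrier M \<Longrightarrow> w \<in> carrier M \<Longrightarrow> Var (v \<oplus> w) - Var v - Var w \<in> sym_ideal M"
  using sym_relations_ideal unfolding sym_relations_def by blast

lemma sym_ideal_smult: "v \<in> carrier M \<Longrightarrow> Var (c \<odot> v) - Const c * Var v \<in> sym_ideal M"
  using sym_relations_ideal unfolding sym_relations_def by blast

lemma sym_ideal_finsum: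
  assumes "finite A" "\<And>k. k \<in> A \<Longrightarrow> b k \<in> carrier M"
  shows "Var (\<Oplus>k\<in>A. c k \<odot> b k) - (\<Sum>k\<in>A. Const (c k) * Var (b k)) \<in> sym_ideal M"
  using assms
proof (induction A)
  case empty
  show ?case
    using sym_ideal_smult[of \<zero> 0] by (simp add: Const_def)
next
  case (insert a A)
  have "(\<Oplus>k\<in>insert a A. c k \<odot> b k) = c a \<odot> b a \<oplus> (\<Oplus>k\<in>A. c k \<odot> b k)"
    using insert by (intro finsum_insert) auto
  moreover have "Var (c a \<odot> b a \<oplus> (\<Oplus>k\<in>A. c k \<odot> b k)) - Var (c a \<odot> b a) - Var (\<Oplus>k\<in>A. c k \<odot> b k)
      \<in> sym_ideal M"
    using insert by (intro sym_ideal_add) auto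
  then have "Var (c a \<odot> b a \<oplus> (\<Oplus>k\<in>A. c k \<odot> b k)) - Var (c a \<odot> b a) - Var (\<Oplus>k\<in>A. c k \<odot> b k)
      + ((Var (c a \<odot> b a) - Const (c a) * Var (b a))
      + (Var (\<Oplus>k\<in>A. c k \<odot> b k) - (\<Sum>k\<in>A. Const (c k) * Var (b k)))) \<in> sym_ideal M"
    using insert by (intro sym_ideal_simps(3) sym_ideal_smult) auto
  ultimately show ?case
    using insert by (simp add: algebra_simps)
qed

text \<open>
  Elements of the kernel of \<open>y\<^sub>j \<mapsto> b j\<close> generate it if they generate the linear forms that express
  the linear relations between the vectors \<open>b j\<close>: modulo these, a polynomial is recovered from
  its image by substituting for every vector one of the linear forms representing it.
\<close>

lemma kernel_to_sym:
  assumes J: "finite J" and b: "\<And>j. j \<in> J \<Longrightarrow> b j \<in> carrier M"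
    and span: "lin_span M (b ` J) = carrier M"
    and S: "S \<subseteq> carrier (cpoly_ring J)"
    and gen: "\<And>P. P \<in> S \<Longrightarrow> cpoly_subst Const (\<lambda>j. Var (b j)) P \<in> sym_ideal M"
    and rel: "\<And>c. (\<Oplus>j\<in>J. c j \<odot> b j) = \<zero> \<Longrightarrow>
      (\<Sum>j\<in>J. Const (c j) * Var j) \<in> Idl\<^bsub>cpoly_ring J\<^esub> S"
  shows "Idl\<^bsub>cpoly_ring J\<^esub> S = a_kernel (cpoly_ring J) (sym_algebra M) (to_sym M b)"
proof -
  let ?R = "cpoly_ring (carrier M)" and ?s = "cpoly_subst Const (\<lambda>j. Var (b j))"
  let ?L = "Idl\<^bsub>cpoly_ring J\<^esub> S"
  interpret sym: cring ?R by (rule cring_cpoly)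
  interpret sym_ideal: ideal "sym_ideal M" ?R by (rule sym_ideal)
  have L: "ideal ?L (cpoly_ring J)"
    by (rule ideal_Idl[OF S])
  note L' = cpoly_ideal_simps[OF L]
  have s_closed: "?s P \<in> carrier ?R" if "P \<in> carrier (cpoly_ring J)" for P
    using that b by (intro cpoly_subst_closed) auto
  have kernel: "P \<in> a_kernel (cpoly_ring J) (sym_algebra M) (to_sym M b) \<longleftrightarrow>
      P \<in> carrier (cpoly_ring J) \<and> ?s P \<in> sym_ideal M" for P
  proof (cases "P \<in> carrier (cpoly_ring J)")
    case True
    have "sym_ideal M +>\<^bsub>?R\<^esub> ?s P = sym_ideal M \<longleftrightarrow> ?s P \<in> sym_ideal M"
      using sym_ideal.a_rcos_const sym_ideal.rcos_const_imp_mem s_closed[OF True] by blast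
    then show ?thesis
      by (simp add: a_kernel_def' to_sym_def sym_algebra_def FactRing_def)
  qed (simp add: a_kernel_def')
  have "\<exists>c. v = (\<Oplus>j\<in>J. c j \<odot> b j)" if "v \<in> carrier M" for v
    using that lin_span_image[OF J b] span by auto
  then obtain c where c: "\<And>v. v \<in> carrier M \<Longrightarrow> v = (\<Oplus>j\<in>J. c v j \<odot> b j)"
    by metis
  define l where "l v = (\<Sum>j\<in>J. Const (c v j) * Var j)" for v
  have l_closed: "l v \<in> carrier (cpoly_ring J)" for v
    unfolding l_def by (intro cpoly_ring_sum) auto
  have "cpoly_subst Const l P \<in> ?L" if P: "P \<in> sym_relations M" for P
  proof -
    consider v w where "v \<in> carrier M" "w \<in> carrier M" "P = Var (v \<oplus> w) - Var v - Var w"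
      | d v where "v \<in> carrier M" "P = Var (d \<odot> v) - Const d * Var v"
      using P by (auto simp: sym_relations_def)
    then show ?thesis
    proof cases
      case 1
      let ?d = "\<lambda>j. c (v \<oplus> w) j + (-1) * (c v j + c w j)"
      have "(\<Oplus>j\<in>J. ?d j \<odot> b j) = (v \<oplus> w) \<oplus> (-1) \<odot> (v \<oplus> w)"
        using 1 J b by (simp only: finsum_add_coeff finsum_smult_coeff c[symmetric] M.a_closed)
      also have "\<dots> = \<zero>"
        using add_smult[of "v \<oplus> w" 1 "-1"] 1 by simp
      finally have "(\<Sum>j\<in>J. Const (?d j) * Var j) \<in> ?L"
        by (rule rel)
      also have "(\<Sum>j\<in>J. Const (?d j) * Var j) = cpoly_subst Const l P"
        unfolding 1 by (simp add: Const.subst_diff l_def Const.h_add Const_uminus Const_diff sum_negf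
            left_diff_distrib distrib_right sum.distrib sum_subtractf)
      finally show ?thesis .
    next
      case 2
      let ?d = "\<lambda>j. c (d \<odot> v) j + (-1) * (d * c v j)"
      have "(\<Oplus>j\<in>J. ?d j \<odot> b j) = d \<odot> v \<oplus> (-1) \<odot> (d \<odot> v)"
        using 2 J b by (simp only: finsum_add_coeff finsum_smult_coeff c[symmetric] smult_in)
      also have "\<dots> = \<zero>"
        using add_smult[of "d \<odot> v" 1 "-1"] 2 by simp
      finally have "(\<Sum>j\<in>J. Const (?d j) * Var j) \<in> ?L"
        by (rule rel)
      also have "(\<Sum>j\<in>J. Const (?d j) * Var j) = cpoly_subst Const l P"
        unfolding 2 by (simp add: Const.subst_diff Const.subst_mult l_def Const.h_mult Const_uminus Const_diff sum_negf
            sum_distrib_left left_diff_distrib sum_subtractf mult.assoc)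
      finally show ?thesis .
    qed
  qed
  then have lift_back: "cpoly_subst Const l P \<in> ?L" if "P \<in> sym_ideal M" for P
    using Idl_subst(2)[OF L sym_relations_subset[OF complex_space_axioms], of l P] l_closed that
    unfolding sym_ideal_def by blast
  have recover: "cpoly_subst Const l (?s P) - P \<in> ?L" if "P \<in> carrier (cpoly_ring J)" for P
    using that
  proof (induction rule: cpoly_induct)
    case (Const c)
    then show ?case
      using L'(2) by simp
  next
    case (Var i)
    let ?d = "\<lambda>j. c (b i) j + (if j = i then -1 else 0)"
    have "(\<Oplus>j\<in>J. ?d j \<odot> b j) = b i \<oplus> (-1) \<odot> b i"
      using Var J b by (simp only: finsum_add_coeff finsum_unit_coeff c[symmetric])
    also have "\<dots> = \<zero>"
      using add_smult[of "b i" 1 "-1"] b[OF Var] by simp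
    finally have "(\<Sum>j\<in>J. Const (?d j) * Var j) \<in> ?L"
      by (rule rel)
    also have "(\<Sum>j\<in>J. Const (?d j) * Var j) = l (b i) + (\<Sum>j\<in>J. if i = j then - Var j else 0)"
      unfolding l_def sum.distrib[symmetric]
      by (intro sum.cong) (auto simp: Const_def single_diff left_diff_distrib)
    also have "\<dots> = cpoly_subst Const l (?s (Var i)) - Var i"
      using J Var by simp
    finally show ?case .
  next
    case (add P Q)
    then show ?case
      using L'(3)[OF add(3,4)] by (simp add: Const.subst_add algebra_simps)
  next
    case (mult P Q)
    let ?t = "\<lambda>P. cpoly_subst Const l (?s P)"
    have "?t P \<in> carrier (cpoly_ring J)"
      using s_closed[OF mult(1)] l_closed by (rule cpoly_subst_closed)
    then have "?t P * (?t Q - Q) + Q * (?t P - P) \<in> ?L"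
      using mult L'(3,6) by blast
    then show ?case
      by (simp add: Const.subst_mult algebra_simps)
  qed
  show ?thesis
  proof (intro equalityI subsetI)
    fix P assume "P \<in> ?L"
    then show "P \<in> a_kernel (cpoly_ring J) (sym_algebra M) (to_sym M b)"
      using Idl_subst[OF sym_ideal S _ gen, of P] b unfolding kernel by auto
  next
    fix P assume "P \<in> a_kernel (cpoly_ring J) (sym_algebra M) (to_sym M b)"
    then have P: "P \<in> carrier (cpoly_ring J)" "?s P \<in> sym_ideal M"
      unfolding kernel by auto
    show "P \<in> ?L"
      using L'(5)[OF lift_back[OF P(2)] recover[OF P(1)]] by simp
  qed
qed

end

section \<open>Points, the torus and open sets\<close>

lemma hpoint_self: "x \<in> hpoint x"
  unfolding hpoint_def by (intro CollectI exI[of _ 1]) auto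

lemma hpoint_scale:
  assumes "c \<noteq> 0"
  shows "hpoint (\<lambda>i. c * x i) = hpoint x"
proof -
  have "\<exists>e. (\<lambda>i. d * x i) = (\<lambda>i. e * (c * x i)) \<and> e \<noteq> 0" if "d \<noteq> 0" for d
    using assms that by (intro exI[of _ "d / c"]) auto
  moreover have "\<exists>e. (\<lambda>i. d * (c * x i)) = (\<lambda>i. e * x i) \<and> e \<noteq> 0" if "d \<noteq> 0" for d
    using assms that by (intro exI[of _ "d * c"]) (auto simp: mult.assoc)
  ultimately show ?thesis
    unfolding hpoint_def by auto
qed

lemma Pn_member:
  assumes "p \<in> Pn n" "x \<in> p"
  shows "p = hpoint x" "\<And>i. i > n \<Longrightarrow> x i = 0" "\<exists>i\<le>n. x i \<noteq> 0"
proof -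
  obtain y where y: "p = hpoint y" "\<forall>i>n. y i = 0" "\<exists>i\<le>n. y i \<noteq> 0"
    using assms(1) by (auto simp: Pn_def)
  obtain c where c: "c \<noteq> 0" "x = (\<lambda>i. c * y i)"
    using assms(2) y(1) by (auto simp: hpoint_def)
  show "p = hpoint x"
    using y(1) c hpoint_scale by simp
  show "x i = 0" if "i > n" for i
    using y c that by simp
  show "\<exists>i\<le>n. x i \<noteq> 0"
    using y c by simp
qed

lemma Pn_obtain:
  assumes "p \<in> Pn n"
  obtains x where "x \<in> p"
  using assms hpoint_self by (auto simp: Pn_def)

lemma Pn_ratio:
  assumes "p \<in> Pn n" "x \<in> p" "y \<in> p"
  obtains c where "c \<noteq> 0" "y = (\<lambda>i. c * x i)"
  using assms(3) Pn_member(1)[OF assms(1,2)] by (auto simp: hpoint_def)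

lemma Pn_scale: "p \<in> Pn n \<Longrightarrow> x \<in> p \<Longrightarrow> c \<noteq> 0 \<Longrightarrow> (\<lambda>i. c * x i) \<in> p"
  using Pn_member(1)[of p n x] by (auto simp: hpoint_def)

lemma torus_nonzero: "t \<in> torus n \<Longrightarrow> t i \<noteq> 0"
  by (cases "i \<in> {1..n}") (auto simp: torus_def)

lemma torus_closed:
  "(\<lambda>i. 1) \<in> torus n"
  "s \<in> torus n \<Longrightarrow> t \<in> torus n \<Longrightarrow> tmult s t \<in> torus n"
  "t \<in> torus n \<Longrightarrow> tinv t \<in> torus n"
  by (auto simp: torus_def tmult_def tinv_def)

lemma tmult_tinv: "t \<in> torus n \<Longrightarrow> tmult (tinv t) (tmult t x) = x"
  "t \<in> torus n \<Longrightarrow> tmult t (tmult (tinv t) x) = x"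
  using torus_nonzero[of t n] by (auto simp: tmult_def tinv_def)

lemma tpoint_hpoint: "tpoint t (hpoint x) = hpoint (tmult t x)"
proof -
  have "tmult t (\<lambda>i. c * x i) = (\<lambda>i. c * tmult t x i)" for c
    by (simp add: tmult_def mult.left_commute)
  moreover have "hpoint x = (\<lambda>c i. c * x i) ` {c. c \<noteq> 0}" for x
    by (auto simp: hpoint_def)
  ultimately show ?thesis
    by (simp add: tpoint_def image_image)
qed

lemma tpoint_in_Pn:
  assumes t: "t \<in> torus n" and p: "p \<in> Pn n"
  shows "tpoint t p \<in> Pn n"
proof -
  obtain x where x: "p = hpoint x" "\<forall>i>n. x i = 0" "\<exists>i\<le>n. x i \<noteq> 0"
    using p by (auto simp: Pn_def)
  then show ?thesis
    using torus_nonzero[OF t] unfolding Pn_def x tpoint_hpoint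
    by (intro CollectI exI[of _ "tmult t x"]) (auto simp: tmult_def)
qed

lemma tpoint_one: "tpoint (\<lambda>i. 1) p = p"
  by (simp add: tpoint_def tmult_def)

lemma tpoint_tmult: "tpoint (tmult s t) p = tpoint s (tpoint t p)"
  by (simp add: tpoint_def tmult_def image_image mult.assoc)

lemma tpoint_tinv: "t \<in> torus n \<Longrightarrow> tpoint (tinv t) (tpoint t p) = p"
  by (simp add: tpoint_def image_image tmult_tinv)

lemma zariski_open_subset: "zariski_open n U \<Longrightarrow> U \<subseteq> Pn n"
  by (auto simp: zariski_open_def)

lemma zariski_openD:
  assumes "zariski_open n U" "p \<in> U"
  shows "\<exists>d. \<exists>P\<in>homogeneous {..n} {..n} d.
     (\<forall>x\<in>p. cpoly_eval P x \<noteq> 0) \<and> (\<forall>q\<in>Pn n. (\<forall>x\<in>q. cpoly_eval P x \<noteq> 0) \<longrightarrow> q \<in> U)"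
proof -
  obtain S where S: "S \<subseteq> (\<Union>d. homogeneous {..n} {..n} d)"
    "U = {p \<in> Pn n. \<exists>P\<in>S. \<forall>x\<in>p. cpoly_eval P x \<noteq> 0}"
    using assms(1) by (auto simp: zariski_open_def)
  then obtain P where P: "P \<in> S" "\<forall>x\<in>p. cpoly_eval P x \<noteq> 0"
    using assms(2) by auto
  moreover obtain d where "P \<in> homogeneous {..n} {..n} d"
    using S(1) P(1) by blast
  moreover have "\<forall>q\<in>Pn n. (\<forall>x\<in>q. cpoly_eval P x \<noteq> 0) \<longrightarrow> q \<in> U"
    unfolding S(2) using P(1) by simp blast
  ultimately show ?thesis
    by blast
qed

lemma zariski_open_basic:
  "P \<in> homogeneous {..n} {..n} d \<Longrightarrow> zariski_open n {p \<in> Pn n. \<forall>x\<in>p. cpoly_eval P x \<noteq> 0}"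
  unfolding zariski_open_def by (intro exI[of _ "{P}"]) auto

lemma zariski_open_Int:
  assumes "zariski_open n U" "zariski_open n V"
  shows "zariski_open n (U \<inter> V)"
proof -
  obtain S where S: "S \<subseteq> (\<Union>d. homogeneous {..n} {..n} d)"
    "U = {p \<in> Pn n. \<exists>P\<in>S. \<forall>x\<in>p. cpoly_eval P x \<noteq> 0}"
    using assms(1) by (auto simp: zariski_open_def)
  obtain T where T: "T \<subseteq> (\<Union>d. homogeneous {..n} {..n} d)"
    "V = {p \<in> Pn n. \<exists>P\<in>T. \<forall>x\<in>p. cpoly_eval P x \<noteq> 0}"
    using assms(2) by (auto simp: zariski_open_def)
  let ?ST = "(\<lambda>(P, Q). P * Q) ` (S \<times> T)"
  have "?ST \<subseteq> (\<Union>d. homogeneous {..n} {..n} d)"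
    using S(1) T(1) homogeneous_mult by fastforce
  moreover have "U \<inter> V = {p \<in> Pn n. \<exists>P\<in>?ST. \<forall>x\<in>p. cpoly_eval P x \<noteq> 0}"
    unfolding S(2) T(2) by (auto simp: eval_simps)
  ultimately show ?thesis
    unfolding zariski_open_def by (intro exI[of _ ?ST]) simp
qed

text \<open>The affine chart \<open>x\<^sub>k \<noteq> 0\<close>, the toric chart of the maximal cone \<open>k\<close>.\<close>

definition coord_chart :: "nat \<Rightarrow> nat \<Rightarrow> ppoint set" where
  "coord_chart n k = {p \<in> Pn n. \<forall>x\<in>p. x k \<noteq> 0}"

lemma open_coord_chart: "k \<le> n \<Longrightarrow> zariski_open n (coord_chart n k)"
  using zariski_open_basic[of "Var k" n 1] homogeneous_Var[of k "{..n}" "{..n}"]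
  by (simp add: coord_chart_def)

lemma open_ray_chart: "zariski_open n (ray_chart n i)"
proof -
  let ?P = "\<Prod>k\<in>{..n} - {i}. Var k :: nat cpoly"
  have "?P \<in> homogeneous {..n} {..n} (\<Sum>k\<in>{..n} - {i}. 1)"
    using homogeneous_Var[of _ "{..n}" "{..n}"] by (intro homogeneous_prod) auto
  moreover have "ray_chart n i = {p \<in> Pn n. \<forall>x\<in>p. cpoly_eval ?P x \<noteq> 0}"
    by (auto simp: ray_chart_def eval_simps)
  ultimately show ?thesis
    using zariski_open_basic by simp
qed

lemma ray_chart_subset: "k \<le> n \<Longrightarrow> k \<noteq> i \<Longrightarrow> ray_chart n i \<subseteq> coord_chart n k"
  by (auto simp: ray_chart_def coord_chart_def)

lemma coord_chart_cover:
  assumes "p \<in> Pn n"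
  obtains k where "k \<le> n" "p \<in> coord_chart n k"
proof -
  obtain x where x: "x \<in> p"
    using assms by (rule Pn_obtain)
  then obtain k where k: "k \<le> n" "x k \<noteq> 0"
    using Pn_member(3)[OF assms] by blast
  have "y k \<noteq> 0" if "y \<in> p" for y
    by (rule Pn_ratio[OF assms x that]) (use k(2) in auto)
  then have "p \<in> coord_chart n k"
    using assms by (simp add: coord_chart_def)
  with k(1) show ?thesis ..
qed

lemma tpoint_coord_chart: "t \<in> torus n \<Longrightarrow> p \<in> coord_chart n k \<Longrightarrow> tpoint t p \<in> coord_chart n k"
  using tpoint_in_Pn torus_nonzero by (auto simp: coord_chart_def tpoint_def tmult_def)

lemma tpoint_ray_chart: "t \<in> torus n \<Longrightarrow> p \<in> ray_chart n i \<Longrightarrow> tpoint t p \<in> ray_chart n i"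
  using tpoint_in_Pn torus_nonzero by (auto simp: ray_chart_def tpoint_def tmult_def)

lemma identity_in_ray_chart: "identity_point n \<in> ray_chart n i"
  by (auto simp: ray_chart_def identity_point_def hpoint_def Pn_def
      intro!: exI[of _ "\<lambda>i. if i \<le> n then 1 else 0"])

lemma ray_chart_in_Pn: "ray_chart n i \<subseteq> Pn n"
  by (auto simp: ray_chart_def)

lemma identity_in_Pn: "identity_point n \<in> Pn n"
  using identity_in_ray_chart ray_chart_in_Pn by blast

text \<open>The identity lies in the chart of every ray, in particular of one different from \<open>k\<close>.\<close>

lemma identity_in_coord_chart: "k \<le> n \<Longrightarrow> identity_point n \<in> coord_chart n k"
  using identity_in_ray_chart[of n "Suc k"] ray_chart_subset[of k n "Suc k"] by auto

section \<open>Regular functions\<close>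

text \<open>The function \<open>f\<close> on \<open>U\<close> equals \<open>P / Q\<close> wherever \<open>Q\<close> does not vanish, in particular at \<open>p\<close>.\<close>

definition fraction_at ::
    "ppoint set \<Rightarrow> ppoint \<Rightarrow> (ppoint \<Rightarrow> complex) \<Rightarrow> nat cpoly \<Rightarrow> nat cpoly \<Rightarrow> bool" where
  "fraction_at U p f P Q \<longleftrightarrow> (\<forall>x\<in>p. cpoly_eval Q x \<noteq> 0) \<and>
     (\<forall>q\<in>U. \<forall>x\<in>q. cpoly_eval Q x \<noteq> 0 \<longrightarrow> f q = cpoly_eval P x / cpoly_eval Q x)"

lemma fraction_atD:
  assumes "fraction_at U p f P Q"
  shows "x \<in> p \<Longrightarrow> cpoly_eval Q x \<noteq> 0"
    and "q \<in> U \<Longrightarrow> x \<in> q \<Longrightarrow> cpoly_eval Q x \<noteq> 0 \<Longrightarrow> f q = cpoly_eval P x / cpoly_eval Q x"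
  using assms by (simp_all add: fraction_at_def)

lemma regular_iff: "f \<in> regular_functions n U \<longleftrightarrow>
    (\<forall>p\<in>U. \<exists>d. \<exists>P\<in>homogeneous {..n} {..n} d. \<exists>Q\<in>homogeneous {..n} {..n} d. fraction_at U p f P Q)"
  by (simp add: regular_functions_def fraction_at_def)

lemma regular_mono:
  assumes "f \<in> regular_functions n U" "V \<subseteq> U"
  shows "f \<in> regular_functions n V"
proof -
  have "fraction_at V p f P Q" if "fraction_at U p f P Q" for p P Q
    using that assms(2) unfolding fraction_at_def by auto
  then show ?thesis
    using assms unfolding regular_iff by blast
qed

lemma regular_cong:
  assumes "f \<in> regular_functions n U" "\<And>p. p \<in> U \<Longrightarrow> g p = f p"
  shows "g \<in> regular_functions n U"
  using assms unfolding regular_functions_def by simp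

lemma regular_const: "(\<lambda>_. c) \<in> regular_functions n U"
proof -
  have "fraction_at U p (\<lambda>_. c) (Const c) 1" for p
    by (simp add: fraction_at_def)
  then show ?thesis
    unfolding regular_iff using homogeneous_Const homogeneous_one by blast
qed

lemma regular_add:
  assumes "f \<in> regular_functions n U" "g \<in> regular_functions n U"
  shows "(\<lambda>p. f p + g p) \<in> regular_functions n U"
  unfolding regular_iff
proof
  fix p assume p: "p \<in> U"
  obtain d P Q where PQ: "P \<in> homogeneous {..n} {..n} d" "Q \<in> homogeneous {..n} {..n} d"
    "fraction_at U p f P Q"
    using assms(1) p unfolding regular_iff by blast
  obtain e A B where AB: "A \<in> homogeneous {..n} {..n} e" "B \<in> homogeneous {..n} {..n} e"
    "fraction_at U p g A B"
    using assms(2) p unfolding regular_iff by blast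
  have "fraction_at U p (\<lambda>p. f p + g p) (P * B + Q * A) (Q * B)"
    using fraction_atD[OF PQ(3)] fraction_atD[OF AB(3)]
    by (simp add: fraction_at_def eval_simps add_divide_distrib)
  moreover have "P * B + Q * A \<in> homogeneous {..n} {..n} (d + e)"
    by (intro homogeneous_add homogeneous_mult PQ AB)
  ultimately show "\<exists>d. \<exists>P\<in>homogeneous {..n} {..n} d. \<exists>Q\<in>homogeneous {..n} {..n} d.
      fraction_at U p (\<lambda>p. f p + g p) P Q"
    using homogeneous_mult[OF PQ(2) AB(2)] by blast
qed

lemma regular_mult:
  assumes "f \<in> regular_functions n U" "g \<in> regular_functions n U"
  shows "(\<lambda>p. f p * g p) \<in> regular_functions n U"
  unfolding regular_iff
proof
  fix p assume p: "p \<in> U"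
  obtain d P Q where PQ: "P \<in> homogeneous {..n} {..n} d" "Q \<in> homogeneous {..n} {..n} d"
    "fraction_at U p f P Q"
    using assms(1) p unfolding regular_iff by blast
  obtain e A B where AB: "A \<in> homogeneous {..n} {..n} e" "B \<in> homogeneous {..n} {..n} e"
    "fraction_at U p g A B"
    using assms(2) p unfolding regular_iff by blast
  have "fraction_at U p (\<lambda>p. f p * g p) (P * A) (Q * B)"
    using fraction_atD[OF PQ(3)] fraction_atD[OF AB(3)]
    by (simp add: fraction_at_def eval_simps)
  then show "\<exists>d. \<exists>P\<in>homogeneous {..n} {..n} d. \<exists>Q\<in>homogeneous {..n} {..n} d.
      fraction_at U p (\<lambda>p. f p * g p) P Q"
    using homogeneous_mult[OF PQ(1) AB(1)] homogeneous_mult[OF PQ(2) AB(2)] by blast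
qed

lemma regular_sum:
  "(\<And>a. a \<in> A \<Longrightarrow> f a \<in> regular_functions n U) \<Longrightarrow>
    (\<lambda>p. \<Sum>a\<in>A. f a p) \<in> regular_functions n U"
  by (induction A rule: infinite_finite_induct) (simp_all add: regular_const regular_add)

text \<open>
  Regularity is local. The denominator is multiplied by a polynomial that vanishes outside
  the smaller open set, as a fraction has to represent the function wherever its
  denominator does not vanish.
\<close>

lemma regular_local:
  assumes U: "U \<subseteq> Pn n"
    and loc: "\<And>p. p \<in> U \<Longrightarrow> \<exists>V. zariski_open n V \<and> p \<in> V \<and> f \<in> regular_functions n (V \<inter> U)"
  shows "f \<in> regular_functions n U"
  unfolding regular_iff
proof
  fix p assume p: "p \<in> U"
  obtain V where V: "zariski_open n V" "p \<in> V" "f \<in> regular_functions n (V \<inter> U)"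
    using loc[OF p] by blast
  have "p \<in> V \<inter> U"
    using p V by blast
  then obtain d P Q where PQ: "P \<in> homogeneous {..n} {..n} d" "Q \<in> homogeneous {..n} {..n} d"
    "fraction_at (V \<inter> U) p f P Q"
    using V(3) unfolding regular_iff by blast
  obtain e R where R: "R \<in> homogeneous {..n} {..n} e" "\<forall>x\<in>p. cpoly_eval R x \<noteq> 0"
    "\<forall>q\<in>Pn n. (\<forall>x\<in>q. cpoly_eval R x \<noteq> 0) \<longrightarrow> q \<in> V"
    using zariski_openD[OF V(1,2)] by (elim exE bexE conjE)
  have "fraction_at U p f (P * R) (Q * R)"
    unfolding fraction_at_def
  proof (intro conjI ballI impI)
    show "cpoly_eval (Q * R) x \<noteq> 0" if "x \<in> p" for x
      using fraction_atD(1)[OF PQ(3)] R(2) that by (simp add: eval_simps)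
    fix q x assume q: "q \<in> U" "x \<in> q" "cpoly_eval (Q * R) x \<noteq> 0"
    have qn: "q \<in> Pn n"
      using q U by blast
    have "cpoly_eval R z \<noteq> 0" if "z \<in> q" for z
      by (rule Pn_ratio[OF qn q(2) that])
        (use q(3) homogeneous_eval_scale[OF R(1)] in \<open>simp add: eval_simps\<close>)
    then have "q \<in> V \<inter> U"
      using R(3) q(1) qn by simp
    then show "f q = cpoly_eval (P * R) x / cpoly_eval (Q * R) x"
      using fraction_atD(2)[OF PQ(3)] q by (simp add: eval_simps)
  qed
  then show "\<exists>d. \<exists>P\<in>homogeneous {..n} {..n} d. \<exists>Q\<in>homogeneous {..n} {..n} d. fraction_at U p f P Q"
    using homogeneous_mult[OF PQ(1) R(1)] homogeneous_mult[OF PQ(2) R(1)] by blast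
qed

section \<open>Bundles with equivariant frames\<close>

lemma frame_iff: "frame n r E U b \<longleftrightarrow> zariski_open n U \<and>
    (\<forall>p\<in>U. family_basis (fibre E p) r (\<lambda>k. b k p)) \<and>
    (\<forall>V s. zariski_open n V \<and> V \<subseteq> U \<longrightarrow>
        (s \<in> sections E V \<longleftrightarrow> (\<exists>f. (\<forall>k<r. f k \<in> regular_functions n V) \<and>
           (\<forall>p\<in>V. s p = (\<Oplus>\<^bsub>fibre E p\<^esub>k\<in>{..<r}. f k p \<odot>\<^bsub>fibre E p\<^esub> b k p)))))"
  unfolding frame_def family_basis_def ball_conj_distrib by (simp add: conj_assoc)

text \<open>
  The part of a toric vector bundle that does not depend on frames: a sheaf of sections and a
  linear action of the torus. That sections can be restricted has to be required, because the
  sheaf condition in the definition of a vector bundle does not by itself imply it.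
\<close>

locale equivariant_bundle =
  fixes n :: nat and E :: "'v tbundle"
  assumes fibre_space: "p \<in> Pn n \<Longrightarrow> complex_space (fibre E p)"
    and restriction: "\<lbrakk>zariski_open n U; zariski_open n V; V \<subseteq> U; s \<in> sections E U\<rbrakk> \<Longrightarrow> s \<in> sections E V"
    and gluing: "\<lbrakk>zariski_open n U; \<And>p. p \<in> U \<Longrightarrow> \<exists>V. zariski_open n V \<and> p \<in> V \<and> V \<subseteq> U \<and> s \<in> sections E V\<rbrakk>
      \<Longrightarrow> s \<in> sections E U"
    and bact_linear: "\<lbrakk>t \<in> torus n; p \<in> Pn n\<rbrakk> \<Longrightarrow> bact E t p \<in> linear_maps (fibre E p) (fibre E (tpoint t p))"
    and bact_one: "\<lbrakk>p \<in> Pn n; v \<in> carrier (fibre E p)\<rbrakk> \<Longrightarrow> bact E (\<lambda>i. 1) p v = v"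
    and bact_tmult: "\<lbrakk>t' \<in> torus n; t \<in> torus n; p \<in> Pn n; v \<in> carrier (fibre E p)\<rbrakk> \<Longrightarrow>
      bact E (tmult t' t) p v = bact E t' (tpoint t p) (bact E t p v)"

text \<open>A frame over a torus-stable open set, of sections that are semi-invariant of weights \<open>u k\<close>.\<close>

definition equivariant_frame ::
    "nat \<Rightarrow> nat \<Rightarrow> 'v tbundle \<Rightarrow> ppoint set \<Rightarrow> (nat \<Rightarrow> ppoint \<Rightarrow> 'v) \<Rightarrow> (nat \<Rightarrow> nat \<Rightarrow> int) \<Rightarrow> bool" where
  "equivariant_frame n r E U b u \<longleftrightarrow> frame n r E U b \<and>
     (\<forall>t\<in>torus n. \<forall>p\<in>U. tpoint t p \<in> U) \<and> (\<forall>k<r. semi_invariant n E U (u k) (b k))"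

lemma torus_character_nonzero: "t \<in> torus n \<Longrightarrow> torus_character n u t \<noteq> 0"
  using torus_nonzero by (simp add: torus_character_def)

lemma torus_character_diff:
  "t \<in> torus n \<Longrightarrow> torus_character n (\<lambda>k. u k - w k) t = torus_character n u t / torus_character n w t"
  using torus_nonzero[of t n] by (simp add: torus_character_def power_int_diff prod_dividef)

lemma torus_character_tinv: "torus_character n u (tinv t) = inverse (torus_character n u t)"
  by (simp add: torus_character_def tinv_def power_int_inverse flip: prod_inversef)

lemma torus_character_uminus: "torus_character n (\<lambda>k. - u k) t = inverse (torus_character n u t)"
  by (simp add: torus_character_def power_int_minus flip: prod_inversef)

lemma powi_eq_quotient: "(x :: complex) powi k = x ^ nat k / x ^ nat (- k)"
  by (cases "k \<ge> 0") (auto simp: power_int_def field_simps)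

lemma prod_powi: "(z :: complex) \<noteq> 0 \<Longrightarrow> (\<Prod>a\<in>A. z powi f a) = z powi (\<Sum>a\<in>A. f a)"
  by (induction A rule: infinite_finite_induct) (simp_all add: power_int_add)

lemma torus_character_regular:
  assumes W: "\<And>t p. (t, p) \<in> W \<Longrightarrow> t \<in> torus n"
  shows "(\<lambda>t p. c * torus_character n u t) \<in> regular_functions_torus n W"
proof -
  define P Q :: "(nat + nat) cpoly" where
    "P = Const c * (\<Prod>i=1..n. Var (Inl i) ^ nat (u i))" and "Q = (\<Prod>i=1..n. Var (Inl i) ^ nat (- u i))"
  have prod: "(\<Prod>i=1..n. Var (Inl i) ^ k i) \<in> homogeneous (Inl ` {1..n} \<union> Inr ` {..n}) (Inr ` {..n}) 0"
    for k :: "nat \<Rightarrow> nat"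
  proof -
    have "(\<Prod>i=1..n. Var (Inl i :: nat + nat) ^ k i)
        \<in> homogeneous (Inl ` {1..n} \<union> Inr ` {..n}) (Inr ` {..n}) (\<Sum>i=1..n. k i * 0)"
    proof (intro homogeneous_prod homogeneous_power)
      fix i assume "i \<in> {1..n}"
      then show "Var (Inl i) \<in> homogeneous (Inl ` {1..n} \<union> Inr ` {..n}) (Inr ` {..n}) 0"
        using homogeneous_Var[of "Inl i :: nat + nat" "Inl ` {1..n} \<union> Inr ` {..n}" "Inr ` {..n}"]
          by (auto split: if_splits)
    qed
    then show ?thesis
      by simp
  qed
  have PQ: "P \<in> homogeneous (Inl ` {1..n} \<union> Inr ` {..n}) (Inr ` {..n}) 0"
    "Q \<in> homogeneous (Inl ` {1..n} \<union> Inr ` {..n}) (Inr ` {..n}) 0"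
    using homogeneous_mult[OF homogeneous_Const prod] prod by (simp_all add: P_def Q_def)
  have Q: "cpoly_eval Q (case_sum t x) \<noteq> 0" if "t \<in> torus n" for t x
    using torus_nonzero[OF that] by (simp add: Q_def eval_simps)
  have eq: "c * torus_character n u t = cpoly_eval P (case_sum t x) / cpoly_eval Q (case_sum t x)" for t x
    by (simp add: P_def Q_def eval_simps torus_character_def powi_eq_quotient prod_dividef)
  show ?thesis
    unfolding regular_functions_torus_def Let_def
  proof (intro CollectI ballI, clarify)
    fix t p assume tp: "(t, p) \<in> W"
    show "\<exists>d. \<exists>P\<in>homogeneous (Inl ` {1..n} \<union> Inr ` {..n}) (Inr ` {..n}) d.
        \<exists>Q\<in>homogeneous (Inl ` {1..n} \<union> Inr ` {..n}) (Inr ` {..n}) d.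
         (\<forall>x\<in>p. cpoly_eval Q (case_sum t x) \<noteq> 0) \<and>
         (\<forall>(s, q)\<in>W. \<forall>x\<in>q. cpoly_eval Q (case_sum s x) \<noteq> 0 \<longrightarrow>
            c * torus_character n u s = cpoly_eval P (case_sum s x) / cpoly_eval Q (case_sum s x))"
      by (intro exI[of _ 0] bexI[of _ P] bexI[of _ Q] PQ conjI ballI)
        (simp_all add: Q[OF W[OF tp]] eq case_prod_beta)
  qed
qed

context equivariant_bundle
begin

lemma frame_based:
  assumes "frame n r E U b" "p \<in> U"
  shows "based_space (fibre E p) r (\<lambda>k. b k p)"
proof -
  have "p \<in> Pn n" "family_basis (fibre E p) r (\<lambda>k. b k p)"
    using assms zariski_open_subset unfolding frame_iff by blast+
  then show ?thesis
    using fibre_space by (simp add: based_space_def based_space_axioms_def)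
qed

lemma frame_sections:
  assumes "frame n r E U b" "zariski_open n V" "V \<subseteq> U"
  shows "s \<in> sections E V \<longleftrightarrow> (\<exists>f. (\<forall>k<r. f k \<in> regular_functions n V) \<and>
           (\<forall>p\<in>V. s p = (\<Oplus>\<^bsub>fibre E p\<^esub>k\<in>{..<r}. f k p \<odot>\<^bsub>fibre E p\<^esub> b k p)))"
  using assms unfolding frame_iff by blast

lemma frame_section:
  assumes "frame n r E U b" "zariski_open n V" "V \<subseteq> U" "l < r"
  shows "b l \<in> sections E V"
proof -
  have "b l p = (\<Oplus>\<^bsub>fibre E p\<^esub>k\<in>{..<r}. (if k = l then 1 else 0) \<odot>\<^bsub>fibre E p\<^esub> b k p)" if "p \<in> V" for p
  proof -
    interpret based_space "fibre E p" r "\<lambda>k. b k p"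
      using frame_based[OF assms(1)] that assms(3) by blast
    show ?thesis
      using basis_expand[OF assms(4)] by simp
  qed
  then show ?thesis
    unfolding frame_sections[OF assms(1-3)]
    by (intro exI[of _ "\<lambda>k p. if k = l then 1 else 0"]) (simp add: regular_const)
qed

lemma toric_vector_bundleI:
  assumes frames: "\<And>k. k \<le> n \<Longrightarrow> \<exists>b u. equivariant_frame n r E (coord_chart n k) b u"
  shows "toric_vector_bundle n r E"
proof -
  have local: "\<exists>U b u. p \<in> U \<and> equivariant_frame n r E U b u" if "p \<in> Pn n" for p
    using that frames by (metis coord_chart_cover)
  have "vector_bundle n r E"
    unfolding vector_bundle_def
  proof (intro conjI ballI allI impI)
    show "module complex_field (fibre E p)" if "p \<in> Pn n" for p
      using fibre_space[OF that] by (rule complex_space.is_module)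
    show "\<exists>U b. p \<in> U \<and> frame n r E U b" if "p \<in> Pn n" for p
      using local[OF that] unfolding equivariant_frame_def by blast
    show "s \<in> sections E U \<longleftrightarrow> (\<forall>p\<in>U. \<exists>V. zariski_open n V \<and> p \<in> V \<and> V \<subseteq> U \<and> s \<in> sections E V)"
      if "zariski_open n U" for U s
      using gluing[OF that, of s] that by blast
  qed
  moreover have "\<exists>U b V c A. p\<^sub>0 \<in> U \<and> frame n r E U b \<and> tpoint t\<^sub>0 p\<^sub>0 \<in> V \<and> frame n r E V c \<and>
        (\<forall>k<r. \<forall>l<r. A k l \<in>
           regular_functions_torus n {(t, p). t \<in> torus n \<and> p \<in> U \<and> tpoint t p \<in> V}) \<and>
        (\<forall>t\<in>torus n. \<forall>p\<in>U. tpoint t p \<in> V \<longrightarrow> (\<forall>k<r. bact E t p (b k p) =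
           (\<Oplus>\<^bsub>fibre E (tpoint t p)\<^esub>l\<in>{..<r}.
              A k l t p \<odot>\<^bsub>fibre E (tpoint t p)\<^esub> c l (tpoint t p))))"
    if t0: "t\<^sub>0 \<in> torus n" and p0: "p\<^sub>0 \<in> Pn n" for t\<^sub>0 p\<^sub>0
  proof -
    obtain U b u where U: "p\<^sub>0 \<in> U" "equivariant_frame n r E U b u"
      using local[OF p0] by blast
    then have fr: "frame n r E U b" and inv: "\<And>t p. t \<in> torus n \<Longrightarrow> p \<in> U \<Longrightarrow> tpoint t p \<in> U"
      and semi: "\<And>k. k < r \<Longrightarrow> semi_invariant n E U (u k) (b k)"
      by (auto simp: equivariant_frame_def)
    define A where "A k l t p = (if l = k then 1 else 0) * torus_character n (u k) t"
      for k l t and p :: ppoint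
    have "A k l \<in> regular_functions_torus n {(t, p). t \<in> torus n \<and> p \<in> U \<and> tpoint t p \<in> U}" for k l
      unfolding A_def by (rule torus_character_regular) auto
    moreover have "bact E t p (b k p) =
           (\<Oplus>\<^bsub>fibre E (tpoint t p)\<^esub>l\<in>{..<r}.
              A k l t p \<odot>\<^bsub>fibre E (tpoint t p)\<^esub> b l (tpoint t p))"
      if "t \<in> torus n" "p \<in> U" "k < r" for t p k
    proof -
      interpret based_space "fibre E (tpoint t p)" r "\<lambda>k. b k (tpoint t p)"
        using frame_based[OF fr inv] that by blast
      have "A k l t p = (if l = k then torus_character n (u k) t else 0)" for l
        by (simp add: A_def)
      then show ?thesis
        using that semi[OF that(3)]
          finsum_unit_coeff[of "{..<r}" "\<lambda>k. b k (tpoint t p)" k, where a = "torus_character n (u k) t"]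
        by (simp add: semi_invariant_def)
    qed
    ultimately show ?thesis
      by (intro exI[of _ U] exI[of _ b] exI[of _ A]) (simp add: U(1) fr inv[OF t0 U(1)])
  qed
  ultimately show ?thesis
    unfolding toric_vector_bundle_def using bact_linear bact_one bact_tmult by blast
qed

end

section \<open>Laurent monomials and one-parameter subgroups\<close>

lemma pairing_ray_generator:
  "pairing n u (ray_generator n i) = (if i = 0 then - (\<Sum>k=1..n. u k) else if i \<le> n then u i else 0)"
proof -
  have "(\<Sum>k=1..n. u k * (if k = i then 1 else 0)) = (\<Sum>k=1..n. if k = i then u k else 0)"
    by (rule sum.cong) auto
  then show ?thesis
    by (simp add: pairing_def ray_generator_def sum_negf)
qed

text \<open>The ray generators add up to zero, so that the Laurent monomials below have degree zero.\<close>

lemma sum_pairing_ray: "(\<Sum>j\<le>n. pairing n u (ray_generator n j)) = 0"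
proof -
  have "{..n} = insert 0 {1..n}"
    by auto
  then show ?thesis
    by (simp add: pairing_ray_generator)
qed

text \<open>
  The character of \<open>m\<close> as a rational function on projective space. Its exponent at \<open>x\<^sub>j\<close> is
  \<open>\<langle>m, e\<^sub>j\<rangle>\<close>, and it is evaluated at an arbitrary coordinate vector. It takes the value \<open>0\<close>
  where some \<open>x\<^sub>j\<close> with a negative exponent vanishes.
\<close>

definition laurent_monomial :: "nat \<Rightarrow> (nat \<Rightarrow> int) \<Rightarrow> ppoint \<Rightarrow> complex" where
  "laurent_monomial n m p = (let x = SOME x. x \<in> p in \<Prod>j\<le>n. x j powi pairing n m (ray_generator n j))"

lemma laurent_monomial_eq:
  assumes p: "p \<in> Pn n" and x: "x \<in> p"
  shows "laurent_monomial n m p = (\<Prod>j\<le>n. x j powi pairing n m (ray_generator n j))"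
proof -
  define y where "y = (SOME x. x \<in> p)"
  have "y \<in> p"
    unfolding y_def using x by (rule someI[of "\<lambda>x. x \<in> p"])
  then obtain c where c: "c \<noteq> 0" "y = (\<lambda>i. c * x i)"
    using Pn_ratio[OF p x] by metis
  have "(\<Prod>j\<le>n. c powi pairing n m (ray_generator n j)) = c powi (\<Sum>j\<le>n. pairing n m (ray_generator n j))"
    using c(1) by (simp add: prod_powi)
  then show ?thesis
    unfolding laurent_monomial_def Let_def y_def[symmetric] c(2)
    by (simp add: power_int_mult_distrib prod.distrib sum_pairing_ray)
qed

lemma laurent_monomial_tpoint:
  assumes t: "t \<in> torus n" and p: "p \<in> Pn n"
  shows "laurent_monomial n m (tpoint t p) = torus_character n m t * laurent_monomial n m p"
proof -
  obtain x where x: "x \<in> p"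
    using p by (rule Pn_obtain)
  then have "tmult t x \<in> tpoint t p"
    by (simp add: tpoint_def)
  then have "laurent_monomial n m (tpoint t p)
      = (\<Prod>j\<le>n. t j powi pairing n m (ray_generator n j)) * laurent_monomial n m p"
    using laurent_monomial_eq[OF tpoint_in_Pn[OF t p]] laurent_monomial_eq[OF p x]
    by (simp add: tmult_def power_int_mult_distrib prod.distrib)
  also have "(\<Prod>j\<le>n. t j powi pairing n m (ray_generator n j)) = torus_character n m t"
  proof -
    have "{..n} = insert 0 {1..n}" "t 0 = 1"
      using t by (auto simp: torus_def)
    then show ?thesis
      by (simp add: pairing_ray_generator torus_character_def)
  qed
  finally show ?thesis .
qed

lemma laurent_monomial_identity: "laurent_monomial n m (identity_point n) = 1"
proof -
  have "(\<lambda>i. if i \<le> n then 1 else 0) \<in> identity_point n"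
    unfolding identity_point_def by (rule hpoint_self)
  from laurent_monomial_eq[OF identity_in_Pn this] show ?thesis
    by simp
qed

lemma laurent_monomial_regular:
  assumes i: "0 \<le> pairing n m (ray_generator n i)"
  shows "laurent_monomial n m \<in> regular_functions n (ray_chart n i)"
  unfolding regular_iff
proof
  let ?M = "\<lambda>j. pairing n m (ray_generator n j)"
  define P Q :: "nat cpoly" where "P = (\<Prod>j\<le>n. Var j ^ nat (?M j))" and "Q = (\<Prod>j\<le>n. Var j ^ nat (- ?M j))"
  have "int (\<Sum>j\<le>n. nat (?M j)) - int (\<Sum>j\<le>n. nat (- ?M j)) = (\<Sum>j\<le>n. ?M j)"
    unfolding of_nat_sum sum_subtractf[symmetric] by (intro sum.cong) auto
  then have deg: "(\<Sum>j\<le>n. nat (- ?M j)) = (\<Sum>j\<le>n. nat (?M j))"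
    unfolding sum_pairing_ray by (metis eq_iff_diff_eq_0 of_nat_eq_iff)
  have P: "P \<in> homogeneous {..n} {..n} (\<Sum>j\<le>n. nat (?M j))"
    unfolding P_def by (intro homogeneous_prod homogeneous_Var_power) auto
  have "Q \<in> homogeneous {..n} {..n} (\<Sum>j\<le>n. nat (- ?M j))"
    unfolding Q_def by (intro homogeneous_prod homogeneous_Var_power) auto
  then have Q: "Q \<in> homogeneous {..n} {..n} (\<Sum>j\<le>n. nat (?M j))"
    unfolding deg .
  fix p assume p: "p \<in> ray_chart n i"
  have "fraction_at (ray_chart n i) p (laurent_monomial n m) P Q"
    unfolding fraction_at_def
  proof (intro conjI ballI impI)
    fix x assume "x \<in> p"
    then have x: "x j \<noteq> 0" if "j \<le> n" "j \<noteq> i" for j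
      using p that by (simp add: ray_chart_def)
    have "x j ^ nat (- ?M j) \<noteq> 0" if "j \<le> n" for j
      using x[OF that] i by (cases "j = i") auto
    then show "cpoly_eval Q x \<noteq> 0"
      by (simp add: Q_def eval_simps)
  next
    fix q x assume "q \<in> ray_chart n i" "x \<in> q"
    then show "laurent_monomial n m q = cpoly_eval P x / cpoly_eval Q x"
      using ray_chart_in_Pn laurent_monomial_eq[of q n x m]
      by (auto simp: P_def Q_def eval_simps powi_eq_quotient prod_dividef)
  qed
  then show "\<exists>d. \<exists>P\<in>homogeneous {..n} {..n} d. \<exists>Q\<in>homogeneous {..n} {..n} d.
      fraction_at (ray_chart n i) p (laurent_monomial n m) P Q"
    using P Q by blast
qed

text \<open>The one-parameter subgroup of a ray, and the curve that it traces in the chart of the ray.\<close>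

definition one_parameter :: "nat \<Rightarrow> nat \<Rightarrow> complex \<Rightarrow> cvec" where
  "one_parameter n i z = (\<lambda>k. if k \<in> {1..n} then z powi ray_generator n i k else 1)"

definition ray_curve :: "nat \<Rightarrow> nat \<Rightarrow> complex \<Rightarrow> cvec" where
  "ray_curve n i z = (\<lambda>k. if k = i then z else if k \<le> n then 1 else 0)"

lemma one_parameter_torus: "z \<noteq> 0 \<Longrightarrow> one_parameter n i z \<in> torus n"
  by (auto simp: one_parameter_def torus_def)

lemma torus_character_one_parameter:
  assumes "z \<noteq> 0"
  shows "torus_character n u (one_parameter n i z) = z powi pairing n u (ray_generator n i)"
proof -
  have "torus_character n u (one_parameter n i z) = (\<Prod>k=1..n. z powi (u k * ray_generator n i k))"
    unfolding torus_character_def one_parameter_def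
    by (intro prod.cong) (simp_all add: mult.commute flip: power_int_mult)
  also have "\<dots> = z powi (\<Sum>k=1..n. u k * ray_generator n i k)"
    using assms by (simp add: prod_powi)
  finally show ?thesis
    by (simp add: pairing_def)
qed

lemma tpoint_one_parameter:
  assumes z: "z \<noteq> 0" and i: "i \<le> n"
  shows "tpoint (one_parameter n i z) (identity_point n) = hpoint (ray_curve n i z)"
proof -
  let ?o = "\<lambda>k. if k \<le> n then 1 else 0 :: complex"
  have "tpoint (one_parameter n i z) (identity_point n) = hpoint (tmult (one_parameter n i z) ?o)"
    by (simp add: identity_point_def tpoint_hpoint)
  also have "\<dots> = hpoint (ray_curve n i z)"
  proof (cases "i = 0")
    case True
    \<comment> \<open>The subgroup of \<open>e\<^sub>0\<close> traces the points \<open>(1, 1/z, \<dots>, 1/z)\<close>, which are multiples of \<open>(z, 1, \<dots>, 1)\<close>.\<close>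
    then have "ray_curve n i z = (\<lambda>k. z * tmult (one_parameter n i z) ?o k)"
      using z by (auto simp: ray_curve_def tmult_def one_parameter_def ray_generator_def
          fun_eq_iff power_int_minus)
    then show ?thesis
      using hpoint_scale[OF z] by simp
  next
    case False
    then have "tmult (one_parameter n i z) ?o = ray_curve n i z"
      using i by (auto simp: ray_curve_def tmult_def one_parameter_def ray_generator_def fun_eq_iff)
    then show ?thesis
      by simp
  qed
  finally show ?thesis .
qed

lemma ray_curve_chart:
  assumes n: "0 < n" and i: "i \<le> n"
  shows "hpoint (ray_curve n i z) \<in> ray_chart n i"
proof -
  obtain k where k: "k \<le> n" "k \<noteq> i"
    using n i that[of 0] that[of n] by (cases "i = 0") auto
  have "hpoint (ray_curve n i z) \<in> Pn n"
    unfolding Pn_def using i k by (intro CollectI exI[of _ "ray_curve n i z"]) (auto simp: ray_curve_def)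
  then show ?thesis
    by (auto simp: ray_chart_def hpoint_def ray_curve_def)
qed

text \<open>
  A regular function on the chart of a ray has no pole along the divisor of the ray, so it
  does not restrict to a negative power of the parameter on the curve.
\<close>

lemma regular_no_pole:
  assumes n: "0 < n" and i: "i \<le> n" and f: "f \<in> regular_functions n (ray_chart n i)"
    and pole: "\<And>z. z \<noteq> 0 \<Longrightarrow> f (hpoint (ray_curve n i z)) = c * z powi m" and m: "m < 0"
  shows "c = 0"
proof -
  let ?x = "ray_curve n i"
  obtain d P Q where PQ: "P \<in> homogeneous {..n} {..n} d" "Q \<in> homogeneous {..n} {..n} d"
    "fraction_at (ray_chart n i) (hpoint (?x 0)) f P Q"
    using f ray_curve_chart[OF n i, of 0] unfolding regular_iff by blast
  have "((\<lambda>z. ?x z j) \<longlongrightarrow> ?x 0 j) (at 0)" for j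
    by (auto simp: ray_curve_def intro!: tendsto_intros)
  then have lim: "((\<lambda>z. cpoly_eval R (?x z)) \<longlongrightarrow> cpoly_eval R (?x 0)) (at 0)" for R
    by (rule tendsto_cpoly_eval)
  have Q0: "cpoly_eval Q (?x 0) \<noteq> 0"
    using fraction_atD(1)[OF PQ(3)] hpoint_self by blast
  \<comment> \<open>After multiplication by the positive power \<open>z ^ (- m)\<close> the function is constantly \<open>c\<close> and tends to \<open>0\<close>.\<close>
  have "((\<lambda>z. cpoly_eval P (?x z) / cpoly_eval Q (?x z) * z ^ nat (- m)) \<longlongrightarrow>
      cpoly_eval P (?x 0) / cpoly_eval Q (?x 0) * 0 ^ nat (- m)) (at 0)"
    using Q0 lim by (intro tendsto_intros) auto
  moreover have "\<forall>\<^sub>F z in at 0. cpoly_eval Q (?x z) \<noteq> 0"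
    using lim[of Q] Q0 by (rule tendsto_imp_eventually_ne)
  then have "\<forall>\<^sub>F z in at 0. cpoly_eval P (?x z) / cpoly_eval Q (?x z) * z ^ nat (- m) = c"
    using eventually_neq_at_within[of 0]
  proof eventually_elim
    case (elim z)
    have "cpoly_eval P (?x z) / cpoly_eval Q (?x z) = c * z powi m"
      using fraction_atD(2)[OF PQ(3) ray_curve_chart[OF n i] hpoint_self elim(1)] pole[OF elim(2)] by simp
    also have "\<dots> = c / z ^ nat (- m)"
      using m by (simp add: powi_eq_quotient)
    finally show ?case
      using elim(2) by simp
  qed
  ultimately have "((\<lambda>z :: complex. c) \<longlongrightarrow> cpoly_eval P (?x 0) / cpoly_eval Q (?x 0) * 0 ^ nat (- m)) (at 0)"
    by (rule Lim_transform_eventually)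
  then show ?thesis
    using m by (simp add: tendsto_const_iff zero_power)
qed

section \<open>Klyachko filtrations from equivariant frames\<close>

context equivariant_bundle
begin

lemma bact_frame_sum:
  assumes fr: "equivariant_frame n r E U b u" and t: "t \<in> torus n" and p: "p \<in> U"
  shows "bact E t p (\<Oplus>\<^bsub>fibre E p\<^esub>k\<in>{..<r}. c k \<odot>\<^bsub>fibre E p\<^esub> b k p)
    = (\<Oplus>\<^bsub>fibre E (tpoint t p)\<^esub>k\<in>{..<r}.
        (c k * torus_character n (u k) t) \<odot>\<^bsub>fibre E (tpoint t p)\<^esub> b k (tpoint t p))"
proof -
  have f: "frame n r E U b" and tp: "tpoint t p \<in> U" and semi: "\<And>k. k < r \<Longrightarrow> semi_invariant n E U (u k) (b k)"
    using fr t p by (auto simp: equivariant_frame_def)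
  have pn: "p \<in> Pn n"
    using f p zariski_open_subset unfolding frame_iff by blast
  interpret M: based_space "fibre E p" r "\<lambda>k. b k p"
    using frame_based[OF f p] .
  interpret N: based_space "fibre E (tpoint t p)" r "\<lambda>k. b k (tpoint t p)"
    using frame_based[OF f tp] .
  have "bact E t p (\<Oplus>\<^bsub>fibre E p\<^esub>k\<in>{..<r}. c k \<odot>\<^bsub>fibre E p\<^esub> b k p)
      = (\<Oplus>\<^bsub>fibre E (tpoint t p)\<^esub>k\<in>{..<r}. c k \<odot>\<^bsub>fibre E (tpoint t p)\<^esub> bact E t p (b k p))"
    by (rule linear_map_finsum[OF M.complex_space_axioms N.complex_space_axioms bact_linear[OF t pn]]) auto
  also have "\<dots> = (\<Oplus>\<^bsub>fibre E (tpoint t p)\<^esub>k\<in>{..<r}.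
        (c k * torus_character n (u k) t) \<odot>\<^bsub>fibre E (tpoint t p)\<^esub> b k (tpoint t p))"
    using semi t p by (intro N.finsum_cong') (auto simp: semi_invariant_def N.smult_smult)
  finally show ?thesis .
qed

text \<open>
  The coordinates of a semi-invariant section with respect to the frame are multiples of Laurent
  monomials. So a coordinate of its value at the identity vanishes if the monomial has a pole along
  the divisor of the ray, and can be prescribed otherwise.
\<close>

lemma klyachko_filtration_coords:
  assumes n: "0 < n" and i: "i \<le> n" and fr: "equivariant_frame n r E U b u"
    and U: "ray_chart n i \<subseteq> U"
  shows "klyachko_filtration n E i \<rho> = {v \<in> carrier (identity_fibre n E).
    \<forall>k<r. pairing n (u k) (ray_generator n i) < \<rho> \<longrightarrow>
      coords (identity_fibre n E) r (\<lambda>k. b k (identity_point n)) v k = 0}" (is "_ = ?R")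
proof (intro equalityI subsetI)
  let ?e = "identity_point n"
  have f: "frame n r E U b"
    using fr by (simp add: equivariant_frame_def)
  have inv: "tpoint t p \<in> ray_chart n i" if "t \<in> torus n" "p \<in> ray_chart n i" for t p
    using tpoint_ray_chart that .
  have eU: "?e \<in> ray_chart n i"
    by (rule identity_in_ray_chart)
  interpret M: based_space "fibre E ?e" r "\<lambda>k. b k ?e"
    using frame_based[OF f] eU U by blast
  {
    fix v assume "v \<in> klyachko_filtration n E i \<rho>"
    then obtain s w where s: "v = s ?e" "s \<in> sections E (ray_chart n i)"
      "pairing n w (ray_generator n i) = \<rho>" "semi_invariant n E (ray_chart n i) w s"
      by (auto simp: klyachko_filtration_def)
    obtain g where g: "\<And>k. k < r \<Longrightarrow> g k \<in> regular_functions n (ray_chart n i)"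
      "\<And>p. p \<in> ray_chart n i \<Longrightarrow> s p = (\<Oplus>\<^bsub>fibre E p\<^esub>k\<in>{..<r}. g k p \<odot>\<^bsub>fibre E p\<^esub> b k p)"
      using s(2) unfolding frame_sections[OF f open_ray_chart U] by blast
    have "g k ?e = 0" if k: "k < r" and less: "pairing n (u k) (ray_generator n i) < \<rho>" for k
    proof (rule regular_no_pole[OF n i g(1)[OF k]])
      show "pairing n (u k) (ray_generator n i) - \<rho> < 0"
        using less by simp
      fix z :: complex assume z: "z \<noteq> 0"
      define t where "t = one_parameter n i z"
      have t: "t \<in> torus n"
        unfolding t_def using z by (rule one_parameter_torus)
      have tz: "tpoint t ?e = hpoint (ray_curve n i z)"
        unfolding t_def using z i by (rule tpoint_one_parameter)
      have tU: "tpoint t ?e \<in> ray_chart n i"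
        using inv[OF t eU] .
      interpret N: based_space "fibre E (tpoint t ?e)" r "\<lambda>k. b k (tpoint t ?e)"
        using frame_based[OF f] tU U by blast
      let ?F = "fibre E (tpoint t ?e)"
      have "(\<Oplus>\<^bsub>?F\<^esub>k\<in>{..<r}. (g k ?e * torus_character n (u k) t) \<odot>\<^bsub>?F\<^esub> b k (tpoint t ?e))
          = bact E t ?e (s ?e)"
        using bact_frame_sum[OF fr t, of ?e "\<lambda>k. g k ?e"] g(2)[OF eU] eU U by auto
      also have "\<dots> = torus_character n w t \<odot>\<^bsub>?F\<^esub> s (tpoint t ?e)"
        using s(4) t eU by (simp add: semi_invariant_def)
      also have "\<dots> = (\<Oplus>\<^bsub>?F\<^esub>k\<in>{..<r}.
          (torus_character n w t * g k (tpoint t ?e)) \<odot>\<^bsub>?F\<^esub> b k (tpoint t ?e))"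
        unfolding g(2)[OF tU] by (rule N.finsum_smult_coeff[symmetric]) auto
      finally have "g k ?e * torus_character n (u k) t = torus_character n w t * g k (tpoint t ?e)"
        by (rule N.coords_unique[OF k])
      then show "g k (hpoint (ray_curve n i z))
          = g k ?e * z powi (pairing n (u k) (ray_generator n i) - \<rho>)"
        using z s(3) unfolding tz[symmetric]
        by (simp add: t_def torus_character_one_parameter power_int_diff field_simps)
    qed
    then show "v \<in> ?R"
      unfolding s(1) g(2)[OF eU] identity_fibre_def
      by (auto simp: M.coords_finsum)
  }
  fix v assume v: "v \<in> ?R"
  let ?c = "coords (fibre E ?e) r (\<lambda>k. b k ?e) v"
  \<comment> \<open>A character with \<open>\<langle>w, e\<^sub>i\<rangle> = \<rho>\<close>.\<close>
  define w where "w = (\<lambda>j. if i = 0 then (if j = 1 then - \<rho> else 0) else (if j = i then \<rho> else 0))"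
  have w: "pairing n w (ray_generator n i) = \<rho>"
    using n i by (auto simp: pairing_ray_generator w_def sum.delta)
  define g where "g k p = ?c k * laurent_monomial n (\<lambda>j. u k j - w j) p" for k p
  have pd: "pairing n (\<lambda>j. u k j - w j) (ray_generator n i) = pairing n (u k) (ray_generator n i) - \<rho>" for k
    unfolding w[symmetric] by (simp add: pairing_def left_diff_distrib sum_subtractf)
  have g: "g k \<in> regular_functions n (ray_chart n i)" if k: "k < r" for k
  proof (cases "pairing n (u k) (ray_generator n i) < \<rho>")
    case True
    then have "g k = (\<lambda>p. 0)"
      using v k by (simp add: g_def identity_fibre_def fun_eq_iff)
    then show ?thesis
      using regular_const by simp
  next
    case False
    then show ?thesis
      unfolding g_def by (intro regular_mult regular_const laurent_monomial_regular) (simp add: pd)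
  qed
  define s where "s p = (\<Oplus>\<^bsub>fibre E p\<^esub>k\<in>{..<r}. g k p \<odot>\<^bsub>fibre E p\<^esub> b k p)" for p
  have "s \<in> sections E (ray_chart n i)"
    unfolding frame_sections[OF f open_ray_chart U] s_def using g by blast
  moreover have "s ?e = v"
    using M.coords_sum[of v] v
    by (simp add: s_def g_def laurent_monomial_identity identity_fibre_def)
  moreover have "semi_invariant n E (ray_chart n i) w s"
    unfolding semi_invariant_def
  proof (intro ballI)
    fix t p assume t: "t \<in> torus n" and p: "p \<in> ray_chart n i"
    have pn: "p \<in> Pn n"
      using p ray_chart_in_Pn by blast
    let ?F = "fibre E (tpoint t p)"
    interpret N: based_space ?F r "\<lambda>k. b k (tpoint t p)"
      using frame_based[OF f] inv[OF t p] U by blast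
    have "g k p * torus_character n (u k) t = torus_character n w t * g k (tpoint t p)" for k
      using torus_character_nonzero[OF t]
      by (simp add: g_def laurent_monomial_tpoint[OF t pn] torus_character_diff[OF t])
    then have "bact E t p (s p) = (\<Oplus>\<^bsub>?F\<^esub>k\<in>{..<r}.
          (torus_character n w t * g k (tpoint t p)) \<odot>\<^bsub>?F\<^esub> b k (tpoint t p))"
      unfolding s_def using bact_frame_sum[OF fr t, of p "\<lambda>k. g k p"] p U by auto
    also have "\<dots> = torus_character n w t \<odot>\<^bsub>?F\<^esub> s (tpoint t p)"
      unfolding s_def by (rule N.finsum_smult_coeff) auto
    finally show "bact E t p (s p) = torus_character n w t \<odot>\<^bsub>?F\<^esub> s (tpoint t p)" .
  qed
  ultimately show "v \<in> klyachko_filtration n E i \<rho>"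
    using w unfolding klyachko_filtration_def by blast
qed

lemma adapted_basis_frame:
  assumes n: "0 < n" and k: "k \<le> n" and fr: "equivariant_frame n r E (coord_chart n k) b u"
  shows "adapted_basis n E k ((\<lambda>l. b l (identity_point n)) ` {..<r})"
proof -
  let ?e = "identity_point n"
  have e: "?e \<in> coord_chart n k"
    using k by (rule identity_in_coord_chart)
  interpret M: based_space "fibre E ?e" r "\<lambda>k. b k ?e"
    using frame_based[OF _ e] fr by (simp add: equivariant_frame_def)
  have "\<exists>S\<subseteq>(\<lambda>l. b l ?e) ` {..<r}. klyachko_filtration n E i \<rho> = lin_span (fibre E ?e) S"
    if i: "i \<le> n" "i \<noteq> k" for i \<rho>
  proof -
    let ?S = "{l. l < r \<and> \<rho> \<le> pairing n (u l) (ray_generator n i)}"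
    have "klyachko_filtration n E i \<rho> = lin_span (fibre E ?e) ((\<lambda>l. b l ?e) ` ?S)"
      unfolding klyachko_filtration_coords[OF n i(1) fr ray_chart_subset[OF k i(2)[symmetric]]]
      by (subst M.lin_span_basis) (auto simp: identity_fibre_def not_le)
    then show ?thesis
      by (intro exI[of _ "(\<lambda>l. b l ?e) ` ?S"]) auto
  qed
  then show ?thesis
    using M.is_basis_image by (simp add: adapted_basis_def identity_fibre_def)
qed

lemma klyachko_filtration_frame_member:
  assumes n: "0 < n" and k: "k \<le> n" and i: "i \<le> n" "i \<noteq> k"
    and fr: "equivariant_frame n r E (coord_chart n k) b u" and l: "l < r"
  shows "b l (identity_point n) \<in> klyachko_filtration n E i \<rho> \<longleftrightarrow>
    \<rho> \<le> pairing n (u l) (ray_generator n i)"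
proof -
  let ?e = "identity_point n"
  have e: "?e \<in> coord_chart n k"
    using k by (rule identity_in_coord_chart)
  interpret M: based_space "fibre E ?e" r "\<lambda>k. b k ?e"
    using frame_based[OF _ e] fr by (simp add: equivariant_frame_def)
  show ?thesis
    unfolding klyachko_filtration_coords[OF n i(1) fr ray_chart_subset[OF k i(2)[symmetric]]]
    using l M.coords_basis[OF _ l] by (auto simp: identity_fibre_def not_less)
qed

end

section \<open>Dual bundles\<close>

lemma dual_bundle_simps [simp]:
  "fibre (dual_bundle n E) p = dual_space (fibre E p)"
  "bact (dual_bundle n E) t p f = (\<lambda>v\<in>carrier (fibre E (tpoint t p)). f (bact E (tinv t) (tpoint t p) v))"
  by (simp_all add: dual_bundle_def)

lemma sections_dual_bundle: "s \<in> sections (dual_bundle n E) U \<longleftrightarrow>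
    (\<forall>p\<in>U. s p \<in> carrier (dual_space (fibre E p))) \<and>
    (\<forall>V \<sigma>. zariski_open n V \<and> V \<subseteq> U \<and> \<sigma> \<in> sections E V \<longrightarrow>
       (\<lambda>p. s p (\<sigma> p)) \<in> regular_functions n V)"
  by (simp add: dual_bundle_def del: dual_space_simps)

context equivariant_bundle
begin

lemma bact_tinv_linear:
  assumes t: "t \<in> torus n" and p: "p \<in> Pn n"
  shows "bact E (tinv t) (tpoint t p) \<in> linear_maps (fibre E (tpoint t p)) (fibre E p)"
  using bact_linear[OF torus_closed(3)[OF t] tpoint_in_Pn[OF t p]] by (simp add: tpoint_tinv[OF t])

lemma bact_tinv_in:
  "\<lbrakk>t \<in> torus n; p \<in> Pn n; v \<in> carrier (fibre E (tpoint t p))\<rbrakk> \<Longrightarrow>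
    bact E (tinv t) (tpoint t p) v \<in> carrier (fibre E p)"
  by (rule linear_mapsD(1)[OF bact_tinv_linear])

lemma equivariant_dual: "equivariant_bundle n (dual_bundle n E)"
proof (rule equivariant_bundle.intro)
  fix p assume "p \<in> Pn n"
  then show "complex_space (fibre (dual_bundle n E) p)"
    by (simp add: complex_space_dual fibre_space)
next
  fix U V s assume "zariski_open n U" "zariski_open n V" "V \<subseteq> U" "s \<in> sections (dual_bundle n E) U"
  then show "s \<in> sections (dual_bundle n E) V"
    unfolding sections_dual_bundle by blast
next
  fix U s assume U: "zariski_open n U"
    and loc: "\<And>p. p \<in> U \<Longrightarrow> \<exists>V. zariski_open n V \<and> p \<in> V \<and> V \<subseteq> U \<and> s \<in> sections (dual_bundle n E) V"
  have "(\<lambda>p. s p (\<sigma> p)) \<in> regular_functions n V"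
    if V: "zariski_open n V" "V \<subseteq> U" "\<sigma> \<in> sections E V" for V \<sigma>
  proof (rule regular_local)
    show "V \<subseteq> Pn n"
      using V(1) by (rule zariski_open_subset)
    fix p assume p: "p \<in> V"
    then obtain W where W: "zariski_open n W" "p \<in> W" "s \<in> sections (dual_bundle n E) W"
      using loc V(2) by blast
    have WV: "zariski_open n (W \<inter> V)"
      using W(1) V(1) by (rule zariski_open_Int)
    then have "\<sigma> \<in> sections E (W \<inter> V)"
      using restriction[OF V(1) WV _ V(3)] by simp
    then have "(\<lambda>p. s p (\<sigma> p)) \<in> regular_functions n (W \<inter> V)"
      using W(3) WV unfolding sections_dual_bundle by simp
    then show "\<exists>W. zariski_open n W \<and> p \<in> W \<and> (\<lambda>p. s p (\<sigma> p)) \<in> regular_functions n (W \<inter> V)"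
      using W by blast
  qed
  moreover have "s p \<in> carrier (dual_space (fibre E p))" if "p \<in> U" for p
    using loc[OF that] unfolding sections_dual_bundle by blast
  ultimately show "s \<in> sections (dual_bundle n E) U"
    unfolding sections_dual_bundle by blast
next
  fix t p assume t: "t \<in> torus n" and p: "p \<in> Pn n"
  note g = bact_tinv_in[OF t p] linear_mapsD(2,3)[OF bact_tinv_linear[OF t p]]
  interpret M: complex_space "fibre E (tpoint t p)"
    by (rule fibre_space[OF tpoint_in_Pn[OF t p]])
  show "bact (dual_bundle n E) t p
      \<in> linear_maps (fibre (dual_bundle n E) p) (fibre (dual_bundle n E) (tpoint t p))"
  proof (rule linear_mapsI)
    show "bact (dual_bundle n E) t p f \<in> carrier (fibre (dual_bundle n E) (tpoint t p))"
      if f: "f \<in> carrier (fibre (dual_bundle n E) p)" for f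
    proof -
      have "f \<in> linear_maps (fibre E p) complex_line"
        using f by simp
      note fD = linear_mapsD[OF this]
      show ?thesis
        using fD(2,3) g by (auto intro!: linear_mapsI)
    qed
  qed (use g in \<open>auto simp: fun_eq_iff\<close>)
next
  fix p v assume p: "p \<in> Pn n" and v: "v \<in> carrier (fibre (dual_bundle n E) p)"
  have "tinv (\<lambda>i. 1) = (\<lambda>i. 1)"
    by (simp add: tinv_def)
  then show "bact (dual_bundle n E) (\<lambda>i. 1) p v = v"
    using v bact_one[OF p] by (intro extensionalityI[of _ "carrier (fibre E p)"]) (auto simp: tpoint_one)
next
  fix s t p v assume s: "s \<in> torus n" and t: "t \<in> torus n" and p: "p \<in> Pn n"
    and v: "v \<in> carrier (fibre (dual_bundle n E) p)"
  have tp: "tpoint t p \<in> Pn n"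
    using t p by (rule tpoint_in_Pn)
  have "tinv (tmult s t) = tmult (tinv t) (tinv s)"
    by (simp add: tinv_def tmult_def fun_eq_iff)
  then have "bact E (tinv (tmult s t)) (tpoint s (tpoint t p)) w
      = bact E (tinv t) (tpoint t p) (bact E (tinv s) (tpoint s (tpoint t p)) w)"
    if "w \<in> carrier (fibre E (tpoint s (tpoint t p)))" for w
    using bact_tmult[OF torus_closed(3)[OF t] torus_closed(3)[OF s] tpoint_in_Pn[OF s tp] that]
    by (simp add: tpoint_tinv[OF s])
  then show "bact (dual_bundle n E) (tmult s t) p v
      = bact (dual_bundle n E) s (tpoint t p) (bact (dual_bundle n E) t p v)"
    using bact_tinv_in[OF s tp] by (auto simp: tpoint_tmult fun_eq_iff)
qed

text \<open>The coordinate functionals of a frame.\<close>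

definition dual_frame :: "nat \<Rightarrow> (nat \<Rightarrow> ppoint \<Rightarrow> 'v) \<Rightarrow> nat \<Rightarrow> ppoint \<Rightarrow> 'v \<Rightarrow> complex" where
  "dual_frame r b k p = (\<lambda>v\<in>carrier (fibre E p). coords (fibre E p) r (\<lambda>k. b k p) v k)"

lemma equivariant_dual_frame:
  assumes fr: "equivariant_frame n r E U b u"
  shows "equivariant_frame n r (dual_bundle n E) U (dual_frame r b) (\<lambda>k j. - u k j)"
proof -
  have f: "frame n r E U b" and inv: "\<And>t p. t \<in> torus n \<Longrightarrow> p \<in> U \<Longrightarrow> tpoint t p \<in> U"
    using fr by (auto simp: equivariant_frame_def)
  have U: "zariski_open n U"
    using f by (simp add: frame_iff)
  note UPn = zariski_open_subset[OF U]
  have based: "based_space (fibre E p) r (\<lambda>k. b k p)" if "p \<in> U" for p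
    using frame_based[OF f that] .
  have df: "dual_frame r b k p = based_space.dual_basis (fibre E p) r (\<lambda>k. b k p) k" if "p \<in> U" for k p
    unfolding dual_frame_def based_space.dual_basis_def[OF based[OF that]] ..
  have in_dual: "dual_frame r b k p \<in> carrier (dual_space (fibre E p))" if "p \<in> U" "k < r" for k p
    unfolding df[OF that(1)] by (rule based_space.dual_basis_in[OF based[OF that(1)] that(2)])
  have dsum: "(\<Oplus>\<^bsub>dual_space (fibre E p)\<^esub>k\<in>{..<r}. c k \<odot>\<^bsub>dual_space (fibre E p)\<^esub> dual_frame r b k p) v
      = (\<Sum>k<r. c k * coords (fibre E p) r (\<lambda>k. b k p) v k)" if p: "p \<in> U" and v: "v \<in> carrier (fibre E p)" for p c v
    using based_space.dual_finsum[OF based[OF p] v, of r "\<lambda>k. dual_frame r b k p" c] in_dual[OF p] v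
    by (simp add: dual_frame_def del: dual_space_simps)
  have sections: "s \<in> sections (dual_bundle n E) V \<longleftrightarrow> (\<exists>g. (\<forall>k<r. g k \<in> regular_functions n V) \<and>
      (\<forall>p\<in>V. s p = (\<Oplus>\<^bsub>dual_space (fibre E p)\<^esub>k\<in>{..<r}. g k p \<odot>\<^bsub>dual_space (fibre E p)\<^esub> dual_frame r b k p)))"
    (is "_ \<longleftrightarrow> (\<exists>g. ?G g)") if V: "zariski_open n V" "V \<subseteq> U" for V s
  proof
    assume s: "s \<in> sections (dual_bundle n E) V"
    have "(\<lambda>p. s p (b k p)) \<in> regular_functions n V" if "k < r" for k
      using s V(1) frame_section[OF f V that] unfolding sections_dual_bundle by blast
    moreover have "s p = (\<Oplus>\<^bsub>dual_space (fibre E p)\<^esub>k\<in>{..<r}. s p (b k p) \<odot>\<^bsub>dual_space (fibre E p)\<^esub> dual_frame r b k p)"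
      if "p \<in> V" for p
    proof -
      have p: "p \<in> U"
        using that V(2) by blast
      have "s p \<in> carrier (dual_space (fibre E p))"
        using s that unfolding sections_dual_bundle by blast
      from based_space.dual_expand[OF based[OF p] this] show ?thesis
        unfolding df[OF p] by simp
    qed
    ultimately show "\<exists>g. ?G g"
      by (intro exI[of _ "\<lambda>k p. s p (b k p)"]) blast
  next
    assume "\<exists>g. ?G g"
    then obtain g where g: "\<And>k. k < r \<Longrightarrow> g k \<in> regular_functions n V"
      "\<And>p. p \<in> V \<Longrightarrow> s p = (\<Oplus>\<^bsub>dual_space (fibre E p)\<^esub>k\<in>{..<r}. g k p \<odot>\<^bsub>dual_space (fibre E p)\<^esub> dual_frame r b k p)"
      by blast
    have "s p \<in> carrier (dual_space (fibre E p))" if "p \<in> V" for p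
    proof -
      have p: "p \<in> U"
        using that V(2) by blast
      interpret D: complex_space "dual_space (fibre E p)"
        using complex_space_dual fibre_space p UPn by blast
      show ?thesis
        unfolding g(2)[OF that] using in_dual[OF p] by (intro D.finsum_in) auto
    qed
    moreover have "(\<lambda>p. s p (\<sigma> p)) \<in> regular_functions n W"
      if W: "zariski_open n W" "W \<subseteq> V" "\<sigma> \<in> sections E W" for W \<sigma>
    proof -
      have WU: "W \<subseteq> U"
        using W(2) V(2) by blast
      obtain h where h: "\<And>k. k < r \<Longrightarrow> h k \<in> regular_functions n W"
        "\<And>p. p \<in> W \<Longrightarrow> \<sigma> p = (\<Oplus>\<^bsub>fibre E p\<^esub>k\<in>{..<r}. h k p \<odot>\<^bsub>fibre E p\<^esub> b k p)"
        using W(3) unfolding frame_sections[OF f W(1) WU] by blast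
      have "s p (\<sigma> p) = (\<Sum>k<r. g k p * h k p)" if pW: "p \<in> W" for p
      proof -
        have p: "p \<in> U" "p \<in> V"
          using pW WU W(2) by auto
        interpret M: based_space "fibre E p" r "\<lambda>k. b k p"
          using based[OF p(1)] .
        show ?thesis
          unfolding g(2)[OF p(2)] h(2)[OF pW]
          by (subst dsum[OF p(1)]) (auto simp: M.coords_finsum)
      qed
      moreover have "(\<lambda>p. \<Sum>k<r. g k p * h k p) \<in> regular_functions n W"
        using regular_mono[OF g(1) W(2)] h(1) by (intro regular_sum regular_mult) auto
      ultimately show ?thesis
        by (rule regular_cong[rotated]) 
    qed
    ultimately show "s \<in> sections (dual_bundle n E) V"
      unfolding sections_dual_bundle by blast
  qed
  have "frame n r (dual_bundle n E) U (dual_frame r b)"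
    unfolding frame_iff dual_bundle_simps
  proof (intro conjI ballI allI impI U)
    fix p assume p: "p \<in> U"
    show "family_basis (dual_space (fibre E p)) r (\<lambda>k. dual_frame r b k p)"
      unfolding df[OF p] by (rule based_space.family_basis_dual[OF based[OF p]])
  qed (use sections in blast)
  moreover have "semi_invariant n (dual_bundle n E) U (\<lambda>j. - u k j) (dual_frame r b k)" if k: "k < r" for k
    unfolding semi_invariant_def
  proof (intro ballI)
    fix t p assume t: "t \<in> torus n" and p: "p \<in> U"
    have tp: "tpoint t p \<in> U"
      using inv t p .
    interpret M: based_space "fibre E p" r "\<lambda>k. b k p"
      using based[OF p] .
    interpret N: based_space "fibre E (tpoint t p)" r "\<lambda>k. b k (tpoint t p)"
      using based[OF tp] .
    let ?d = "coords (fibre E (tpoint t p)) r (\<lambda>k. b k (tpoint t p))"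
    have "dual_frame r b k p (bact E (tinv t) (tpoint t p) v)
        = inverse (torus_character n (u k) t) * ?d v k"
      if v: "v \<in> carrier (fibre E (tpoint t p))" for v
    proof -
      have "bact E (tinv t) (tpoint t p) v = bact E (tinv t) (tpoint t p)
          (\<Oplus>\<^bsub>fibre E (tpoint t p)\<^esub>k\<in>{..<r}. ?d v k \<odot>\<^bsub>fibre E (tpoint t p)\<^esub> b k (tpoint t p))"
        using N.coords_sum[OF v] by simp
      also have "\<dots> = (\<Oplus>\<^bsub>fibre E p\<^esub>k\<in>{..<r}.
          (?d v k * inverse (torus_character n (u k) t)) \<odot>\<^bsub>fibre E p\<^esub> b k p)"
        using bact_frame_sum[OF fr torus_closed(3)[OF t] tp, of "?d v"]
        by (simp add: tpoint_tinv[OF t] torus_character_tinv)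
      finally show ?thesis
        using k by (simp add: dual_frame_def M.coords_finsum mult.commute)
    qed
    then show "bact (dual_bundle n E) t p (dual_frame r b k p) =
        torus_character n (\<lambda>j. - u k j) t \<odot>\<^bsub>fibre (dual_bundle n E) (tpoint t p)\<^esub> dual_frame r b k (tpoint t p)"
      by (auto simp: fun_eq_iff torus_character_uminus) (simp_all add: dual_frame_def)
  qed
  ultimately show ?thesis
    unfolding equivariant_frame_def using inv by blast
qed

end

section \<open>Fibres and sections of line bundles\<close>

text \<open>The fibre of \<open>O(d)\<close> over \<open>p\<close>: functions on the punctured line \<open>p\<close> homogeneous of degree \<open>d\<close>.\<close>

definition line_fibre :: "int \<Rightarrow> ppoint \<Rightarrow> (cvec \<Rightarrow> complex) cspace" where
  "line_fibre d p = \<lparr>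
       carrier = {\<phi> \<in> p \<rightarrow>\<^sub>E UNIV. \<forall>x\<in>p. \<forall>c. c \<noteq> 0 \<longrightarrow> \<phi> (\<lambda>i. c * x i) = c powi d * \<phi> x},
       monoid.mult = undefined, one = undefined,
       zero = (\<lambda>x\<in>p. 0),
       add = (\<lambda>\<phi> \<psi>. \<lambda>x\<in>p. \<phi> x + \<psi> x),
       module.smult = (\<lambda>c \<phi>. \<lambda>x\<in>p. c * \<phi> x)\<rparr>"

lemma line_fibre_simps [simp]:
  "carrier (line_fibre d p) =
    {\<phi> \<in> p \<rightarrow>\<^sub>E UNIV. \<forall>x\<in>p. \<forall>c. c \<noteq> 0 \<longrightarrow> \<phi> (\<lambda>i. c * x i) = c powi d * \<phi> x}"
  "\<zero>\<^bsub>line_fibre d p\<^esub> = (\<lambda>x\<in>p. 0)"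
  "\<phi> \<oplus>\<^bsub>line_fibre d p\<^esub> \<psi> = (\<lambda>x\<in>p. \<phi> x + \<psi> x)"
  "c \<odot>\<^bsub>line_fibre d p\<^esub> \<phi> = (\<lambda>x\<in>p. c * \<phi> x)"
  by (simp_all add: line_fibre_def)

lemma complex_space_line_fibre:
  assumes p: "p \<in> Pn n"
  shows "complex_space (line_fibre d p)"
proof (rule complex_spaceI)
qed (use Pn_scale[OF p] in \<open>auto simp: algebra_simps fun_eq_iff restrict_def PiE_iff extensional_def\<close>)

lemma line_fibre_eqI:
  assumes p: "p \<in> Pn n" and x: "x \<in> p"
    and \<phi>: "\<phi> \<in> carrier (line_fibre d p)" and \<psi>: "\<psi> \<in> carrier (line_fibre d p)" and eq: "\<phi> x = \<psi> x"
  shows "\<phi> = \<psi>"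
proof (rule extensionalityI)
  show "\<phi> \<in> extensional p" "\<psi> \<in> extensional p"
    using \<phi> \<psi> by (auto simp: PiE_iff)
  fix y assume "y \<in> p"
  then obtain c where "c \<noteq> 0" "y = (\<lambda>i. c * x i)"
    using Pn_ratio[OF p x] by metis
  then show "\<phi> y = \<psi> y"
    using \<phi> \<psi> x eq by simp
qed

lemma fibre_toric_line_bundle: "fibre (toric_line_bundle n r) p = line_fibre (\<Sum>i\<le>n. r i) p"
  by (simp add: toric_line_bundle_def line_fibre_def Let_def)

lemma bact_toric_line_bundle: "bact (toric_line_bundle n r) t p \<phi> =
    (\<lambda>x\<in>tpoint t p. (\<Prod>i\<le>n. t i powi r i) * \<phi> (tmult (tinv t) x))"
  by (simp add: toric_line_bundle_def Let_def)

text \<open>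
  The section \<open>s\<close> of a line bundle over \<open>U\<close> equals \<open>P / Q\<close> wherever \<open>Q\<close> does not vanish, in particular
  at \<open>p\<close>. Unlike for functions, the value depends on the coordinate vector.
\<close>

definition line_fraction_at ::
    "ppoint set \<Rightarrow> ppoint \<Rightarrow> (ppoint \<Rightarrow> cvec \<Rightarrow> complex) \<Rightarrow> nat cpoly \<Rightarrow> nat cpoly \<Rightarrow> bool" where
  "line_fraction_at U p s P Q \<longleftrightarrow> (\<forall>x\<in>p. cpoly_eval Q x \<noteq> 0) \<and>
     (\<forall>q\<in>U. \<forall>x\<in>q. cpoly_eval Q x \<noteq> 0 \<longrightarrow> s q x = cpoly_eval P x / cpoly_eval Q x)"

lemma line_fraction_atD:
  assumes "line_fraction_at U p s P Q"
  shows "x \<in> p \<Longrightarrow> cpoly_eval Q x \<noteq> 0"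
    and "q \<in> U \<Longrightarrow> x \<in> q \<Longrightarrow> cpoly_eval Q x \<noteq> 0 \<Longrightarrow> s q x = cpoly_eval P x / cpoly_eval Q x"
  using assms by (simp_all add: line_fraction_at_def)

lemma sections_toric_line_bundle: "s \<in> sections (toric_line_bundle n r) U \<longleftrightarrow>
    (\<forall>p\<in>U. s p \<in> carrier (line_fibre (\<Sum>i\<le>n. r i) p) \<and>
      (\<exists>k l. int k - int l = (\<Sum>i\<le>n. r i) \<and>
        (\<exists>P\<in>homogeneous {..n} {..n} k. \<exists>Q\<in>homogeneous {..n} {..n} l. line_fraction_at U p s P Q)))"
  by (simp add: toric_line_bundle_def Let_def line_fibre_def line_fraction_at_def)

lemma sections_toric_line_bundle_mono:
  assumes "s \<in> sections (toric_line_bundle n r) U" "V \<subseteq> U"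
  shows "s \<in> sections (toric_line_bundle n r) V"
proof -
  have "line_fraction_at V p s P Q" if "line_fraction_at U p s P Q" for p P Q
    using that assms(2) unfolding line_fraction_at_def by auto
  then show ?thesis
    using assms unfolding sections_toric_line_bundle by (meson subsetD)
qed

text \<open>A chosen coordinate vector of a point.\<close>

definition coordinates :: "ppoint \<Rightarrow> cvec" where
  "coordinates p = (SOME x. x \<in> p)"

lemma coordinates_in: "p \<in> Pn n \<Longrightarrow> coordinates p \<in> p"
  unfolding coordinates_def by (metis Pn_obtain someI)

lemma coord_chart_in_Pn: "coord_chart n k \<subseteq> Pn n"
  by (auto simp: coord_chart_def)

lemma section_quotient_regular:
  assumes s: "s \<in> sections (toric_line_bundle n r) U" and d: "(\<Sum>i\<le>n. r i) = int d"
    and k: "k \<le> n" and U: "U \<subseteq> coord_chart n k"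
  shows "(\<lambda>q. s q (coordinates q) / coordinates q k ^ d) \<in> regular_functions n U"
  unfolding regular_iff
proof
  fix p assume p: "p \<in> U"
  obtain e l P Q where PQ: "int e - int l = int d" "P \<in> homogeneous {..n} {..n} e"
    "Q \<in> homogeneous {..n} {..n} l" "line_fraction_at U p s P Q"
    using s p unfolding sections_toric_line_bundle d by blast
  have Pe: "P \<in> homogeneous {..n} {..n} (l + d)"
    using PQ(1,2) by (simp add: algebra_simps flip: of_nat_add)
  have Q': "Q * Var k ^ d \<in> homogeneous {..n} {..n} (l + d)"
    using k by (intro homogeneous_mult PQ homogeneous_Var_power) auto
  have "fraction_at U p (\<lambda>q. s q (coordinates q) / coordinates q k ^ d) P (Q * Var k ^ d)"
    unfolding fraction_at_def
  proof (intro conjI ballI impI)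
    show "cpoly_eval (Q * Var k ^ d) x \<noteq> 0" if "x \<in> p" for x
      using line_fraction_atD(1)[OF PQ(4) that] p U that by (auto simp: eval_simps coord_chart_def)
    fix q x assume q: "q \<in> U" "x \<in> q" "cpoly_eval (Q * Var k ^ d) x \<noteq> 0"
    have qn: "q \<in> Pn n"
      using q(1) U coord_chart_in_Pn by blast
    obtain c where c: "c \<noteq> 0" "coordinates q = (\<lambda>i. c * x i)"
      using Pn_ratio[OF qn q(2) coordinates_in[OF qn]] by metis
    have "s q (coordinates q) = c ^ d * s q x"
      using s q(1,2) c unfolding sections_toric_line_bundle d by simp
    then have "s q (coordinates q) / coordinates q k ^ d = s q x / x k ^ d"
      using c by (simp add: power_mult_distrib)
    then show "s q (coordinates q) / coordinates q k ^ d = cpoly_eval P x / cpoly_eval (Q * Var k ^ d) x"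
      using line_fraction_atD(2)[OF PQ(4) q(1,2)] q(3) by (simp add: eval_simps)
  qed
  then show "\<exists>d'. \<exists>P\<in>homogeneous {..n} {..n} d'. \<exists>Q\<in>homogeneous {..n} {..n} d'.
      fraction_at U p (\<lambda>q. s q (coordinates q) / coordinates q k ^ d) P Q"
    using Pe Q' by blast
qed

lemma coordinate_quotient_regular:
  assumes k: "k \<le> n" and j: "j \<le> n" and U: "U \<subseteq> coord_chart n k"
  shows "(\<lambda>q. (coordinates q j / coordinates q k) ^ d) \<in> regular_functions n U"
  unfolding regular_iff
proof
  fix p assume p: "p \<in> U"
  have "fraction_at U p (\<lambda>q. (coordinates q j / coordinates q k) ^ d) (Var j ^ d) (Var k ^ d)"
    unfolding fraction_at_def
  proof (intro conjI ballI impI)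
    show "cpoly_eval (Var k ^ d) x \<noteq> 0" if "x \<in> p" for x
      using p U that by (auto simp: eval_simps coord_chart_def)
    fix q x assume q: "q \<in> U" "x \<in> q"
    have qn: "q \<in> Pn n"
      using q(1) U coord_chart_in_Pn by blast
    obtain c where c: "c \<noteq> 0" "coordinates q = (\<lambda>i. c * x i)"
      using Pn_ratio[OF qn q(2) coordinates_in[OF qn]] by metis
    then show "(coordinates q j / coordinates q k) ^ d = cpoly_eval (Var j ^ d) x / cpoly_eval (Var k ^ d) x"
      by (simp add: eval_simps power_divide power_mult_distrib)
  qed
  moreover have "Var j ^ d \<in> homogeneous {..n} {..n} d" "Var k ^ d \<in> homogeneous {..n} {..n} d"
    using j k by (auto intro: homogeneous_Var_power)
  ultimately show "\<exists>d'. \<exists>P\<in>homogeneous {..n} {..n} d'. \<exists>Q\<in>homogeneous {..n} {..n} d'.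
      fraction_at U p (\<lambda>q. (coordinates q j / coordinates q k) ^ d) P Q"
    by blast
qed

section \<open>The cokernel bundle\<close>

lemma direct_sum_space_cong:
  "(\<And>j. j \<in> J \<Longrightarrow> M j = N j) \<Longrightarrow> direct_sum_space J M = direct_sum_space J N"
  by (auto simp: direct_sum_space_def fun_eq_iff PiE_iff)

context
  fixes n :: nat and a :: "nat \<Rightarrow> nat"
begin

text \<open>The direct sum of the line bundles \<open>O(a\<^sub>j H\<^sub>j)\<close>, and its fibres over projective space.\<close>

definition sum_bundle :: "(nat \<Rightarrow> cvec \<Rightarrow> complex) tbundle" where
  "sum_bundle = direct_sum_bundle {..n} (\<lambda>j. toric_line_bundle n (\<lambda>i. if i = j then int (a j) else 0))"

definition sum_fibre :: "ppoint \<Rightarrow> (nat \<Rightarrow> cvec \<Rightarrow> complex) cspace" where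
  "sum_fibre p = direct_sum_space {..n} (\<lambda>j. line_fibre (int (a j)) p)"

text \<open>The line spanned by \<open>(x\<^sub>0\<^bsup>a\<^sub>0\<^esup>, \<dots>, x\<^sub>n\<^bsup>a\<^sub>n\<^esup>)\<close> in the fibre of the direct sum.\<close>

definition image_line :: "ppoint \<Rightarrow> (nat \<Rightarrow> cvec \<Rightarrow> complex) set" where
  "image_line p = {\<lambda>j\<in>{..n}. \<lambda>x\<in>p. c * x j ^ a j | c. True}"

lemma fibre_sum_bundle: "fibre sum_bundle p = sum_fibre p"
  unfolding sum_bundle_def sum_fibre_def direct_sum_bundle_def
  by (auto simp: fibre_toric_line_bundle intro!: direct_sum_space_cong)

lemma sum_fibre_simps [simp]:
  "carrier (sum_fibre p) = (\<Pi>\<^sub>E j\<in>{..n}. carrier (line_fibre (int (a j)) p))"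
  "\<zero>\<^bsub>sum_fibre p\<^esub> = (\<lambda>j\<in>{..n}. \<lambda>x\<in>p. 0)"
  "v \<oplus>\<^bsub>sum_fibre p\<^esub> w = (\<lambda>j\<in>{..n}. \<lambda>x\<in>p. v j x + w j x)"
  "c \<odot>\<^bsub>sum_fibre p\<^esub> v = (\<lambda>j\<in>{..n}. \<lambda>x\<in>p. c * v j x)"
  by (simp_all add: sum_fibre_def cong: restrict_cong)

lemma complex_space_sum_fibre: "p \<in> Pn n \<Longrightarrow> complex_space (sum_fibre p)"
  unfolding sum_fibre_def by (intro complex_space_direct_sum complex_space_line_fibre)

lemma sum_fibre_eqI:
  assumes p: "p \<in> Pn n" and x: "x \<in> p" and v: "v \<in> carrier (sum_fibre p)" and w: "w \<in> carrier (sum_fibre p)"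
    and eq: "\<And>j. j \<le> n \<Longrightarrow> v j x = w j x"
  shows "v = w"
proof (rule extensionalityI)
  show "v \<in> extensional {..n}" "w \<in> extensional {..n}"
    using v w by (auto simp: PiE_iff)
  fix j assume j: "j \<in> {..n}"
  have "v j \<in> carrier (line_fibre (int (a j)) p)" "w j \<in> carrier (line_fibre (int (a j)) p)"
    using v w j unfolding sum_fibre_simps by (auto simp del: line_fibre_simps)
  then show "v j = w j"
    by (rule line_fibre_eqI[OF p x]) (use eq j in auto)
qed

lemma eval_linear:
  "j \<le> n \<Longrightarrow> x \<in> p \<Longrightarrow> (\<lambda>v. v j x) \<in> linear_maps (sum_fibre p) complex_line"
  by (rule linear_mapsI) auto

lemma image_line_subset: "p \<in> Pn n \<Longrightarrow> image_line p \<subseteq> carrier (sum_fibre p)"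
  using Pn_scale by (fastforce simp: image_line_def power_mult_distrib)

lemma image_line_iff:
  assumes p: "p \<in> Pn n" and x: "x \<in> p" and v: "v \<in> carrier (sum_fibre p)"
  shows "v \<in> image_line p \<longleftrightarrow> (\<exists>c. \<forall>j\<le>n. v j x = c * x j ^ a j)"
proof
  assume "v \<in> image_line p"
  then show "\<exists>c. \<forall>j\<le>n. v j x = c * x j ^ a j"
    using x by (auto simp: image_line_def)
next
  assume "\<exists>c. \<forall>j\<le>n. v j x = c * x j ^ a j"
  then obtain c where c: "\<And>j. j \<le> n \<Longrightarrow> v j x = c * x j ^ a j"
    by blast
  have in_line: "(\<lambda>j\<in>{..n}. \<lambda>x\<in>p. c * x j ^ a j) \<in> image_line p"
    unfolding image_line_def by blast
  have "v = (\<lambda>j\<in>{..n}. \<lambda>x\<in>p. c * x j ^ a j)"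
    by (rule sum_fibre_eqI[OF p x v subsetD[OF image_line_subset[OF p] in_line]]) (use c x in auto)
  then show "v \<in> image_line p"
    using in_line by simp
qed

lemma sub_space_image_line:
  assumes p: "p \<in> Pn n"
  shows "sub_space (sum_fibre p) (image_line p)"
proof -
  interpret complex_space "sum_fibre p"
    by (rule complex_space_sum_fibre[OF p])
  obtain x where x: "x \<in> p"
    using p by (rule Pn_obtain)
  note iff = image_line_iff[OF p x] 
  have sub: "image_line p \<subseteq> carrier (sum_fibre p)"
    by (rule image_line_subset[OF p])
  have "submodule (image_line p) complex_field (sum_fibre p)"
  proof (rule submoduleI'[OF sub])
    show "\<zero>\<^bsub>sum_fibre p\<^esub> \<in> image_line p"
      using iff[OF M.zero_closed] x by (auto intro!: exI[of _ 0])
    fix v w c assume v: "v \<in> image_line p"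
    then have vc: "v \<in> carrier (sum_fibre p)"
      using sub by blast
    obtain d where d: "\<And>j. j \<le> n \<Longrightarrow> v j x = d * x j ^ a j"
      using v iff[OF vc] by blast
    show "c \<odot>\<^bsub>sum_fibre p\<^esub> v \<in> image_line p"
      using iff[OF smult_in[OF vc]] d x by (auto intro!: exI[of _ "c * d"])
    assume w: "w \<in> image_line p"
    then have wc: "w \<in> carrier (sum_fibre p)"
      using sub by blast
    obtain e where e: "\<And>j. j \<le> n \<Longrightarrow> w j x = e * x j ^ a j"
      using w iff[OF wc] by blast
    show "v \<oplus>\<^bsub>sum_fibre p\<^esub> w \<in> image_line p"
      using iff[OF M.a_closed[OF vc wc]] d e x by (auto intro!: exI[of _ "d + e"] simp: distrib_right)
  qed
  then show ?thesis
    by (simp add: sub_space_def sub_space_axioms_def complex_space_axioms)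
qed

text \<open>
  Elements of the direct sum are determined by their components at a single coordinate vector,
  and so equality in the cokernel can be tested there.
\<close>

lemma coset_eq_iff_eval:
  assumes p: "p \<in> Pn n" and x: "x \<in> p" and v: "v \<in> carrier (sum_fibre p)" and w: "w \<in> carrier (sum_fibre p)"
  shows "image_line p +>\<^bsub>sum_fibre p\<^esub> v = image_line p +>\<^bsub>sum_fibre p\<^esub> w \<longleftrightarrow>
    (\<exists>c. \<forall>j\<le>n. v j x - w j x = c * x j ^ a j)"
proof -
  interpret sub_space "sum_fibre p" "image_line p"
    by (rule sub_space_image_line[OF p])
  have "v \<oplus>\<^bsub>sum_fibre p\<^esub> (-1) \<odot>\<^bsub>sum_fibre p\<^esub> w \<in> carrier (sum_fibre p)"
    using v w by (intro M.a_closed smult_in)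
  from image_line_iff[OF p x this] show ?thesis
    unfolding coset_eq_iff[OF v w] using x by simp
qed

lemma image_trivial_fibre:
  assumes p: "p \<in> Pn n"
  shows "(\<lambda>\<phi>. \<lambda>j\<in>{..n}. \<lambda>x\<in>p. \<phi> x * x j ^ a j) ` carrier (line_fibre 0 p) = image_line p"
proof (intro equalityI subsetI)
  obtain x where x: "x \<in> p"
    using p by (rule Pn_obtain)
  {
    fix v assume "v \<in> (\<lambda>\<phi>. \<lambda>j\<in>{..n}. \<lambda>x\<in>p. \<phi> x * x j ^ a j) ` carrier (line_fibre 0 p)"
    then obtain \<phi> where \<phi>: "\<phi> \<in> carrier (line_fibre 0 p)" "v = (\<lambda>j\<in>{..n}. \<lambda>x\<in>p. \<phi> x * x j ^ a j)"
      by blast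
    have "\<phi> = (\<lambda>y\<in>p. \<phi> x)"
      using x Pn_scale[OF p] by (intro line_fibre_eqI[OF p x \<phi>(1)]) auto
    then have "\<phi> y = \<phi> x" if "y \<in> p" for y
      using that by (metis restrict_apply')
    then have "v = (\<lambda>j\<in>{..n}. \<lambda>y\<in>p. \<phi> x * y j ^ a j)"
      unfolding \<phi>(2) by (auto simp: fun_eq_iff)
    then show "v \<in> image_line p"
      unfolding image_line_def by blast
  next
    fix v assume "v \<in> image_line p"
    then obtain c where v: "v = (\<lambda>j\<in>{..n}. \<lambda>x\<in>p. c * x j ^ a j)"
      unfolding image_line_def by blast
    have c: "(\<lambda>x\<in>p. c) \<in> carrier (line_fibre 0 p)"
      using Pn_scale[OF p] by auto
    show "v \<in> (\<lambda>\<phi>. \<lambda>j\<in>{..n}. \<lambda>x\<in>p. \<phi> x * x j ^ a j) ` carrier (line_fibre 0 p)"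
      by (rule rev_image_eqI[OF c]) (auto simp: v fun_eq_iff)
  }
qed

lemma fibre_bundle_E:
  "p \<in> Pn n \<Longrightarrow> fibre (bundle_E n a) p = quotient_space (sum_fibre p) (image_line p)"
  using image_trivial_fibre[of p] fibre_sum_bundle[of p] unfolding sum_bundle_def
  by (simp add: bundle_E_def cokernel_bundle_def Let_def fibre_toric_line_bundle del: line_fibre_simps)

lemma bact_bundle_E: "bact (bundle_E n a) t p C = bact sum_bundle t p ` C"
  by (simp add: bundle_E_def cokernel_bundle_def Let_def sum_bundle_def)

lemma sections_bundle_E:
  assumes U: "U \<subseteq> Pn n"
  shows "s \<in> sections (bundle_E n a) U \<longleftrightarrow> (\<forall>p\<in>U. \<exists>V \<sigma>. zariski_open n V \<and> p \<in> V \<and> V \<subseteq> U \<and>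
        \<sigma> \<in> sections sum_bundle V \<and> (\<forall>q\<in>V. s q = image_line q +>\<^bsub>sum_fibre q\<^esub> \<sigma> q))"
proof -
  have "(\<forall>q\<in>V. s q = (\<lambda>\<phi>. \<lambda>j\<in>{..n}. \<lambda>x\<in>q. \<phi> x * x j ^ a j) `
      carrier (fibre (toric_line_bundle n (\<lambda>i. 0)) q) +>\<^bsub>fibre sum_bundle q\<^esub> \<sigma> q) \<longleftrightarrow>
    (\<forall>q\<in>V. s q = image_line q +>\<^bsub>sum_fibre q\<^esub> \<sigma> q)" if "V \<subseteq> U" for V \<sigma>
    using that U image_trivial_fibre
    by (intro ball_cong refl) (auto simp: fibre_sum_bundle fibre_toric_line_bundle simp del: line_fibre_simps)
  then show ?thesis
    unfolding bundle_E_def cokernel_bundle_def Let_def sum_bundle_def[symmetric]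
    by (simp cong: conj_cong del: line_fibre_simps)
qed

lemma degree_sum: "j \<le> n \<Longrightarrow> (\<Sum>i\<le>n. if i = j then int (a j) else 0) = int (a j)"
  by simp

lemma sections_sum_bundle: "\<sigma> \<in> sections sum_bundle U \<longleftrightarrow>
    (\<forall>p\<in>U. \<sigma> p \<in> extensional {..n}) \<and>
    (\<forall>j\<le>n. (\<lambda>p. \<sigma> p j) \<in> sections (toric_line_bundle n (\<lambda>i. if i = j then int (a j) else 0)) U)"
  by (auto simp: sum_bundle_def direct_sum_bundle_def)

lemma section_sum_bundle_in:
  assumes "\<sigma> \<in> sections sum_bundle U" "p \<in> U"
  shows "\<sigma> p \<in> carrier (sum_fibre p)"
  using assms unfolding sections_sum_bundle sections_toric_line_bundle sum_fibre_simps
  by (auto simp del: line_fibre_simps simp: PiE_iff)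

lemma bact_sum_bundle: "bact sum_bundle t p v =
    (\<lambda>j\<in>{..n}. \<lambda>x\<in>tpoint t p. t j ^ a j * v j (tmult (tinv t) x))"
proof -
  have "(\<Prod>i\<le>n. t i powi (if i = j then int (a j) else 0)) = t j ^ a j" if "j \<le> n" for j
  proof -
    have "(\<Prod>i\<le>n. t i powi (if i = j then int (a j) else 0)) = (\<Prod>i\<le>n. if i = j then t i ^ a j else 1)"
      by (intro prod.cong) auto
    then show ?thesis
      using that by simp
  qed
  then show ?thesis
    unfolding sum_bundle_def direct_sum_bundle_def
    by (auto simp: bact_toric_line_bundle fun_eq_iff)
qed

lemma tmult_tinv_mem: "t \<in> torus n \<Longrightarrow> x \<in> tpoint t p \<Longrightarrow> tmult (tinv t) x \<in> p"
  using tmult_tinv(1) by (auto simp: tpoint_def)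

lemma tmult_scale: "tmult t (\<lambda>i. c * x i) = (\<lambda>i. c * tmult t x i)"
  by (simp add: tmult_def mult.left_commute)

lemma bact_sum_bundle_linear:
  assumes t: "t \<in> torus n" and p: "p \<in> Pn n"
  shows "bact sum_bundle t p \<in> linear_maps (sum_fibre p) (sum_fibre (tpoint t p))"
proof (rule linear_mapsI)
  note mem = tmult_tinv_mem[OF t, of _ p]
  show "bact sum_bundle t p v \<in> carrier (sum_fibre (tpoint t p))" if v: "v \<in> carrier (sum_fibre p)" for v
    using v mem Pn_scale[OF tpoint_in_Pn[OF t p]]
    by (auto simp: bact_sum_bundle tmult_scale PiE_iff)
  show "bact sum_bundle t p (v \<oplus>\<^bsub>sum_fibre p\<^esub> w)
      = bact sum_bundle t p v \<oplus>\<^bsub>sum_fibre (tpoint t p)\<^esub> bact sum_bundle t p w" for v w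
    using mem by (auto simp: bact_sum_bundle fun_eq_iff distrib_left)
  show "bact sum_bundle t p (c \<odot>\<^bsub>sum_fibre p\<^esub> v)
      = c \<odot>\<^bsub>sum_fibre (tpoint t p)\<^esub> bact sum_bundle t p v" for c v
    using mem by (auto simp: bact_sum_bundle fun_eq_iff)
qed

lemma bact_image_line:
  assumes t: "t \<in> torus n"
  shows "bact sum_bundle t p ` image_line p = image_line (tpoint t p)"
proof -
  have "bact sum_bundle t p (\<lambda>j\<in>{..n}. \<lambda>x\<in>p. c * x j ^ a j)
      = (\<lambda>j\<in>{..n}. \<lambda>x\<in>tpoint t p. c * x j ^ a j)" for c
    using tmult_tinv_mem[OF t, of _ p] torus_nonzero[OF t]
    by (auto simp: bact_sum_bundle fun_eq_iff tmult_def tinv_def power_mult_distrib power_inverse)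
  moreover have "image_line q = range (\<lambda>c. \<lambda>j\<in>{..n}. \<lambda>x\<in>q. c * x j ^ a j)" for q
    by (auto simp: image_line_def)
  ultimately show ?thesis
    by (simp add: image_image)
qed

lemma bact_bundle_E_coset:
  assumes "t \<in> torus n" "p \<in> Pn n" "v \<in> carrier (sum_fibre p)"
  shows "bact (bundle_E n a) t p (image_line p +>\<^bsub>sum_fibre p\<^esub> v)
    = image_line (tpoint t p) +>\<^bsub>sum_fibre (tpoint t p)\<^esub> bact sum_bundle t p v"
  unfolding bact_bundle_E
  by (rule image_coset_linear(1)[OF sub_space_image_line sub_space_image_line
        bact_sum_bundle_linear bact_image_line]) (use assms tpoint_in_Pn in auto)

lemma equivariant_bundle_E: "equivariant_bundle n (bundle_E n a)"
proof (rule equivariant_bundle.intro)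
  fix p assume p: "p \<in> Pn n"
  show "complex_space (fibre (bundle_E n a) p)"
    unfolding fibre_bundle_E[OF p] by (rule sub_space.complex_space_quotient[OF sub_space_image_line[OF p]])
next
  fix U V s assume U: "zariski_open n U" and V: "zariski_open n V" "V \<subseteq> U"
    and s: "s \<in> sections (bundle_E n a) U"
  show "s \<in> sections (bundle_E n a) V"
    unfolding sections_bundle_E[OF zariski_open_subset[OF V(1)]]
  proof
    fix p assume p: "p \<in> V"
    then obtain W \<sigma> where W: "zariski_open n W" "p \<in> W" "\<sigma> \<in> sections sum_bundle W"
      "\<forall>q\<in>W. s q = image_line q +>\<^bsub>sum_fibre q\<^esub> \<sigma> q"
      using s V(2) unfolding sections_bundle_E[OF zariski_open_subset[OF U]] by blast
    have "\<sigma> \<in> sections sum_bundle (W \<inter> V)"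
      using W(3) unfolding sections_sum_bundle
      by (auto intro: sections_toric_line_bundle_mono)
    then show "\<exists>W \<sigma>. zariski_open n W \<and> p \<in> W \<and> W \<subseteq> V \<and> \<sigma> \<in> sections sum_bundle W \<and>
        (\<forall>q\<in>W. s q = image_line q +>\<^bsub>sum_fibre q\<^esub> \<sigma> q)"
      using W p V zariski_open_Int by (intro exI[of _ "W \<inter> V"] exI[of _ \<sigma>]) auto
  qed
next
  fix U s assume U: "zariski_open n U"
    and loc: "\<And>p. p \<in> U \<Longrightarrow> \<exists>V. zariski_open n V \<and> p \<in> V \<and> V \<subseteq> U \<and> s \<in> sections (bundle_E n a) V"
  show "s \<in> sections (bundle_E n a) U"
    unfolding sections_bundle_E[OF zariski_open_subset[OF U]]
  proof
    fix p assume "p \<in> U"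
    then obtain V where V: "zariski_open n V" "p \<in> V" "V \<subseteq> U" "s \<in> sections (bundle_E n a) V"
      using loc by blast
    obtain W \<sigma> where "zariski_open n W" "p \<in> W" "W \<subseteq> V" "\<sigma> \<in> sections sum_bundle W"
      "\<forall>q\<in>W. s q = image_line q +>\<^bsub>sum_fibre q\<^esub> \<sigma> q"
      using V(2,4) unfolding sections_bundle_E[OF zariski_open_subset[OF V(1)]] by blast
    then show "\<exists>W \<sigma>. zariski_open n W \<and> p \<in> W \<and> W \<subseteq> U \<and> \<sigma> \<in> sections sum_bundle W \<and>
        (\<forall>q\<in>W. s q = image_line q +>\<^bsub>sum_fibre q\<^esub> \<sigma> q)"
      using V(3) by blast
  qed
next
  fix t p assume t: "t \<in> torus n" and p: "p \<in> Pn n"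
  show "bact (bundle_E n a) t p \<in> linear_maps (fibre (bundle_E n a) p) (fibre (bundle_E n a) (tpoint t p))"
    using image_coset_linear(2)[OF sub_space_image_line[OF p] sub_space_image_line[OF tpoint_in_Pn[OF t p]]
        bact_sum_bundle_linear[OF t p] bact_image_line[OF t]]
    by (simp add: fibre_bundle_E p tpoint_in_Pn[OF t p] bact_bundle_E[abs_def])
next
  fix p C assume p: "p \<in> Pn n" and C: "C \<in> carrier (fibre (bundle_E n a) p)"
  interpret sub_space "sum_fibre p" "image_line p"
    by (rule sub_space_image_line[OF p])
  have "bact sum_bundle (\<lambda>i. 1) p v = v" if "v \<in> carrier (sum_fibre p)" for v
    using that by (auto simp: bact_sum_bundle fun_eq_iff tpoint_one tmult_def tinv_def PiE_iff extensional_def)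
  then show "bact (bundle_E n a) (\<lambda>i. 1) p C = C"
    using coset_member(1) C unfolding bact_bundle_E fibre_bundle_E[OF p] by simp
next
  fix s t p C assume s: "s \<in> torus n" and t: "t \<in> torus n" and p: "p \<in> Pn n"
    and C: "C \<in> carrier (fibre (bundle_E n a) p)"
  interpret sub_space "sum_fibre p" "image_line p"
    by (rule sub_space_image_line[OF p])
  have "bact sum_bundle (tmult s t) p v = bact sum_bundle s (tpoint t p) (bact sum_bundle t p v)" for v
    using tmult_tinv_mem[OF s, of _ "tpoint t p"] unfolding bact_sum_bundle tpoint_tmult
    by (auto simp: fun_eq_iff tmult_def tinv_def power_mult_distrib mult_ac)
  then show "bact (bundle_E n a) (tmult s t) p C
      = bact (bundle_E n a) s (tpoint t p) (bact (bundle_E n a) t p C)"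
    unfolding bact_bundle_E by (simp add: image_image)
qed

end

section \<open>Frames of the bundle\<close>

text \<open>The increasing enumeration of the natural numbers different from \<open>k\<close>.\<close>

definition skip :: "nat \<Rightarrow> nat \<Rightarrow> nat" where
  "skip k l = (if l < k then l else Suc l)"

lemma skip_le: "l < n \<Longrightarrow> skip k l \<le> n"
  by (simp add: skip_def)

lemma skip_neq: "skip k l \<noteq> k"
  by (simp add: skip_def)

lemma skip_eq_iff [simp]: "skip k l = skip k m \<longleftrightarrow> l = m"
  by (auto simp: skip_def)

lemma skip_cases:
  assumes "j \<le> n" "j \<noteq> k" "k \<le> n"
  obtains l where "l < n" "j = skip k l"
proof (cases "j < k")
  case True
  then show ?thesis
    using assms by (intro that[of j]) (auto simp: skip_def)
next
  case False
  then show ?thesis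
    using assms by (intro that[of "j - 1"]) (auto simp: skip_def)
qed

context
  fixes n :: nat and a :: "nat \<Rightarrow> nat"
begin

private abbreviation (input) "B \<equiv> sum_fibre n a"
private abbreviation (input) "L \<equiv> image_line n a"
private abbreviation (input) "F p \<equiv> fibre (bundle_E n a) p"

text \<open>The vector whose only component is \<open>e x\<^sub>k\<^bsup>a\<^sub>j\<^esup>\<close>, in the \<open>j\<close>-th summand.\<close>

definition unit_vector :: "ppoint \<Rightarrow> nat \<Rightarrow> complex \<Rightarrow> nat \<Rightarrow> nat \<Rightarrow> cvec \<Rightarrow> complex" where
  "unit_vector p k e j = (\<lambda>i\<in>{..n}. \<lambda>x\<in>p. if i = j then e * x k ^ a j else 0)"

text \<open>
  Over the chart \<open>x\<^sub>k \<noteq> 0\<close> the classes of the vectors for \<open>j \<noteq> k\<close> form a frame, since the \<open>k\<close>-th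
  component of \<open>(x\<^sub>0\<^bsup>a\<^sub>0\<^esup>, \<dots>, x\<^sub>n\<^bsup>a\<^sub>n\<^esup>)\<close> does not vanish there. The constants \<open>e l\<close> are used to adjust signs.
\<close>

definition frame_E :: "nat \<Rightarrow> (nat \<Rightarrow> complex) \<Rightarrow> nat \<Rightarrow> ppoint \<Rightarrow> (nat \<Rightarrow> cvec \<Rightarrow> complex) set" where
  "frame_E k e l p = L p +>\<^bsub>B p\<^esub> unit_vector p k (e l) (skip k l)"

text \<open>The weight of the \<open>l\<close>-th member of the frame, the character \<open>(t\<^sub>j / t\<^sub>k) ^ a\<^sub>j\<close> with \<open>j = skip k l\<close>.\<close>

definition frame_weight :: "nat \<Rightarrow> nat \<Rightarrow> nat \<Rightarrow> int" where
  "frame_weight k l m =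
    (if m = skip k l then int (a (skip k l)) else 0) - (if m = k then int (a (skip k l)) else 0)"

text \<open>
  The \<open>l\<close>-th coordinate, with respect to the frame, of the class of \<open>v\<close>, computed at the
  coordinate vector \<open>x\<close> of a point with \<open>x\<^sub>k \<noteq> 0\<close>: the multiple of
  \<open>(x\<^sub>0\<^bsup>a\<^sub>0\<^esup>, \<dots>, x\<^sub>n\<^bsup>a\<^sub>n\<^esup>)\<close> with the \<open>k\<close>-th component of \<open>v\<close> is subtracted first.
\<close>

definition frame_coord :: "nat \<Rightarrow> (nat \<Rightarrow> complex) \<Rightarrow> cvec \<Rightarrow> nat \<Rightarrow> (nat \<Rightarrow> cvec \<Rightarrow> complex) \<Rightarrow> complex" where
  "frame_coord k e x l v = (let j = skip k l in
    inverse (e l) * (v j x / x k ^ a j + (-1) * (v k x / x k ^ a k * (x j / x k) ^ a j)))"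

lemma unit_vector_in: "p \<in> Pn n \<Longrightarrow> unit_vector p k e j \<in> carrier (B p)"
  using Pn_scale by (auto simp: unit_vector_def power_mult_distrib)

lemma unit_sum_eval:
  assumes p: "p \<in> Pn n" and x: "x \<in> p" and k: "k \<le> n"
  shows "m < n \<Longrightarrow> (\<Oplus>\<^bsub>B p\<^esub>l\<in>{..<n}. c l \<odot>\<^bsub>B p\<^esub> unit_vector p k (e l) (skip k l)) (skip k m) x
      = c m * (e m * x k ^ a (skip k m))"
    and "(\<Oplus>\<^bsub>B p\<^esub>l\<in>{..<n}. c l \<odot>\<^bsub>B p\<^esub> unit_vector p k (e l) (skip k l)) k x = 0"
proof -
  have eval: "(\<Oplus>\<^bsub>B p\<^esub>l\<in>{..<n}. c l \<odot>\<^bsub>B p\<^esub> unit_vector p k (e l) (skip k l)) j x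
      = (\<Sum>l<n. c l * (if j = skip k l then e l * x k ^ a (skip k l) else 0))" if "j \<le> n" for j
    using functional_finsum[OF complex_space_sum_fibre[OF p] eval_linear[OF that x],
        where A = "{..<n}" and b = "\<lambda>l. unit_vector p k (e l) (skip k l)" and c = c] unit_vector_in[OF p] that x
    by (simp add: unit_vector_def del: sum_fibre_simps)
  show "(\<Oplus>\<^bsub>B p\<^esub>l\<in>{..<n}. c l \<odot>\<^bsub>B p\<^esub> unit_vector p k (e l) (skip k l)) (skip k m) x
      = c m * (e m * x k ^ a (skip k m))" if m: "m < n"
  proof -
    have "(\<Sum>l<n. c l * (if skip k m = skip k l then e l * x k ^ a (skip k l) else 0))
        = (\<Sum>l<n. if l = m then c m * (e m * x k ^ a (skip k m)) else 0)"
      by (intro sum.cong) auto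
    then show ?thesis
      unfolding eval[OF skip_le[OF m]] using m by simp
  qed
  show "(\<Oplus>\<^bsub>B p\<^esub>l\<in>{..<n}. c l \<odot>\<^bsub>B p\<^esub> unit_vector p k (e l) (skip k l)) k x = 0"
    unfolding eval[OF k] using skip_neq[of k] by (intro sum.neutral) (auto simp: eq_commute)
qed

lemma frame_coord_linear:
  assumes "k \<le> n" "l < n" "x \<in> p"
  shows "frame_coord k e x l \<in> linear_maps (B p) complex_line"
  using assms skip_le[OF assms(2), of k]
  by (intro linear_mapsI) (auto simp: frame_coord_def Let_def algebra_simps add_divide_distrib)

lemma frame_coord_image_line:
  assumes "k \<le> n" "l < n" "x \<in> p" "x k \<noteq> 0" "v \<in> L p"
  shows "frame_coord k e x l v = 0"
  using assms skip_le[OF assms(2), of k]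
  by (auto simp: image_line_def frame_coord_def Let_def power_divide)

lemma frame_coord_unit:
  assumes "k \<le> n" "l < n" "m < n" "x \<in> p" "x k \<noteq> 0" "e m \<noteq> 0"
  shows "frame_coord k e x l (unit_vector p k (e m) (skip k m)) = (if l = m then 1 else 0)"
  using assms skip_le[OF assms(2), of k] skip_neq[of k l] skip_neq[of k m]
  by (simp add: frame_coord_def Let_def unit_vector_def skip_neq[symmetric])

lemma coset_frame_sum:
  assumes p: "p \<in> Pn n"
  shows "(\<Oplus>\<^bsub>F p\<^esub>l\<in>{..<n}. c l \<odot>\<^bsub>F p\<^esub> frame_E k e l p)
    = L p +>\<^bsub>B p\<^esub>
      (\<Oplus>\<^bsub>B p\<^esub>l\<in>{..<n}. c l \<odot>\<^bsub>B p\<^esub> unit_vector p k (e l) (skip k l))"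
  unfolding fibre_bundle_E[OF p] frame_E_def
  by (rule sub_space.coset_finsum[OF sub_space_image_line[OF p]]) (use unit_vector_in[OF p] in auto)

lemma frame_E_expand:
  assumes k: "k \<le> n" and e: "\<forall>l<n. e l \<noteq> 0" and p: "p \<in> coord_chart n k" and x: "x \<in> p"
    and v: "v \<in> carrier (B p)"
  shows "L p +>\<^bsub>B p\<^esub> v = (\<Oplus>\<^bsub>F p\<^esub>l\<in>{..<n}.
    frame_coord k e x l v \<odot>\<^bsub>F p\<^esub> frame_E k e l p)"
proof -
  have pn: "p \<in> Pn n" and xk: "x k \<noteq> 0"
    using p x by (auto simp: coord_chart_def)
  interpret complex_space "B p"
    by (rule complex_space_sum_fibre[OF pn])
  let ?w = "\<Oplus>\<^bsub>B p\<^esub>l\<in>{..<n}. frame_coord k e x l v \<odot>\<^bsub>B p\<^esub> unit_vector p k (e l) (skip k l)"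
  have w: "?w \<in> carrier (B p)"
    using unit_vector_in[OF pn] by (intro finsum_in) auto
  have "v j x - ?w j x = v k x / x k ^ a k * x j ^ a j" if j: "j \<le> n" for j
  proof (cases "j = k")
    case True
    then show ?thesis
      using unit_sum_eval(2)[OF pn x k] xk by simp
  next
    case False
    then obtain m where m: "m < n" "j = skip k m"
      using skip_cases[OF j False k] by metis
    have "?w j x = frame_coord k e x m v * (e m * x k ^ a j)"
      unfolding m(2) by (rule unit_sum_eval(1)[OF pn x k m(1)])
    also have "\<dots> = v j x - v k x / x k ^ a k * x j ^ a j"
      using xk e m(1) by (simp add: frame_coord_def Let_def m(2)[symmetric] field_simps)
    finally show ?thesis
      by simp
  qed
  then show ?thesis
    unfolding coset_frame_sum[OF pn] coset_eq_iff_eval[OF pn x v w] by blast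
qed

lemma frame_E_basis:
  assumes k: "k \<le> n" and e: "\<forall>l<n. e l \<noteq> 0" and p: "p \<in> coord_chart n k"
  shows "family_basis (F p) n (\<lambda>l. frame_E k e l p)"
proof -
  have pn: "p \<in> Pn n"
    using p by (simp add: coord_chart_def)
  obtain x where x: "x \<in> p"
    using pn by (rule Pn_obtain)
  have xk: "x k \<noteq> 0"
    using p x by (simp add: coord_chart_def)
  interpret sub_space "B p" "L p"
    by (rule sub_space_image_line[OF pn])
  note fib = fibre_bundle_E[OF pn]
  note lin = frame_coord_linear[OF k _ x] and van = frame_coord_image_line[OF k _ x xk]
  have functional: "quotient_functional (frame_coord k e x l) (L p +>\<^bsub>B p\<^esub> v)
      = frame_coord k e x l v" if "l < n" "v \<in> carrier (B p)" for l v
    by (rule quotient_functional_coset[OF lin[OF that(1)] _ that(2)]) (rule van[OF that(1)])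
  show ?thesis
  proof (rule family_basisI[where l = "\<lambda>l. quotient_functional (frame_coord k e x l)"])
    show "complex_space (F p)"
      unfolding fib by (rule complex_space_quotient)
    show "frame_E k e l p \<in> carrier (F p)" for l
      unfolding fib frame_E_def by (rule coset_in) (rule unit_vector_in[OF pn])
    show "quotient_functional (frame_coord k e x l) \<in> linear_maps (F p) complex_line"
      if "l < n" for l
      unfolding fib using lin[OF that] van[OF that] by (rule quotient_functional_linear)
    show "quotient_functional (frame_coord k e x l) (frame_E k e m p) = (if l = m then 1 else 0)"
      if "l < n" "m < n" for l m
      unfolding frame_E_def functional[OF that(1) unit_vector_in[OF pn]]
      by (rule frame_coord_unit[where p = p and e = e and k = k]) (use k that x xk e in auto)
    show "C = (\<Oplus>\<^bsub>F p\<^esub>l\<in>{..<n}. quotient_functional (frame_coord k e x l) C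
        \<odot>\<^bsub>F p\<^esub> frame_E k e l p)" if C: "C \<in> carrier (F p)" for C
    proof -
      interpret Q: complex_space "F p"
        unfolding fib by (rule complex_space_quotient)
      obtain v where v: "v \<in> carrier (B p)" "C = L p +>\<^bsub>B p\<^esub> v"
        using C unfolding fib by (rule coset_cases)
      have "quotient_functional (frame_coord k e x l) C = frame_coord k e x l v" if "l < n" for l
        unfolding v(2) by (rule functional[OF that v(1)])
      moreover have "frame_E k e l p \<in> carrier (F p)" for l
        unfolding fib frame_E_def by (rule coset_in) (rule unit_vector_in[OF pn])
      ultimately show ?thesis
        using frame_E_expand[OF k e p x v(1)] unfolding v(2)[symmetric]
        by (subst Q.finsum_cong'[OF refl]) auto
    qed
  qed
qed

lemma frame_E_coords:
  assumes k: "k \<le> n" and e: "\<forall>l<n. e l \<noteq> 0" and p: "p \<in> coord_chart n k" and x: "x \<in> p"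
    and v: "v \<in> carrier (B p)" and l: "l < n"
  shows "coords (F p) n (\<lambda>l. frame_E k e l p) (L p +>\<^bsub>B p\<^esub> v) l
    = frame_coord k e x l v"
proof -
  have pn: "p \<in> Pn n"
    using p by (simp add: coord_chart_def)
  interpret based_space "F p" n "\<lambda>l. frame_E k e l p"
    unfolding based_space_def based_space_axioms_def
    using frame_E_basis[OF k e p] equivariant_bundle.fibre_space[OF equivariant_bundle_E pn] by blast
  show ?thesis
    unfolding frame_E_expand[OF k e p x v] by (rule coords_finsum[OF l])
qed

lemma torus_character_frame_weight:
  assumes t: "t \<in> torus n" and k: "k \<le> n" and l: "l < n"
  shows "torus_character n (frame_weight k l) t = t (skip k l) ^ a (skip k l) / t k ^ a (skip k l)"
proof -
  have single: "torus_character n (\<lambda>m. if m = j then int d else 0) t = t j ^ d" if "j \<le> n" for j d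
  proof -
    have "torus_character n (\<lambda>m. if m = j then int d else 0) t = (\<Prod>m=1..n. if m = j then t m ^ d else 1)"
      unfolding torus_character_def by (intro prod.cong) auto
    also have "\<dots> = t j ^ d"
      using that t by (auto simp: torus_def)
    finally show ?thesis .
  qed
  show ?thesis
    unfolding frame_weight_def[abs_def] torus_character_diff[OF t] single[OF skip_le[OF l]] single[OF k] ..
qed

lemma pairing_frame_weight:
  assumes k: "k \<le> n" and l: "l < n" and i: "i \<le> n" "i \<noteq> k"
  shows "pairing n (frame_weight k l) (ray_generator n i) = (if i = skip k l then int (a i) else 0)"
proof (cases "i = 0")
  case True
  have s: "(\<Sum>m=1..n. if m = j then d else 0) = (if j = 0 then 0 else d)" if "j \<le> n" for j and d :: int
    using that by auto
  have "(\<Sum>m=1..n. frame_weight k l m)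
      = (if skip k l = 0 then 0 else int (a (skip k l))) - (if k = 0 then 0 else int (a (skip k l)))"
    unfolding frame_weight_def sum_subtractf using s[OF skip_le[OF l]] s[OF k] by simp
  then show ?thesis
    using True i by (auto simp: pairing_ray_generator)
next
  case False
  then show ?thesis
    using i by (auto simp: pairing_ray_generator frame_weight_def)
qed

text \<open>A section with regular coefficients lifts to the direct sum.\<close>

lemma unit_sum_section:
  assumes k: "k \<le> n" and V: "V \<subseteq> coord_chart n k"
    and f: "\<And>l. l < n \<Longrightarrow> f l \<in> regular_functions n V"
  shows "(\<lambda>p. \<Oplus>\<^bsub>B p\<^esub>l\<in>{..<n}. f l p \<odot>\<^bsub>B p\<^esub> unit_vector p k (e l) (skip k l))
    \<in> sections (sum_bundle n a) V" (is "?\<sigma> \<in> _")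
  unfolding sections_sum_bundle
proof (intro conjI ballI allI impI)
  have VPn: "p \<in> Pn n" if "p \<in> V" for p
    using that V coord_chart_in_Pn by blast
  have car: "?\<sigma> p \<in> carrier (B p)" if "p \<in> V" for p
    by (rule complex_space.finsum_in[OF complex_space_sum_fibre[OF VPn[OF that]]])
      (rule unit_vector_in[OF VPn[OF that]])
  then show "?\<sigma> p \<in> extensional {..n}" if "p \<in> V" for p
    using that by (auto simp: PiE_iff)
  fix j assume j: "j \<le> n"
  show "(\<lambda>p. ?\<sigma> p j) \<in> sections (toric_line_bundle n (\<lambda>i. if i = j then int (a j) else 0)) V"
    unfolding sections_toric_line_bundle degree_sum[OF j]
  proof (intro ballI conjI)
    fix p assume p: "p \<in> V"
    show "?\<sigma> p j \<in> carrier (line_fibre (int (a j)) p)"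
      using car[OF p] j unfolding sum_fibre_simps by (auto simp del: line_fibre_simps)
    show "\<exists>d l. int d - int l = int (a j) \<and> (\<exists>P\<in>homogeneous {..n} {..n} d. \<exists>Q\<in>homogeneous {..n} {..n} l.
        line_fraction_at V p (\<lambda>p. ?\<sigma> p j) P Q)"
    proof (cases "j = k")
      case True
      have "line_fraction_at V p (\<lambda>p. ?\<sigma> p j) 0 1"
        unfolding True line_fraction_at_def using unit_sum_eval(2)[OF VPn _ k] by simp
      moreover have "0 \<in> homogeneous {..n} {..n} (a j)"
        by (simp add: homogeneous_iff cpoly_ring_carrier)
      ultimately show ?thesis
        using homogeneous_one by (intro exI[of _ "a j"] exI[of _ 0]) auto
    next
      case False
      then obtain m where m: "m < n" "j = skip k m"
        using skip_cases[OF j False k] by metis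
      obtain d P Q where PQ: "P \<in> homogeneous {..n} {..n} d" "Q \<in> homogeneous {..n} {..n} d"
        "fraction_at V p (f m) P Q"
        using f[OF m(1)] p unfolding regular_iff by blast
      have "line_fraction_at V p (\<lambda>p. ?\<sigma> p j) (Const (e m) * (P * Var k ^ a j)) Q"
        unfolding line_fraction_at_def m(2)
        using fraction_atD[OF PQ(3)] unit_sum_eval(1)[OF VPn _ k m(1)]
        by (simp add: eval_simps mult_ac)
      moreover have "Const (e m) * (P * Var k ^ a j) \<in> homogeneous {..n} {..n} (0 + (d + a j))"
        using k by (intro homogeneous_mult homogeneous_Const PQ homogeneous_Var_power) auto
      ultimately show ?thesis
        using PQ(2) by (intro exI[of _ "d + a j"] exI[of _ d]) auto
    qed
  qed
qed

lemma frame_E_regular_coeff: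
  assumes k: "k \<le> n" and V: "V \<subseteq> coord_chart n k" and \<sigma>: "\<sigma> \<in> sections (sum_bundle n a) V" and l: "l < n"
  shows "(\<lambda>p. frame_coord k e (coordinates p) l (\<sigma> p)) \<in> regular_functions n V"
proof -
  have quot: "(\<lambda>p. \<sigma> p j (coordinates p) / coordinates p k ^ a j) \<in> regular_functions n V"
    if j: "j \<le> n" for j
  proof -
    have "(\<lambda>p. \<sigma> p j) \<in> sections (toric_line_bundle n (\<lambda>i. if i = j then int (a j) else 0)) V"
      using \<sigma> j unfolding sections_sum_bundle by blast
    then show ?thesis
      by (rule section_quotient_regular) (use degree_sum[OF j] k V in auto)
  qed
  show ?thesis
    unfolding frame_coord_def Let_def
    by (intro regular_mult regular_add regular_const coordinate_quotient_regular[OF k skip_le[OF l] V]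
        quot skip_le[OF l] k)
qed

lemma frame_E:
  assumes k: "k \<le> n" and e: "\<forall>l<n. e l \<noteq> 0"
  shows "frame n n (bundle_E n a) (coord_chart n k) (frame_E k e)"
  unfolding frame_iff
proof (intro conjI ballI allI impI)
  show "zariski_open n (coord_chart n k)"
    using k by (rule open_coord_chart)
  show "family_basis (F p) n (\<lambda>l. frame_E k e l p)" if "p \<in> coord_chart n k" for p
    using k e that by (rule frame_E_basis)
  fix V s assume "zariski_open n V \<and> V \<subseteq> coord_chart n k"
  then have V: "zariski_open n V" "V \<subseteq> coord_chart n k"
    by auto
  have VPn: "V \<subseteq> Pn n"
    using V(1) by (rule zariski_open_subset)
  show "s \<in> sections (bundle_E n a) V \<longleftrightarrow> (\<exists>f. (\<forall>l<n. f l \<in> regular_functions n V) \<and>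
      (\<forall>p\<in>V. s p = (\<Oplus>\<^bsub>F p\<^esub>l\<in>{..<n}. f l p \<odot>\<^bsub>F p\<^esub> frame_E k e l p)))"
  proof
    assume s: "s \<in> sections (bundle_E n a) V"
    define f where "f l p = coords (F p) n (\<lambda>l. frame_E k e l p) (s p) l" for l p
    have lift: "\<exists>W \<sigma>. zariski_open n W \<and> p \<in> W \<and> W \<subseteq> V \<and> \<sigma> \<in> sections (sum_bundle n a) W \<and>
        (\<forall>q\<in>W. s q = L q +>\<^bsub>B q\<^esub> \<sigma> q)" if "p \<in> V" for p
      using s that unfolding sections_bundle_E[OF VPn] by blast
    have "f l \<in> regular_functions n V" if l: "l < n" for l
    proof (rule regular_local[OF VPn])
      fix p assume "p \<in> V"
      then obtain W \<sigma> where W: "zariski_open n W" "p \<in> W" "W \<subseteq> V" "\<sigma> \<in> sections (sum_bundle n a) W"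
        "\<forall>q\<in>W. s q = L q +>\<^bsub>B q\<^esub> \<sigma> q"
        using lift by blast
      have Wk: "W \<subseteq> coord_chart n k"
        using W(3) V(2) by blast
      have "f l q = frame_coord k e (coordinates q) l (\<sigma> q)" if q: "q \<in> W" for q
      proof -
        have qk: "q \<in> coord_chart n k" and qn: "q \<in> Pn n"
          using q Wk coord_chart_in_Pn by auto
        show ?thesis
          using frame_E_coords[OF k e qk coordinates_in[OF qn] section_sum_bundle_in[OF W(4) q] l] W(5) q
          by (simp add: f_def)
      qed
      then have "f l \<in> regular_functions n W"
        by (rule regular_cong[OF frame_E_regular_coeff[OF k Wk W(4) l]])
      then show "\<exists>W. zariski_open n W \<and> p \<in> W \<and> f l \<in> regular_functions n (W \<inter> V)"
        using W regular_mono by (intro exI[of _ W]) auto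
    qed
    moreover have "s p = (\<Oplus>\<^bsub>F p\<^esub>l\<in>{..<n}. f l p \<odot>\<^bsub>F p\<^esub> frame_E k e l p)"
      if p: "p \<in> V" for p
    proof -
      have pk: "p \<in> coord_chart n k" and pn: "p \<in> Pn n"
        using p V(2) VPn by auto
      interpret sub_space "B p" "L p"
        by (rule sub_space_image_line[OF pn])
      interpret Q: based_space "F p" n "\<lambda>l. frame_E k e l p"
        unfolding based_space_def based_space_axioms_def
        using frame_E_basis[OF k e pk] equivariant_bundle.fibre_space[OF equivariant_bundle_E pn] by blast
      obtain W \<sigma> where "p \<in> W" "\<sigma> \<in> sections (sum_bundle n a) W"
        "\<forall>q\<in>W. s q = L q +>\<^bsub>B q\<^esub> \<sigma> q"
        using lift[OF p] by blast
      then have "s p \<in> carrier (F p)"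
        unfolding fibre_bundle_E[OF pn] using section_sum_bundle_in by (metis coset_in)
      then show ?thesis
        unfolding f_def by (rule Q.coords_sum[symmetric])
    qed
    ultimately show "\<exists>f. (\<forall>l<n. f l \<in> regular_functions n V) \<and>
      (\<forall>p\<in>V. s p = (\<Oplus>\<^bsub>F p\<^esub>l\<in>{..<n}. f l p \<odot>\<^bsub>F p\<^esub> frame_E k e l p))"
      by blast
  next
    assume "\<exists>f. (\<forall>l<n. f l \<in> regular_functions n V) \<and>
      (\<forall>p\<in>V. s p = (\<Oplus>\<^bsub>F p\<^esub>l\<in>{..<n}. f l p \<odot>\<^bsub>F p\<^esub> frame_E k e l p))"
    then obtain f where f: "\<And>l. l < n \<Longrightarrow> f l \<in> regular_functions n V"
      "\<And>p. p \<in> V \<Longrightarrow> s p = (\<Oplus>\<^bsub>F p\<^esub>l\<in>{..<n}. f l p \<odot>\<^bsub>F p\<^esub> frame_E k e l p)"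
      by blast
    let ?\<sigma> = "\<lambda>p. \<Oplus>\<^bsub>B p\<^esub>l\<in>{..<n}. f l p \<odot>\<^bsub>B p\<^esub> unit_vector p k (e l) (skip k l)"
    have lift: "s p = L p +>\<^bsub>B p\<^esub> ?\<sigma> p" if "p \<in> V" for p
      unfolding f(2)[OF that] by (rule coset_frame_sum) (use that VPn in blast)
    have "?\<sigma> \<in> sections (sum_bundle n a) V"
      by (rule unit_sum_section[OF k V(2)]) (rule f(1))
    then show "s \<in> sections (bundle_E n a) V"
      unfolding sections_bundle_E[OF VPn]
      by (intro ballI exI[of _ V] exI[of _ ?\<sigma>] conjI V(1) lift) auto
  qed
qed

lemma equivariant_frame_E:
  assumes k: "k \<le> n" and e: "\<forall>l<n. e l \<noteq> 0"
  shows "equivariant_frame n n (bundle_E n a) (coord_chart n k) (frame_E k e) (frame_weight k)"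
  unfolding equivariant_frame_def semi_invariant_def
proof (intro conjI ballI allI impI frame_E[OF k e])
  show "tpoint t p \<in> coord_chart n k" if "t \<in> torus n" "p \<in> coord_chart n k" for t p
    using that by (rule tpoint_coord_chart)
  fix l t p assume l: "l < n" and t: "t \<in> torus n" and p: "p \<in> coord_chart n k"
  have pn: "p \<in> Pn n" and tp: "tpoint t p \<in> Pn n"
    using p coord_chart_in_Pn tpoint_in_Pn[OF t] by auto
  let ?j = "skip k l"
  have "bact (sum_bundle n a) t p (unit_vector p k (e l) ?j)
      = torus_character n (frame_weight k l) t \<odot>\<^bsub>B (tpoint t p)\<^esub> unit_vector (tpoint t p) k (e l) ?j"
    using tmult_tinv_mem[OF t, of _ p] torus_nonzero[OF t, of k]
    by (auto simp: bact_sum_bundle unit_vector_def fun_eq_iff torus_character_frame_weight[OF t k l]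
        tmult_def tinv_def power_mult_distrib field_simps)
  then show "bact (bundle_E n a) t p (frame_E k e l p) = torus_character n (frame_weight k l) t
      \<odot>\<^bsub>fibre (bundle_E n a) (tpoint t p)\<^esub> frame_E k e l (tpoint t p)"
    unfolding frame_E_def bact_bundle_E_coset[OF t pn unit_vector_in[OF pn]] fibre_bundle_E[OF tp]
    by (simp only: sub_space.coset_smult[OF sub_space_image_line[OF tp] unit_vector_in[OF tp]])
qed

end

section \<open>The pairs of the bundle and of its dual\<close>

text \<open>The coordinate vector \<open>(1, \<dots>, 1)\<close> of the identity of the torus.\<close>

definition one_vector :: "nat \<Rightarrow> cvec" where
  "one_vector n = (\<lambda>i. if i \<le> n then 1 else 0)"

lemma one_vector_in: "one_vector n \<in> identity_point n"
  unfolding one_vector_def identity_point_def by (rule hpoint_self)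

lemma one_vector_simp [simp]: "i \<le> n \<Longrightarrow> one_vector n i = 1"
  by (simp add: one_vector_def)

lemma exists_third:
  assumes "(2::nat) \<le> n"
  obtains k where "k \<le> n" "k \<noteq> i" "k \<noteq> j"
proof -
  have "\<exists>k\<le>2. k \<noteq> i \<and> k \<noteq> j"
    by presburger
  then show ?thesis
    using assms that by (meson le_trans)
qed

context
  fixes n :: nat and a :: "nat \<Rightarrow> nat"
begin

text \<open>The image of the \<open>j\<close>-th standard vector in the fibre at the identity.\<close>

definition fibre_vector :: "nat \<Rightarrow> (nat \<Rightarrow> cvec \<Rightarrow> complex) set" where
  "fibre_vector j = image_line n a (identity_point n) +>\<^bsub>sum_fibre n a (identity_point n)\<^esub>
     unit_vector n a (identity_point n) 0 1 j"

text \<open>The difference of the \<open>i\<close>-th and the \<open>j\<close>-th component, as a functional on the fibre at the identity.\<close>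

definition difference_functional :: "nat \<Rightarrow> nat \<Rightarrow> (nat \<Rightarrow> cvec \<Rightarrow> complex) set \<Rightarrow> complex" where
  "difference_functional i j = sub_space.quotient_functional (sum_fibre n a (identity_point n))
     (image_line n a (identity_point n)) (\<lambda>v. v i (one_vector n) + (-1) * v j (one_vector n))"

private abbreviation (input) "M \<equiv> sum_fibre n a (identity_point n)"
private abbreviation (input) "H \<equiv> image_line n a (identity_point n)"
private abbreviation (input) "E \<equiv> bundle_E n a"

interpretation M: sub_space M H
  by (rule sub_space_image_line[OF identity_in_Pn])

interpretation E: equivariant_bundle n E
  by (rule equivariant_bundle_E)

interpretation D: equivariant_bundle n "dual_bundle n E"
  by (rule E.equivariant_dual)

lemma identity_fibre_E: "identity_fibre n E = quotient_space M H"
  by (simp add: identity_fibre_def fibre_bundle_E[OF identity_in_Pn])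

lemma unit_vector_identity:
  assumes "k \<le> n"
  shows "unit_vector n a (identity_point n) k e j = unit_vector n a (identity_point n) 0 e j"
  unfolding unit_vector_def
proof (intro restrict_ext)
  fix i x assume "x \<in> identity_point n"
  then have "x k = x 0"
    using assms by (auto simp: identity_point_def hpoint_def)
  then show "(if i = j then e * x k ^ a j else 0) = (if i = j then e * x 0 ^ a j else 0)"
    by simp
qed

lemma fibre_vector_in: "fibre_vector j \<in> carrier (identity_fibre n E)"
  unfolding fibre_vector_def identity_fibre_E by (intro M.coset_in unit_vector_in identity_in_Pn)

lemma frame_E_identity: "k \<le> n \<Longrightarrow> frame_E n a k (\<lambda>_. 1) l (identity_point n) = fibre_vector (skip k l)"
  unfolding frame_E_def fibre_vector_def by (simp only: unit_vector_identity[of k])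

lemma fibre_vector_relation:
  "(\<Oplus>\<^bsub>identity_fibre n E\<^esub>j\<in>{..n}. c j \<odot>\<^bsub>identity_fibre n E\<^esub> fibre_vector j) = \<zero>\<^bsub>identity_fibre n E\<^esub>
    \<longleftrightarrow> (\<exists>d. \<forall>j\<le>n. c j = d)"
proof -
  let ?p = "identity_point n" and ?x = "one_vector n"
  let ?w = "\<Oplus>\<^bsub>M\<^esub>j\<in>{..n}. c j \<odot>\<^bsub>M\<^esub> unit_vector n a ?p 0 1 j"
  have sum: "(\<Oplus>\<^bsub>identity_fibre n E\<^esub>j\<in>{..n}. c j \<odot>\<^bsub>identity_fibre n E\<^esub> fibre_vector j) = H +>\<^bsub>M\<^esub> ?w"
    unfolding identity_fibre_E fibre_vector_def
    by (rule M.coset_finsum) (auto simp del: sum_fibre_simps intro: unit_vector_in[OF identity_in_Pn])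
  have w: "?w \<in> carrier M"
    by (intro M.finsum_in unit_vector_in identity_in_Pn)
  have "?w i ?x = c i" if "i \<le> n" for i
  proof -
    have "?w i ?x = (\<Sum>j\<le>n. c j * unit_vector n a ?p 0 1 j i ?x)"
      by (rule functional_finsum[OF M.complex_space_axioms eval_linear[OF that one_vector_in]])
        (auto simp del: sum_fibre_simps intro: unit_vector_in[OF identity_in_Pn])
    also have "\<dots> = (\<Sum>j\<le>n. if j = i then c j else 0)"
      using that one_vector_in by (intro sum.cong) (auto simp: unit_vector_def)
    finally show ?thesis
      using that by simp
  qed
  then have "?w \<in> H \<longleftrightarrow> (\<exists>d. \<forall>j\<le>n. c j = d)"
    unfolding image_line_iff[OF identity_in_Pn one_vector_in w] by auto
  moreover have "H +>\<^bsub>M\<^esub> ?w = H \<longleftrightarrow> ?w \<in> H"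
    using M.a_rcos_const M.a_rcos_self[OF w] by auto
  ultimately show ?thesis
    unfolding sum by (simp add: identity_fibre_E del: sum_fibre_simps)
qed

lemma difference_linear:
  assumes "i \<le> n" "j \<le> n"
  shows "(\<lambda>v. v i (one_vector n) + (-1) * v j (one_vector n)) \<in> linear_maps M complex_line"
  using assms one_vector_in by (intro linear_mapsI) (auto simp: algebra_simps)

lemma difference_image_line:
  assumes "i \<le> n" "j \<le> n" "v \<in> H"
  shows "v i (one_vector n) + (-1) * v j (one_vector n) = 0"
  using assms one_vector_in by (auto simp: image_line_def)

lemma difference_functional_coset:
  assumes "i \<le> n" "j \<le> n" "v \<in> carrier M"
  shows "difference_functional i j (H +>\<^bsub>M\<^esub> v) = v i (one_vector n) - v j (one_vector n)"
proof -
  have "difference_functional i j (H +>\<^bsub>M\<^esub> v) = v i (one_vector n) + (-1) * v j (one_vector n)"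
    unfolding difference_functional_def
    by (rule M.quotient_functional_coset[OF difference_linear[OF assms(1,2)] _ assms(3)])
      (rule difference_image_line[OF assms(1,2)])
  then show ?thesis
    by simp
qed

lemma difference_functional_in:
  assumes "i \<le> n" "j \<le> n"
  shows "difference_functional i j \<in> carrier (identity_fibre n (dual_bundle n E))"
proof -
  have "difference_functional i j \<in> carrier (dual_space (quotient_space M H))"
    unfolding difference_functional_def
    by (rule M.quotient_functional_dual[OF difference_linear[OF assms]])
      (rule difference_image_line[OF assms])
  then show ?thesis
    by (simp only: identity_fibre_def dual_bundle_simps fibre_bundle_E[OF identity_in_Pn])
qed

lemma difference_functional_vector:
  assumes "i \<le> n" "j \<le> n" "m \<le> n"
  shows "difference_functional i j (fibre_vector m) = (if i = m then 1 else 0) - (if j = m then 1 else 0)"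
  unfolding fibre_vector_def difference_functional_coset[OF assms(1,2) unit_vector_in[OF identity_in_Pn]]
  using assms one_vector_in by (simp add: unit_vector_def)

text \<open>
  With all signs positive, the dual frame over the chart \<open>x\<^sub>k \<noteq> 0\<close> consists at the identity of the
  differences of the components \<open>j\<close> and \<open>k\<close>, for \<open>j \<noteq> k\<close>. The following signs turn them into
  the differences in which the smaller index comes first.
\<close>

definition order_sign :: "nat \<Rightarrow> nat \<Rightarrow> complex" where
  "order_sign k l = (if skip k l < k then 1 else -1)"

lemma order_sign_nonzero: "\<forall>l<n. order_sign k l \<noteq> 0"
  by (simp add: order_sign_def)

lemma dual_frame_identity:
  assumes k: "k \<le> n" and l: "l < n"
  shows "E.dual_frame n (frame_E n a k (order_sign k)) l (identity_point n)
    = difference_functional (min (skip k l) k) (max (skip k l) k)"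
proof (rule extensionalityI[of _ "carrier (identity_fibre n E)"])
  show "E.dual_frame n (frame_E n a k (order_sign k)) l (identity_point n)
      \<in> extensional (carrier (identity_fibre n E))"
    by (simp add: E.dual_frame_def identity_fibre_def)
  have le: "min (skip k l) k \<le> n" "max (skip k l) k \<le> n"
    using k skip_le[OF l, of k] by auto
  show "difference_functional (min (skip k l) k) (max (skip k l) k)
      \<in> extensional (carrier (identity_fibre n E))"
    using difference_functional_in[OF le] by (simp add: identity_fibre_def)
  fix C assume C: "C \<in> carrier (identity_fibre n E)"
  then obtain v where v: "v \<in> carrier M" "C = H +>\<^bsub>M\<^esub> v"
    unfolding identity_fibre_E by (rule M.coset_cases)
  have "E.dual_frame n (frame_E n a k (order_sign k)) l (identity_point n) C
      = frame_coord a k (order_sign k) (one_vector n) l v"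
    using C frame_E_coords[OF k order_sign_nonzero identity_in_coord_chart[OF k] one_vector_in v(1) l]
    by (simp add: E.dual_frame_def identity_fibre_def v(2))
  also have "\<dots> = difference_functional (min (skip k l) k) (max (skip k l) k) C"
    unfolding v(2) difference_functional_coset[OF le v(1)]
    using k skip_le[OF l, of k] by (auto simp: frame_coord_def Let_def order_sign_def min_def max_def)
  finally show "E.dual_frame n (frame_E n a k (order_sign k)) l (identity_point n) C
      = difference_functional (min (skip k l) k) (max (skip k l) k) C" .
qed

lemma bundle_E_pair:
  assumes n: "2 \<le> n"
  shows "corresponds_to_pair n E {..n} (Idl\<^bsub>cpoly_ring {..n}\<^esub> {\<Sum>j\<le>n. Var j})
    (\<lambda>i j. if i = j then int (a i) else 0)"
proof -
  have n0: "0 < n"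
    using n by simp
  let ?F = "identity_fibre n E"
  interpret F: complex_space ?F
    unfolding identity_fibre_def by (rule E.fibre_space[OF identity_in_Pn])
  have frame: "equivariant_frame n n E (coord_chart n k) (frame_E n a k (\<lambda>_. 1)) (frame_weight a k)"
    if "k \<le> n" for k
    using that by (intro equivariant_frame_E) auto
  have basis: "\<exists>B\<subseteq>fibre_vector ` {..n}. adapted_basis n E k B" if k: "k \<le> n" for k
    using E.adapted_basis_frame[OF n0 k frame[OF k]] frame_E_identity[OF k] skip_le
    by (intro exI[of _ "(\<lambda>l. frame_E n a k (\<lambda>_. 1) l (identity_point n)) ` {..<n}"]) auto
  have "lin_span ?F (fibre_vector ` {..n}) \<subseteq> carrier ?F"
    using fibre_vector_in by (intro F.lin_span_subset) auto
  moreover have "carrier ?F \<subseteq> lin_span ?F (fibre_vector ` {..n})"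
    using basis[of 0] lin_span_mono[of _ "fibre_vector ` {..n}" ?F]
    unfolding adapted_basis_def is_basis_def by blast
  ultimately have span: "lin_span ?F (fibre_vector ` {..n}) = carrier ?F"
    by blast
  have kernel: "Idl\<^bsub>cpoly_ring {..n}\<^esub> {\<Sum>j\<le>n. Var j}
      = a_kernel (cpoly_ring {..n}) (sym_algebra ?F) (to_sym ?F fibre_vector)"
  proof (rule F.kernel_to_sym)
    show S: "{\<Sum>j\<le>n. Var j} \<subseteq> carrier (cpoly_ring {..n})"
      by (auto intro!: cpoly_ring_sum)
    show "cpoly_subst Const (\<lambda>j. Var (fibre_vector j)) P \<in> sym_ideal ?F" if "P \<in> {\<Sum>j\<le>n. Var j}" for P
    proof -
      have "(\<Oplus>\<^bsub>?F\<^esub>j\<in>{..n}. 1 \<odot>\<^bsub>?F\<^esub> fibre_vector j) = 0 \<odot>\<^bsub>?F\<^esub> \<zero>\<^bsub>?F\<^esub>"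
        using fibre_vector_relation[of "\<lambda>_. 1"] by simp
      then have "Var (0 \<odot>\<^bsub>?F\<^esub> \<zero>\<^bsub>?F\<^esub>) - (\<Sum>j\<le>n. Const 1 * Var (fibre_vector j)) \<in> sym_ideal ?F"
        using F.sym_ideal_finsum[of "{..n}" fibre_vector "\<lambda>_. 1"] fibre_vector_in by simp
      from F.sym_ideal_simps(5)[OF F.sym_ideal_smult[OF F.M.zero_closed, of 0] this]
      show ?thesis
        using that by (simp add: Const.subst_sum Const.h_zero Const.h_one)
    qed
    fix c assume "(\<Oplus>\<^bsub>?F\<^esub>j\<in>{..n}. c j \<odot>\<^bsub>?F\<^esub> fibre_vector j) = \<zero>\<^bsub>?F\<^esub>"
    then obtain d where d: "\<And>j. j \<le> n \<Longrightarrow> c j = d"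
      unfolding fibre_vector_relation by blast
    have "(\<Sum>j\<le>n. Const (c j) * Var j) = Const d * (\<Sum>j\<le>n. Var j)"
      using d by (simp add: sum_distrib_left)
    moreover have "(\<Sum>j\<le>n. Var j) \<in> Idl\<^bsub>cpoly_ring {..n}\<^esub> {\<Sum>j\<le>n. Var j}"
      using ring.genideal_self[OF _ S] cring_cpoly by (auto simp: cring_def)
    ultimately show "(\<Sum>j\<le>n. Const (c j) * Var j) \<in> Idl\<^bsub>cpoly_ring {..n}\<^esub> {\<Sum>j\<le>n. Var j}"
      using cpoly_ideal_simps(6)[OF ideal_Idl[OF S]] by auto
  qed (use fibre_vector_in span in auto)
  have filtration: "fibre_vector j \<in> klyachko_filtration n E i r \<longleftrightarrow> r \<le> (if i = j then int (a i) else 0)"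
    if ij: "i \<le> n" "j \<le> n" for i j r
  proof -
    \<comment> \<open>The frame over \<open>x\<^sub>k \<noteq> 0\<close> contains the vector and determines the filtration of the ray \<open>i\<close>.\<close>
    obtain k where k: "k \<le> n" "k \<noteq> i" "k \<noteq> j"
      using n by (rule exists_third)
    obtain l where l: "l < n" "j = skip k l"
      using skip_cases[OF ij(2) k(3)[symmetric] k(1)] by metis
    show ?thesis
      using E.klyachko_filtration_frame_member[OF n0 k(1) ij(1) k(2)[symmetric] frame[OF k(1)] l(1)]
      by (simp add: frame_E_identity[OF k(1)] pairing_frame_weight[OF k(1) l(1) ij(1) k(2)[symmetric]] l(2))
  qed
  have "toric_vector_bundle n n E"
    using frame by (intro E.toric_vector_bundleI) blast
  then show ?thesis
    unfolding corresponds_to_pair_def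
    using fibre_vector_in span basis kernel filtration
    by (intro conjI bexI[of _ fibre_vector]) (auto simp del: dual_space_simps)
qed

lemma dual_bundle_E_pair:
  assumes n: "2 \<le> n"
  shows "corresponds_to_pair n (dual_bundle n E) {(i, j). i < j \<and> j \<le> n}
    (Idl\<^bsub>cpoly_ring {(i, j). i < j \<and> j \<le> n}\<^esub>
      {Var (i, k) - Var (i, j) - Var (j, k) | i j k. i < j \<and> j < k \<and> k \<le> n})
    (\<lambda>i (j, k). if i \<in> {j, k} then - int (a i) else 0)"
proof -
  have n0: "0 < n"
    using n by simp
  let ?J = "{(i, j). i < j \<and> j \<le> n}" and ?F = "identity_fibre n (dual_bundle n E)"
  let ?z = "\<lambda>(i, j). difference_functional i j"
  let ?S = "{Var (i, k) - Var (i, j) - Var (j, k) | i j k. i < j \<and> j < k \<and> k \<le> n} :: (nat \<times> nat) cpoly set"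
  interpret F: complex_space ?F
    unfolding identity_fibre_def by (rule D.fibre_space[OF identity_in_Pn])
  have F_dual: "?F = dual_space (identity_fibre n E)"
    by (simp add: identity_fibre_def)
  have J: "finite ?J"
    by (rule finite_subset[of _ "{..n} \<times> {..n}"]) auto
  have z_in: "?z x \<in> carrier ?F" if "x \<in> ?J" for x
    using that difference_functional_in by (auto simp del: dual_space_simps)
  have frame: "equivariant_frame n n (dual_bundle n E) (coord_chart n k)
      (E.dual_frame n (frame_E n a k (order_sign k))) (\<lambda>l j. - frame_weight a k l j)" if "k \<le> n" for k
    using that order_sign_nonzero by (intro E.equivariant_dual_frame equivariant_frame_E) auto
  have basis: "\<exists>B\<subseteq>?z ` ?J. adapted_basis n (dual_bundle n E) k B" if k: "k \<le> n" for k
  proof -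
    have "E.dual_frame n (frame_E n a k (order_sign k)) l (identity_point n) \<in> ?z ` ?J" if l: "l < n" for l
      unfolding dual_frame_identity[OF k l] using k skip_le[OF l, of k] skip_neq[of k l]
      by (intro image_eqI[of _ _ "(min (skip k l) k, max (skip k l) k)"]) (auto simp: min_def max_def)
    then show ?thesis
      using D.adapted_basis_frame[OF n0 k frame[OF k]]
      by (intro exI[of _ "(\<lambda>l. E.dual_frame n (frame_E n a k (order_sign k)) l (identity_point n)) ` {..<n}"]) auto
  qed
  have "lin_span ?F (?z ` ?J) \<subseteq> carrier ?F"
    using z_in by (intro F.lin_span_subset) blast
  moreover have "carrier ?F \<subseteq> lin_span ?F (?z ` ?J)"
    using basis[of 0] lin_span_mono[of _ "?z ` ?J" ?F]
    unfolding adapted_basis_def is_basis_def by blast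
  ultimately have span: "lin_span ?F (?z ` ?J) = carrier ?F"
    by blast
  have kernel: "Idl\<^bsub>cpoly_ring ?J\<^esub> ?S = a_kernel (cpoly_ring ?J) (sym_algebra ?F) (to_sym ?F ?z)"
  proof (rule F.kernel_to_sym[OF J z_in span])
    show S: "?S \<subseteq> carrier (cpoly_ring ?J)"
      by (auto intro!: cpoly_ring_diff)
    show "cpoly_subst Const (\<lambda>x. Var (?z x)) P \<in> sym_ideal ?F" if P: "P \<in> ?S" for P
    proof -
      obtain i j k where ijk: "i < j" "j < k" "k \<le> n" "P = Var (i, k) - Var (i, j) - Var (j, k)"
        using P by blast
      let ?d = difference_functional
      have le: "i \<le> n" "j \<le> n" "k \<le> n"
        using ijk by auto
      have "?d i k = ?d i j \<oplus>\<^bsub>?F\<^esub> ?d j k"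
      proof (rule extensionalityI[of _ "carrier (identity_fibre n E)"])
        show "?d i k \<in> extensional (carrier (identity_fibre n E))"
          "?d i j \<oplus>\<^bsub>?F\<^esub> ?d j k \<in> extensional (carrier (identity_fibre n E))"
          using difference_functional_in[OF le(1,3)] by (simp_all add: F_dual)
        fix C assume C: "C \<in> carrier (identity_fibre n E)"
        then obtain v where v: "v \<in> carrier M" "C = H +>\<^bsub>M\<^esub> v"
          unfolding identity_fibre_E by (rule M.coset_cases)
        then show "?d i k C = (?d i j \<oplus>\<^bsub>?F\<^esub> ?d j k) C"
          using C difference_functional_coset le by (simp add: F_dual)
      qed
      moreover have "Var (?d i j \<oplus>\<^bsub>?F\<^esub> ?d j k) - Var (?d i j) - Var (?d j k) \<in> sym_ideal ?F"
        using difference_functional_in le by (intro F.sym_ideal_add)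
      ultimately show ?thesis
        by (simp add: ijk(4) Const.subst_diff)
    qed
    fix c assume rel: "(\<Oplus>\<^bsub>?F\<^esub>x\<in>?J. c x \<odot>\<^bsub>?F\<^esub> ?z x) = \<zero>\<^bsub>?F\<^esub>"
    have L: "ideal (Idl\<^bsub>cpoly_ring ?J\<^esub> ?S) (cpoly_ring ?J)"
      by (rule ideal_Idl[OF S])
    note L' = cpoly_ideal_simps[OF L]
    have gen: "P \<in> Idl\<^bsub>cpoly_ring ?J\<^esub> ?S" if "P \<in> ?S" for P
      using ring.genideal_self[OF _ S] cring_cpoly that by (auto simp: cring_def)
    \<comment> \<open>Modulo the relations every variable is a difference of variables with first index \<open>0\<close>.\<close>
    define y where "y j = (if j = 0 then 0 else Var (0, j) :: (nat \<times> nat) cpoly)" for j :: nat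
    have reduce: "Var x + (y (fst x) - y (snd x)) \<in> Idl\<^bsub>cpoly_ring ?J\<^esub> ?S" if x: "x \<in> ?J" for x
    proof -
      obtain i j where ij: "x = (i, j)" "i < j" "j \<le> n"
        using x by auto
      show ?thesis
      proof (cases "i = 0")
        case True
        then show ?thesis
          using L'(2) ij by (simp add: y_def)
      next
        case False
        then have "Var (0, j) - Var (0, i) - Var (i, j) \<in> ?S"
          using ij by blast
        then have "- (Var (0, j) - Var (0, i) - Var (i, j)) \<in> Idl\<^bsub>cpoly_ring ?J\<^esub> ?S"
          by (intro L'(4) gen)
        then show ?thesis
          using False ij by (simp add: y_def algebra_simps)
      qed
    qed
    have "(\<Sum>x\<in>?J. Const (c x) * (Var x + (y (fst x) - y (snd x)))) \<in> Idl\<^bsub>cpoly_ring ?J\<^esub> ?S"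
      by (rule cpoly_ideal_sum[OF L]) (rule L'(6)[OF reduce cpoly_ring_closed(1)])
    moreover have "(\<Sum>x\<in>?J. Const (c x) * (y (fst x) - y (snd x))) = 0"
    proof -
      \<comment> \<open>Evaluating the relation at the \<open>m\<close>-th vector gives the coefficient of \<open>y m\<close>.\<close>
      have coeff: "(\<Sum>x\<in>?J. c x * ((if fst x = m then 1 else 0) - (if snd x = m then 1 else 0))) = 0"
        if m: "m \<le> n" for m
      proof -
        have "(\<Oplus>\<^bsub>?F\<^esub>x\<in>?J. c x \<odot>\<^bsub>?F\<^esub> ?z x) (fibre_vector m) = (\<Sum>x\<in>?J. c x * ?z x (fibre_vector m))"
          unfolding F_dual
        proof (rule functional_finsum[OF _ dual_eval_linear[OF fibre_vector_in] J])
          show "complex_space (dual_space (identity_fibre n E))"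
            using F.complex_space_axioms by (simp add: F_dual)
          show "?z x \<in> carrier (dual_space (identity_fibre n E))" if "x \<in> ?J" for x
            using z_in[OF that] by (simp only: F_dual)
        qed
        also have "\<dots> = (\<Sum>x\<in>?J. c x * ((if fst x = m then 1 else 0) - (if snd x = m then 1 else 0)))"
          using difference_functional_vector m by (intro sum.cong) auto
        finally show ?thesis
          unfolding rel using fibre_vector_in by (simp add: F_dual)
      qed
      have y_sum: "y i = (\<Sum>m\<le>n. Const (if i = m then 1 else 0) * y m)" if "i \<le> n" for i
      proof -
        have "(\<Sum>m\<le>n. Const (if i = m then 1 else 0) * y m) = (\<Sum>m\<le>n. if m = i then y m else 0)"
          by (intro sum.cong) (auto simp: Const.h_zero Const.h_one)
        then show ?thesis
          using that by simp
      qed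
      have "Const (c x) * (y (fst x) - y (snd x)) = (\<Sum>m\<le>n. Const (c x *
          ((if fst x = m then 1 else 0) - (if snd x = m then 1 else 0))) * y m)" if "x \<in> ?J" for x
      proof -
        have le: "fst x \<le> n" "snd x \<le> n"
          using that by auto
        show ?thesis
          by (subst y_sum[OF le(1)], subst y_sum[OF le(2)])
            (simp only: sum_subtractf[symmetric] sum_distrib_left Const.h_mult Const_diff left_diff_distrib mult.assoc right_diff_distrib)
      qed
      then have "(\<Sum>x\<in>?J. Const (c x) * (y (fst x) - y (snd x))) = (\<Sum>x\<in>?J. \<Sum>m\<le>n. Const (c x *
          ((if fst x = m then 1 else 0) - (if snd x = m then 1 else 0))) * y m)"
        by (intro sum.cong) auto
      also have "\<dots> = (\<Sum>m\<le>n. Const (\<Sum>x\<in>?J. c x *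
          ((if fst x = m then 1 else 0) - (if snd x = m then 1 else 0))) * y m)"
        by (subst sum.swap) (simp only: Const_sum sum_distrib_right)
      also have "\<dots> = 0"
        using coeff by (simp add: Const.h_zero)
      finally show ?thesis .
    qed
    ultimately show "(\<Sum>x\<in>?J. Const (c x) * Var x) \<in> Idl\<^bsub>cpoly_ring ?J\<^esub> ?S"
      by (simp add: distrib_left sum.distrib)
  qed
  \<comment> \<open>The frame over \<open>x\<^sub>k \<noteq> 0\<close> says nothing about the ray \<open>k\<close>, which is treated with the chart of the other index.\<close>
  have member: "difference_functional (min j k) (max j k) \<in> klyachko_filtration n (dual_bundle n E) i r
      \<longleftrightarrow> r \<le> (if i = j then - int (a i) else 0)"
    if le: "i \<le> n" "j \<le> n" "k \<le> n" "i \<noteq> k" "j \<noteq> k" for i j k r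
  proof -
    obtain l where l: "l < n" "j = skip k l"
      using skip_cases[OF le(2,5,3)] by metis
    have "pairing n (\<lambda>m. - frame_weight a k l m) (ray_generator n i)
        = - pairing n (frame_weight a k l) (ray_generator n i)"
      by (simp add: pairing_def sum_negf)
    then show ?thesis
      using D.klyachko_filtration_frame_member[OF n0 le(3,1,4) frame[OF le(3)] l(1)]
      by (simp add: dual_frame_identity[OF le(3) l(1)] pairing_frame_weight[OF le(3) l(1) le(1,4)] l(2))
  qed
  have filtration: "difference_functional j k \<in> klyachko_filtration n (dual_bundle n E) i r
      \<longleftrightarrow> r \<le> (if i \<in> {j, k} then - int (a i) else 0)"
    if "i \<le> n" "j < k" "k \<le> n" for i j k r
    using member[of i j k r] member[of i k j r] that by (cases "i = k") (auto simp: min_def max_def)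
  have "toric_vector_bundle n n (dual_bundle n E)"
    using frame by (intro D.toric_vector_bundleI) blast
  then show ?thesis
    unfolding corresponds_to_pair_def
    using J z_in span basis kernel filtration
    by (intro conjI bexI[of _ ?z]) (auto simp del: dual_space_simps)
qed

end

theorem theorem1p1:
  fixes n :: nat and a :: "nat \<Rightarrow> nat"
  assumes "n \<ge> 2" and "\<forall>i\<le>n. a i > 0"
  shows "corresponds_to_pair n (bundle_E n a) {..n}
           (Idl\<^bsub>cpoly_ring {..n}\<^esub> {\<Sum>j\<le>n. Var j})
           (\<lambda>i j. if i = j then int (a i) else 0)
       \<and> corresponds_to_pair n (dual_bundle n (bundle_E n a)) {(i, j). i < j \<and> j \<le> n}
           (Idl\<^bsub>cpoly_ring {(i, j). i < j \<and> j \<le> n}\<^esub>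
              {Var (i, k) - Var (i, j) - Var (j, k) | i j k. i < j \<and> j < k \<and> k \<le> n})
           (\<lambda>i (j, k). if i \<in> {j, k} then - int (a i) else 0)"
  using bundle_E_pair[OF assms(1)] dual_bundle_E_pair[OF assms(1)] by blast

end
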